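(* Let $\mathbf{A}$ be a kernel on $\mathbb{R}$ with values in $2\times2$ real matrices, of the form $$\mathbf{A}(x,y)=\begin{pmatrix}A(x,y)&-\partial_yA(x,y)\\-\partial_xA(x,y)&\partial_x\partial_yA(x,y)\end{pmatrix},$$ where $A$ is smooth and antisymmetric ($A(x,y)=-A(y,x)$), and suppose there exist constants $C>0$ and $a>b\geq0$ such that $$|\mathbf{A}_{11}(x,y)|<Ce^{-ax-ay},\quad|\mathbf{A}_{12}(x,y)|<Ce^{-ax+by},\quad|\mathbf{A}_{22}(x,y)|<Ce^{bx+by}.$$ Let $\mathbf{B}$ be the (distribution valued) kernel $$\mathbf{B}(x,y)=\begin{pmatrix}A(x,y)&-2\partial_yA(x,y)\\-2\partial_xA(x,y)&4\partial_x\partial_yA(x,y)+\delta'(x,y)\end{pmatrix}.$$ Then for any $x\in\mathbb{R}$, $$\mathrm{Pf}[J-\mathbf{A}]_{\mathbb{L}^2(x,+\infty)}=\mathrm{Pf}[J-\mathbf{B}]_{\mathbb{L}^2(x,+\infty)}.$$ In particular, $\mathrm{Pf}[J-K^{\rm GSE}]_{\mathbb{L}^2(x,+\infty)}=\mathrm{Pf}[J-K^{\infty}]_{\mathbb{L}^2(x,+\infty)}$, where $K^{\rm GSE}$ and $K^\infty$ are the kernels $\mathbf{A}$ and $\mathbf{B}$ corresponding to $A=K^{\rm GSE}_{11}$.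
   Context: Fredholm Pfaffian: $\mathrm{Pf}[J-K]_{\mathbb{L}^2(x,\infty)}=1+\sum_{k\geq1}\frac{(-1)^k}{k!}\int_{(x,\infty)^k}\mathrm{Pf}\big(K(x_i,x_j)\big)_{i,j=1}^k\,\mathrm{d}x_1\cdots\mathrm{d}x_k$, where the $2k\times2k$ skew-symmetric matrix is made of $k^2$ blocks of size $2\times2$. The distribution $\delta'$ acts on smooth functions $f$ with sufficient decay by $$\iint f(x,y)\delta'(x,y)\,\mathrm{d}x\,\mathrm{d}y=\int\big(\partial_yf(x,y)-\partial_xf(x,y)\big)\big|_{y=x}\,\mathrm{d}x ,$$ all integrals being over the domain $(x_0,\infty)$ when working on $\mathbb{L}^2(x_0,\infty)$; it is antisymmetric, $\delta'(x,y)=-\delta'(y,x)$. The quantity $\int_{(x_0,\infty)^k}\mathrm{Pf}[\mathbf{B}(x_i,x_j)]\mathrm{d}x_1\cdots\mathrm{d}x_k$ is defined by expanding the Pfaffian: each term is a product of factors $\delta'(x_r,x_s)$ on disjoint pairs of variables with a smooth function of all the variables, and each factor $\delta'(x_r,x_s)$ acts in its pair of variables by the formula above. The Fredholm Pfaffian of $\mathbf{B}$ is the resulting series, where $\int_{(x_0,\infty)^k}\mathrm{Pf}[\mathbf B]$ is thus a sum of $j$-fold integrals with $k-\lfloor k/2\rfloor\leq j\leq k$. $K^{\rm GSE}_{11}(x,y)=\int_{\mathcal{C}_1^{\pi/3}}\frac{\mathrm{d}z}{2\pi i}\int_{\mathcal{C}_1^{\pi/3}}\frac{\mathrm{d}w}{2\pi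 i}\frac{z-w}{4zw(z+w)}e^{z^3/3+w^3/3-xz-yw}$, where $\mathcal{C}_1^{\pi/3}$ consists of the two rays departing from $1$ with angles $\pm\pi/3$, oriented from $1+\infty e^{-i\pi/3}$ to $1+\infty e^{i\pi/3}$; $K^{\rm GSE}=\begin{pmatrix}A&-\partial_yA\\-\partial_xA&\partial_x\partial_yA\end{pmatrix}$ and $K^\infty=\begin{pmatrix}A&-2\partial_yA\\-2\partial_xA&4\partial_x\partial_yA+\delta'\end{pmatrix}$ with $A=K^{\rm GSE}_{11}$. For $\mathbb{L}^2(x_0,\infty)$ only the values of the kernels (and the decay bounds) on $(x_0,\infty)^2$ matter. *)

theory Defs
  imports "HOL-Analysis.Analysis" "HOL-Combinatorics.Permutations"
begin

section \<open>Smooth functions and partial derivatives\<close>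

primrec C_diff :: "nat \<Rightarrow> ('a::real_normed_vector \<Rightarrow> 'b::real_normed_vector) \<Rightarrow> bool" where
  "C_diff 0 f \<longleftrightarrow> continuous_on UNIV f"
| "C_diff (Suc n) f \<longleftrightarrow>
     (\<forall>p. f differentiable (at p)) \<and> (\<forall>v. C_diff n (\<lambda>p. frechet_derivative f (at p) v))"

definition smooth :: "('a::real_normed_vector \<Rightarrow> 'b::real_normed_vector) \<Rightarrow> bool" where
  "smooth f \<longleftrightarrow> (\<forall>n. C_diff n f)"

definition dx :: "(real \<Rightarrow> real \<Rightarrow> real) \<Rightarrow> real \<Rightarrow> real \<Rightarrow> real" where
  "dx f x y = deriv (\<lambda>t. f t y) x"

definition dy :: "(real \<Rightarrow> real \<Rightarrow> real) \<Rightarrow> real \<Rightarrow> real \<Rightarrow> real" where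
  "dy f x y = deriv (\<lambda>t. f x t) y"

definition pderiv_coord :: "nat \<Rightarrow> ((nat \<Rightarrow> real) \<Rightarrow> real) \<Rightarrow> (nat \<Rightarrow> real) \<Rightarrow> real" where
  "pderiv_coord j f x = deriv (\<lambda>t. f (x(j := t))) (x j)"

section \<open>Pfaffians and Fredholm Pfaffians of matrix kernels\<close>

text \<open>Rows and columns of a \<open>2k \<times> 2k\<close> matrix are indexed by \<open>0, \<dots>, 2k - 1\<close>.\<close>

definition pfaffian :: "nat \<Rightarrow> (nat \<Rightarrow> nat \<Rightarrow> real) \<Rightarrow> real" where
  "pfaffian k M =
     (\<Sum>\<sigma> | \<sigma> permutes {..<2*k}. of_int (sign \<sigma>) * (\<Prod>i<k. M (\<sigma> (2*i)) (\<sigma> (2*i+1))))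
       / (2^k * fact k)"

type_synonym kernel = "real \<Rightarrow> real \<Rightarrow> real^2^2"

text \<open>Index \<open>a\<close> of the block matrix belongs to the point \<open>x (a div 2)\<close>;
  even indices are the first row or column of their block, odd indices the second.\<close>

definition row_comp :: "nat \<Rightarrow> 2" where
  "row_comp a = (if even a then 1 else 2)"

definition block_matrix :: "kernel \<Rightarrow> (nat \<Rightarrow> real) \<Rightarrow> nat \<Rightarrow> nat \<Rightarrow> real" where
  "block_matrix K x a b = K (x (a div 2)) (x (b div 2)) $ row_comp a $ row_comp b"

abbreviation lebesgue_prod :: "nat set \<Rightarrow> (nat \<Rightarrow> real) measure" where
  "lebesgue_prod I \<equiv> Pi\<^sub>M I (\<lambda>_. lborel)"

abbreviation half_box :: "real \<Rightarrow> nat set \<Rightarrow> (nat \<Rightarrow> real) set" where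
  "half_box x0 I \<equiv> Pi\<^sub>E I (\<lambda>_. {x0<..})"

definition pfaffian_integral :: "kernel \<Rightarrow> real \<Rightarrow> nat \<Rightarrow> real" where
  "pfaffian_integral K x0 k =
     (LINT x : half_box x0 {..<k} | lebesgue_prod {..<k}. pfaffian k (block_matrix K x))"

definition fredholm_pfaffian :: "kernel \<Rightarrow> real \<Rightarrow> real" where
  "fredholm_pfaffian K x0 =
     1 + (\<Sum>n. (-1) ^ Suc n / fact (Suc n) * pfaffian_integral K x0 (Suc n))"

definition fredholm_pfaffian_converges :: "kernel \<Rightarrow> real \<Rightarrow> bool" where
  "fredholm_pfaffian_converges K x0 \<longleftrightarrow>
     (\<forall>k\<ge>1. set_integrable (lebesgue_prod {..<k}) (half_box x0 {..<k})
        (\<lambda>x. pfaffian k (block_matrix K x))) \<and>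
     summable (\<lambda>n. (-1) ^ Suc n / fact (Suc n) * pfaffian_integral K x0 (Suc n))"

section \<open>Kernels containing \<open>\<delta>'\<close>\<close>

text \<open>\<open>Dist_Kernel R D\<close> stands for the distribution-valued kernel
  \<open>R(x,y) + \<delta>'(x,y) D\<close> with a constant matrix \<open>D\<close>.\<close>

datatype dist_kernel = Dist_Kernel (reg: kernel) (delta_coeff: "real^2^2")

text \<open>\<open>\<integral>\<integral> f \<delta>'(x\<^sub>r,x\<^sub>s) dx\<^sub>r dx\<^sub>s = \<integral> (delta_act (r,s) f) dx\<^sub>r\<close>: the result is evaluated at
  \<open>x\<^sub>s = x\<^sub>r\<close> and no longer depends on the coordinate \<open>s\<close>, which drops out of the integration.\<close>

definition delta_act ::
  "nat \<times> nat \<Rightarrow> ((nat \<Rightarrow> real) \<Rightarrow> real) \<Rightarrow> (nat \<Rightarrow> real) \<Rightarrow> real" where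
  "delta_act p f x = (case p of (r, s) \<Rightarrow>
     pderiv_coord s f (x(s := x r)) - pderiv_coord r f (x(s := x r)))"

text \<open>Expanding each entry \<open>R + \<delta>' D\<close> of the \<open>i\<close>-th factor of the summand of the Pfaffian belonging
  to the permutation \<open>\<sigma>\<close>, the factors \<open>i \<in> S\<close> contribute \<open>\<delta>'\<close> and the others the regular part. If \<open>D\<close>
  vanishes outside its lower right entry, all terms in which two of the \<open>\<delta>'\<close> factors share a variable,
  or some \<open>\<delta>'\<close> factor has equal arguments, have coefficient 0.\<close>

definition point_pair :: "(nat \<Rightarrow> nat) \<Rightarrow> nat \<Rightarrow> nat \<times> nat" where
  "point_pair \<sigma> i = (\<sigma> (2*i) div 2, \<sigma> (2*i+1) div 2)"

definition dist_term_vars :: "nat \<Rightarrow> (nat \<Rightarrow> nat) \<Rightarrow> nat set \<Rightarrow> nat set" where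
  "dist_term_vars k \<sigma> S = {..<k} - (\<lambda>i. snd (point_pair \<sigma> i)) ` S"

definition dist_term ::
  "dist_kernel \<Rightarrow> nat \<Rightarrow> (nat \<Rightarrow> nat) \<Rightarrow> nat set \<Rightarrow> (nat \<Rightarrow> real) \<Rightarrow> real" where
  "dist_term K k \<sigma> S x =
     (\<Prod>i\<in>S. delta_coeff K $ row_comp (\<sigma> (2*i)) $ row_comp (\<sigma> (2*i+1))) *
     fold delta_act (map (point_pair \<sigma>) (sorted_list_of_set S))
       (\<lambda>x. \<Prod>i\<in>{..<k} - S. block_matrix (reg K) x (\<sigma> (2*i)) (\<sigma> (2*i+1))) x"

definition dist_pfaffian_integral :: "dist_kernel \<Rightarrow> real \<Rightarrow> nat \<Rightarrow> real" where
  "dist_pfaffian_integral K x0 k =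
     (\<Sum>\<sigma> | \<sigma> permutes {..<2*k}. of_int (sign \<sigma>) * (\<Sum>S\<in>Pow {..<k}.
        LINT x : half_box x0 (dist_term_vars k \<sigma> S) | lebesgue_prod (dist_term_vars k \<sigma> S).
          dist_term K k \<sigma> S x))
       / (2^k * fact k)"

definition dist_fredholm_pfaffian :: "dist_kernel \<Rightarrow> real \<Rightarrow> real" where
  "dist_fredholm_pfaffian K x0 =
     1 + (\<Sum>n. (-1) ^ Suc n / fact (Suc n) * dist_pfaffian_integral K x0 (Suc n))"

definition dist_fredholm_pfaffian_converges :: "dist_kernel \<Rightarrow> real \<Rightarrow> bool" where
  "dist_fredholm_pfaffian_converges K x0 \<longleftrightarrow>
     (\<forall>k\<ge>1. \<forall>\<sigma>. \<sigma> permutes {..<2*k} \<longrightarrow> (\<forall>S\<subseteq>{..<k}.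
        set_integrable (lebesgue_prod (dist_term_vars k \<sigma> S)) (half_box x0 (dist_term_vars k \<sigma> S))
          (dist_term K k \<sigma> S))) \<and>
     summable (\<lambda>n. (-1) ^ Suc n / fact (Suc n) * dist_pfaffian_integral K x0 (Suc n))"

section \<open>The two kernels attached to an antisymmetric function\<close>

definition kernel_A :: "(real \<Rightarrow> real \<Rightarrow> real) \<Rightarrow> kernel" where
  "kernel_A A x y = vector [vector [A x y, - dy A x y],
                            vector [- dx A x y, dx (dy A) x y]]"

definition kernel_B :: "(real \<Rightarrow> real \<Rightarrow> real) \<Rightarrow> dist_kernel" where
  "kernel_B A = Dist_Kernel
     (\<lambda>x y. vector [vector [A x y, - 2 * dy A x y],
                    vector [- 2 * dx A x y, 4 * dx (dy A) x y]])
     (vector [vector [0, 0], vector [0, 1]])"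

section \<open>The GSE kernel\<close>

text \<open>Integral over the rays from 1 with angles \<open>\<plusminus>\<pi>/3\<close>, oriented upwards; the lower ray is run through
  towards its starting point 1.\<close>

definition wedge_integral :: "(complex \<Rightarrow> complex) \<Rightarrow> complex" where
  "wedge_integral f =
     (LINT t : {0<..} | lborel. f (1 + of_real t * cis (pi/3)) * cis (pi/3)) -
     (LINT t : {0<..} | lborel. f (1 + of_real t * cis (-pi/3)) * cis (-pi/3))"

definition gse_integral :: "real \<Rightarrow> real \<Rightarrow> complex" where
  "gse_integral x y =
     wedge_integral (\<lambda>z. wedge_integral (\<lambda>w.
       (z - w) / (4 * z * w * (z + w)) *
       exp (z^3 / 3 + w^3 / 3 - of_real x * z - of_real y * w)
       / (2 * of_real pi * \<i>)) / (2 * of_real pi * \<i>))"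

lemma cnj_wedge_integral:
  "cnj (wedge_integral f) = - wedge_integral (\<lambda>z. cnj (f (cnj z)))"
  unfolding wedge_integral_def set_lebesgue_integral_def
  by (simp add: cis_cnj flip: Bochner_Integration.integral_cnj)

lemma Im_gse_integral: "Im (gse_integral x y) = 0"
proof -
  have neg: "wedge_integral (\<lambda>z. - f z) = - wedge_integral f" for f
    unfolding wedge_integral_def set_lebesgue_integral_def by simp
  have "cnj (gse_integral x y) = gse_integral x y"
    unfolding gse_integral_def
    by (simp add: cnj_wedge_integral exp_cnj neg flip: neg)
  then show ?thesis
    by (simp add: complex_eq_iff)
qed

text \<open>Taking the real part only changes the type, by the lemma \<open>Im_gse_integral\<close>.\<close>

definition K_GSE_11 :: "real \<Rightarrow> real \<Rightarrow> real" where
  "K_GSE_11 x y = Re (gse_integral x y)"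

definition K_GSE :: kernel where
  "K_GSE = kernel_A K_GSE_11"

definition K_infty :: dist_kernel where
  "K_infty = kernel_B K_GSE_11"

end

theory Submission
  imports Defs
begin

text \<open>Let \<open>a\<^sub>j = \<integral> Pf[\<^bold>A]\<close> over \<open>j\<close> points. In the expansion of \<open>\<integral> Pf[\<^bold>B]\<close> over \<open>k\<close> points, a factor \<open>\<delta>'(x\<^sub>r, x\<^sub>s)\<close> removes
  the second rows of the points \<open>r\<close> and \<open>s\<close>; differentiating the remaining first rows and putting \<open>x\<^sub>s = x\<^sub>r\<close>
  leaves, twice, the pair of rows that \<open>\<^bold>A\<close> attaches to the single point \<open>x\<^sub>r\<close>. Each of the other points
  contributes a factor 2 from its second row. Choosing \<open>m\<close> pairs among \<open>k\<close> points gives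
  \<open>b\<^sub>k = \<Sum>\<^sub>m k! / (m! (k - 2m)!) 2\<^bsup>k-2m\<^esup> a\<^bsub>k-m\<^esub>\<close>, so that the coefficient of \<open>(-1)\<^sup>j a\<^sub>j / j!\<close> in \<open>\<Sum>\<^sub>k (-1)\<^sup>k b\<^sub>k / k!\<close> is
  \<open>\<Sum>\<^sub>m (j choose m) (-1)\<^sup>m 2\<^bsup>j-m\<^esup> = 1\<close>. The rearrangement is legitimate because Hadamard's bound
  \<open>\<bar>a\<^sub>j\<bar> \<le> (c j)\<^bsup>j/2\<^esup>\<close> makes \<open>\<Sum>\<^sub>j 3\<^sup>j \<bar>a\<^sub>j\<bar> / j!\<close> finite.

  For the GSE kernel, \<open>A\<close> is a double exponential integral over a contour in \<open>Re z \<ge> 1\<close> on which the cubic exponent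
  beats every linear one; hence \<open>A\<close> is smooth and satisfies the decay hypotheses on \<open>(x\<^sub>0, \<infinity>)\<close> with \<open>a = 1\<close>, \<open>b = 0\<close>.\<close>

subsection \<open>Pfaffians and permutations\<close>

text \<open>Two obstacles shape the proof. Bounding a Pfaffian by its (2j)! / (2^j j!) pairings lets
  |a_j| / j! grow geometrically, so the series weighted by 3^j would converge only if C times the
  integral of the weights were small; Hadamard's bound removes this restriction. It applies because
  the decay hypotheses bound the entry of two rows by C times a product of row weights: the weights
  come out of the Pfaffian, and the two weights of a point multiply to exp (- (a - b) t), which is
  integrable. The other obstacle is bookkeeping. The integral of Pf[B] runs over all permutations
  and all sets S of factors, and every term is integrated over variables of its own. Permutations of
  the points and of the factors act on the terms and preserve signs and integrals, so one placement
  of the \<delta>' factors suffices and the rest is a count. There the minus sign in \<delta>' is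
  compensated by exchanging the two rows of the merged point; hence its two derivatives contribute
  equally only after summation over the permutations, not term by term.\<close>

lemma prod_lessThan_double:
  fixes f :: "nat \<Rightarrow> 'a::comm_monoid_mult"
  shows "(\<Prod>a<2*n. f a) = (\<Prod>i<n. f (2*i) * f (2*i+1))"
  by (induction n) (simp_all add: mult.assoc)

lemma sign_permutes_compose:
  assumes "finite S" "p permutes S" "q permutes S"
  shows "sign (p \<circ> q) = sign p * sign q"
  using assms by (metis sign_compose permutes_imp_permutation)

lemma sum_permutes_compose_left:
  assumes "q permutes S"
  shows "(\<Sum>p | p permutes S. f (q \<circ> p)) = (\<Sum>p | p permutes S. f p)"
  using setum_permutations_compose_left[OF assms, of f] by simp

lemma sum_permutes_compose_right:
  assumes "q permutes S"
  shows "(\<Sum>p | p permutes S. f (p \<circ> q)) = (\<Sum>p | p permutes S. f p)"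
  using sum_permutations_compose_right[OF assms, of f] by simp

text \<open>Lifts a permutation of points to rows, and one of factors to slots. The two members of a
  pair move together and keep their order, so parity, and with it the kind of a row, is
  preserved.\<close>

definition block_perm :: "(nat \<Rightarrow> nat) \<Rightarrow> nat \<Rightarrow> nat" where
  "block_perm p a = 2 * p (a div 2) + a mod 2"

lemma block_perm_simps [simp]:
  "block_perm p (2*i) = 2 * p i"
  "block_perm p (Suc (2*i)) = Suc (2 * p i)"
  "block_perm p a div 2 = p (a div 2)"
  "even (block_perm p a) \<longleftrightarrow> even a"
  "row_comp (block_perm p a) = row_comp a"
  by (auto simp: block_perm_def row_comp_def)

lemma block_perm_compose: "block_perm (p \<circ> q) = block_perm p \<circ> block_perm q"
  by (auto simp: block_perm_def fun_eq_iff)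

lemma block_perm_id: "block_perm id = id"
  by (auto simp: block_perm_def fun_eq_iff)

lemma block_perm_permutes:
  assumes "p permutes {..<k}"
  shows "block_perm p permutes {..<2*k}"
proof (rule bij_imp_permutes)
  have inv: "block_perm (inv p) \<circ> block_perm p = id" "block_perm p \<circ> block_perm (inv p) = id"
    using permutes_inv_o[OF assms] by (metis block_perm_compose block_perm_id)+
  have p: "block_perm q ` {..<2*k} \<subseteq> {..<2*k}" if "q permutes {..<k}" for q
  proof clarsimp
    fix a assume "a < 2*k"
    then have "q (a div 2) < k"
      using permutes_in_image[OF that, of "a div 2"] by auto
    then show "block_perm q a < 2*k"
      unfolding block_perm_def by linarith
  qed
  show "bij_betw (block_perm p) {..<2*k} {..<2*k}"
    by (rule bij_betw_byWitness[where f' = "block_perm (inv p)"])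
      (use inv p[OF assms] p[OF permutes_inv[OF assms]] in \<open>auto simp: fun_eq_iff\<close>)
  show "block_perm p x = x" if "x \<notin> {..<2*k}" for x
  proof -
    have "x div 2 \<notin> {..<k}" using that by auto
    then show ?thesis
      using assms by (simp add: block_perm_def permutes_not_in)
  qed
qed

text \<open>A transposition of points exchanges two pairs of rows and so is a product of two
  transpositions of rows. Relabelling therefore never costs a sign.\<close>

lemma sign_block_perm:
  assumes "p permutes {..<k}"
  shows "sign (block_perm p) = 1"
  using assms finite_lessThan
proof (induction rule: permutes_induct)
  case id
  then show ?case unfolding block_perm_id by simp
next
  case (swap a b p)
  have "block_perm (Transposition.transpose a b) = Transposition.transpose (2*a) (2*b) \<circ> Transposition.transpose (2*a+1) (2*b+1)"
  proof
    fix x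
    show "block_perm (Transposition.transpose a b) x = (Transposition.transpose (2*a) (2*b) \<circ> Transposition.transpose (2*a+1) (2*b+1)) x"
      by (cases "even x") (auto elim!: evenE oddE simp: Transposition.transpose_def)
  qed
  then have "sign (block_perm (Transposition.transpose a b)) = 1"
    using swap by (simp add: sign_compose permutation_swap_id sign_swap_id)
  moreover have "Transposition.transpose a b permutes {..<k}"
    using swap by (simp add: permutes_swap_id)
  ultimately show ?case
    using swap sign_permutes_compose[of "{..<2*k}" "block_perm (Transposition.transpose a b)" "block_perm p"]
    unfolding block_perm_compose by (simp add: block_perm_permutes del: o_apply)
qed

text \<open>Every row occurs exactly once in each term. This serves to divide the row weights out of
  the matrix before Hadamard's bound is applied.\<close>

lemma pfaffian_scale:
  "pfaffian n (\<lambda>a b. u a * u b * M a b) = (\<Prod>a<2*n. u a) * pfaffian n M"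
proof -
  have "(\<Prod>i<n. u (\<sigma> (2*i)) * u (\<sigma> (2*i+1)) * M (\<sigma> (2*i)) (\<sigma> (2*i+1)))
      = (\<Prod>a<2*n. u a) * (\<Prod>i<n. M (\<sigma> (2*i)) (\<sigma> (2*i+1)))" if "\<sigma> permutes {..<2*n}" for \<sigma>
  proof -
    have "(\<Prod>a<2*n. u a) = (\<Prod>a<2*n. u (\<sigma> a))"
      using prod.permute[OF that, of u] by (simp add: o_def)
    then show ?thesis
      by (simp add: prod_lessThan_double prod.distrib)
  qed
  then show ?thesis
    unfolding pfaffian_def by (simp add: sum_distrib_left algebra_simps)
qed

section \<open>Determinants in Leibniz form and the congruence rule for Pfaffians\<close>

definition leibniz_det :: "nat \<Rightarrow> (nat \<Rightarrow> nat \<Rightarrow> real) \<Rightarrow> real" where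
  "leibniz_det n B = (\<Sum>p | p permutes {..<n}. of_int (sign p) * (\<Prod>a<n. B a (p a)))"

lemma leibniz_det_rows_permuted:
  assumes "f permutes {..<n}"
  shows "leibniz_det n (\<lambda>a. B (f a)) = of_int (sign f) * leibniz_det n B"
proof -
  have "leibniz_det n (\<lambda>a. B (f a))
    = (\<Sum>p | p permutes {..<n}. of_int (sign (p \<circ> f)) * (\<Prod>a<n. B (f a) ((p \<circ> f) a)))"
    unfolding leibniz_det_def
    by (rule sum_permutes_compose_right[OF assms, symmetric,
          of "\<lambda>p. of_int (sign p) * (\<Prod>a<n. B (f a) (p a))"])
  also have "\<dots> = (\<Sum>p | p permutes {..<n}. of_int (sign f) * (of_int (sign p) * (\<Prod>a<n. B a (p a))))"
  proof (rule sum.cong)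
    fix p assume "p \<in> {p. p permutes {..<n}}"
    then show "real_of_int (sign (p \<circ> f)) * (\<Prod>a<n. B (f a) ((p \<circ> f) a)) =
         real_of_int (sign f) * (real_of_int (sign p) * (\<Prod>a<n. B a (p a)))"
      using prod.permute[OF assms, of "\<lambda>a. B a (p a)"] sign_permutes_compose[of "{..<n}" p f] assms
      by (simp add: o_def)
  qed auto
  finally show ?thesis
    by (simp add: leibniz_det_def sum_distrib_left)
qed

lemma leibniz_det_equal_rows:
  assumes "a < n" "b < n" "a \<noteq> b" "B a = B b"
  shows "leibniz_det n B = 0"
proof -
  have t: "Transposition.transpose a b permutes {..<n}"
    using assms by (simp add: permutes_swap_id)
  have "(\<lambda>c. B (Transposition.transpose a b c)) = B"
    using assms by (auto simp: Transposition.transpose_def fun_eq_iff)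
  then have "leibniz_det n B = - leibniz_det n B"
    using leibniz_det_rows_permuted[OF t, of B] assms by (simp add: sign_swap_id)
  then show ?thesis by simp
qed

text \<open>The rule Pf(B^T M B) = det B Pf M. Expanding every entry assigns a row
  \<open>f a\<close> to each slot \<open>a\<close>; summing over \<sigma> first leaves the
  determinant with rows \<open>B (f a)\<close>, which vanishes unless \<open>f\<close> is injective
  and otherwise is the sign of \<open>f\<close> times det B.\<close>

lemma pfaffian_congruence:
  fixes B M :: "nat \<Rightarrow> nat \<Rightarrow> real"
  shows "pfaffian n (\<lambda>a b. \<Sum>c<2*n. \<Sum>d<2*n. B c a * M c d * B d b) = leibniz_det (2*n) B * pfaffian n M"
proof -
  let ?I = "{..<2*n}" and ?F = "Pi\<^sub>E {..<2*n} (\<lambda>_. {..<2*n})"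
  let ?P = "\<lambda>f. \<Prod>i<n. M (f (2*i)) (f (2*i+1))"
  have fin: "finite ?F" by (intro finite_PiE) auto
  have expand: "(\<Prod>i<n. \<Sum>c<2*n. \<Sum>d<2*n. B c (\<sigma> (2*i)) * M c d * B d (\<sigma> (2*i+1)))
      = (\<Sum>f\<in>?F. ?P f * (\<Prod>a<2*n. B (f a) (\<sigma> a)))" for \<sigma>
  proof -
    have "(\<Prod>i<n. \<Sum>c<2*n. \<Sum>d<2*n. B c (\<sigma> (2*i)) * M c d * B d (\<sigma> (2*i+1)))
      = (\<Prod>i<n. \<Sum>(c,d)\<in>?I\<times>?I. B c (\<sigma> (2*i)) * M c d * B d (\<sigma> (2*i+1)))"
      by (simp add: sum.cartesian_product)
    also have "\<dots> = (\<Sum>g\<in>Pi\<^sub>E {..<n} (\<lambda>_. ?I\<times>?I). \<Prod>i<n. case g i of (c,d) \<Rightarrow> 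
         B c (\<sigma> (2*i)) * M c d * B d (\<sigma> (2*i+1)))"
      by (rule prod_sum_PiE) auto
    \<comment> \<open>A pair (c, d) for each of the n factors amounts to one index for each of the
      2n slots.\<close>
    also have "\<dots> = (\<Sum>f\<in>?F. \<Prod>i<n. B (f (2*i)) (\<sigma> (2*i)) * M (f (2*i)) (f (2*i+1)) * B (f (2*i+1)) (\<sigma> (2*i+1)))"
    proof (rule sum.reindex_bij_witness[where
          i = "\<lambda>f. \<lambda>i\<in>{..<n}. (f (2*i), f (2*i+1))" and
          j = "\<lambda>g. \<lambda>a\<in>?I. (if even a then fst (g (a div 2)) else snd (g (a div 2)))"], goal_cases)
      case (1 g)
      then show ?case by (auto simp: fun_eq_iff PiE_def extensional_def restrict_def)
    next
      case (2 g)
      then have "g (a div 2) \<in> ?I \<times> ?I" if "a < 2*n" for a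
        using that by (auto simp: PiE_iff)
      then show ?case by (force simp: PiE_iff)
    next
      case (3 f)
      then show ?case 
        by (auto simp: fun_eq_iff PiE_def extensional_def restrict_def elim!: evenE oddE)
    next
      case (4 f)
      then show ?case by (auto simp: PiE_iff)
    next
      case (5 g)
      then show ?case by (intro prod.cong) (auto split: prod.splits)
    qed
    also have "\<dots> = (\<Sum>f\<in>?F. ?P f * (\<Prod>a<2*n. B (f a) (\<sigma> a)))"
      unfolding prod_lessThan_double prod.distrib by (simp add: mult_ac)
    finally show ?thesis .
  qed
  have "(\<Sum>\<sigma> | \<sigma> permutes ?I. of_int (sign \<sigma>) * 
      (\<Prod>i<n. \<Sum>c<2*n. \<Sum>d<2*n. B c (\<sigma> (2*i)) * M c d * B d (\<sigma> (2*i+1))))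
    = (\<Sum>f\<in>?F. ?P f * leibniz_det (2*n) (\<lambda>a. B (f a)))"
    unfolding expand leibniz_det_def sum_distrib_left
    by (subst sum.swap) (simp add: mult_ac)
  also have "\<dots> = (\<Sum>f | f \<in> ?F \<and> inj_on f ?I. ?P f * leibniz_det (2*n) (\<lambda>a. B (f a)))"
  proof (rule sum.mono_neutral_right, goal_cases)
    case 3
    show ?case
    proof
      fix f assume "f \<in> ?F - {f. f \<in> ?F \<and> inj_on f ?I}"
      then obtain a b where "a < 2*n" "b < 2*n" "a \<noteq> b" "f a = f b"
        by (auto simp: inj_on_def)
      then have "leibniz_det (2*n) (\<lambda>a. B (f a)) = 0"
        by (intro leibniz_det_equal_rows[of a _ b]) auto
      then show "?P f * leibniz_det (2*n) (\<lambda>a. B (f a)) = 0" by simp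
    qed
  qed (use fin in auto)
  \<comment> \<open>Members of \<open>?F\<close> are \<open>undefined\<close> outside the index set,
    permutations are the identity there; hence the two conversions.\<close>
  also have "\<dots> = (\<Sum>f | f permutes ?I. ?P f * leibniz_det (2*n) (\<lambda>a. B (f a)))"
  proof (rule sum.reindex_bij_witness[where i = "\<lambda>f. restrict f ?I" and
        j = "\<lambda>f a. if a \<in> ?I then f a else a"], goal_cases)
    case (2 f)
    then have "f ` ?I \<subseteq> ?I" "inj_on f ?I" by auto
    then have "bij_betw f ?I ?I"
      using endo_inj_surj[of ?I f] by (simp add: bij_betw_def)
    then have "bij_betw (\<lambda>a. if a \<in> ?I then f a else a) ?I ?I"
      by (rule bij_betw_cong[THEN iffD1, rotated]) auto
    then show ?case
      by (auto intro!: bij_imp_permutes split: if_splits)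
  next
    case (4 f)
    then show ?case
      using permutes_in_image[of f ?I] by (auto simp: permutes_inj_on inj_on_restrict_eq PiE_iff)
  next
    case (5 f)
    have "leibniz_det (2*n) (\<lambda>a. B (f a)) = leibniz_det (2*n) (\<lambda>a. B (if a \<in> ?I then f a else a))"
      unfolding leibniz_det_def by (intro sum.cong refl) auto
    then show ?case by auto
  qed (auto simp: fun_eq_iff PiE_def extensional_def permutes_def)
  also have "\<dots> = (\<Sum>f | f permutes ?I. of_int (sign f) * ?P f) * leibniz_det (2*n) B"
    unfolding sum_distrib_right by (intro sum.cong) (auto simp: leibniz_det_rows_permuted)
  finally show ?thesis
    unfolding pfaffian_def by simp
qed


subsection \<open>A Hadamard bound for Pfaffians\<close>

lemma permutes_fixing_last_two:
  "{\<sigma>. \<sigma> permutes {..<2 * Suc n} \<and> \<sigma> (2*n) = 2*n \<and> \<sigma> (2*n+1) = 2*n+1} = {\<sigma>. \<sigma> permutes {..<2*n}}"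
proof (intro Collect_cong iffI conjI)
  fix \<sigma> :: "nat \<Rightarrow> nat"
  assume \<sigma>: "\<sigma> permutes {..<2 * Suc n} \<and> \<sigma> (2*n) = 2*n \<and> \<sigma> (2*n+1) = 2*n+1"
  show "\<sigma> permutes {..<2*n}"
  proof (rule permutes_superset)
    show "\<sigma> permutes {..<2 * Suc n}" using \<sigma> by blast
    show "\<sigma> x = x" if "x \<in> {..<2 * Suc n} - {..<2*n}" for x
    proof -
      have "x = 2*n \<or> x = 2*n+1" using that by auto
      then show ?thesis using \<sigma> by auto
    qed
  qed
next
  fix \<sigma> :: "nat \<Rightarrow> nat"
  assume \<sigma>: "\<sigma> permutes {..<2*n}"
  show "\<sigma> permutes {..<2 * Suc n}" by (rule permutes_subset[OF \<sigma>]) auto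
  show "\<sigma> (2*n) = 2*n" "\<sigma> (2*n+1) = 2*n+1" using \<sigma> by (auto simp: permutes_not_in)
qed

text \<open>By skewness the last column has its only nonzero entry in row 2n, so a nonzero term
  pairs 2n+1 with 2n. The index 2n+1 may stand in any of the \<open>2 * Suc n\<close> slots;
  exchanging factors, or the two slots of a factor, shows that all of them contribute equally, and
  their number is the quotient of the two normalisations.\<close>

lemma pfaffian_last_row:
  assumes skew: "\<And>a b. a < 2 * Suc n \<Longrightarrow> b < 2 * Suc n \<Longrightarrow> M a b = - M b a"
    and row: "\<And>b. b < 2*n \<Longrightarrow> M (2*n+1) b = 0"
  shows "pfaffian (Suc n) M = M (2*n) (2*n+1) * pfaffian n M"
proof -
  let ?I = "{..<2 * Suc n}" and ?z = "2*n+1"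
  define g where "g \<sigma> = real_of_int (sign \<sigma>) * (\<Prod>i<Suc n. M (\<sigma> (2*i)) (\<sigma> (2*i+1)))" for \<sigma>
  \<comment> \<open>The part of the Pfaffian sum in which slot \<open>c\<close> holds the index
    2n+1.\<close>
  define G where "G c = (\<Sum>\<sigma> | \<sigma> permutes ?I. if \<sigma> c = ?z then g \<sigma> else 0)" for c
  have inv: "G (t c) = G c" if t: "t permutes ?I" and "\<And>\<sigma>. \<sigma> permutes ?I \<Longrightarrow> g (\<sigma> \<circ> t) = g \<sigma>" for t c
  proof -
    have "G c = (\<Sum>\<sigma> | \<sigma> permutes ?I. if (\<sigma> \<circ> t) c = ?z then g (\<sigma> \<circ> t) else 0)"
      unfolding G_def
      by (rule sum_permutes_compose_right[OF t, symmetric, of "\<lambda>\<sigma>. if \<sigma> c = ?z then g \<sigma> else 0"])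
    also have "\<dots> = G (t c)"
      unfolding G_def using that by (intro sum.cong) auto
    finally show ?thesis by simp
  qed
  have swap: "g (\<sigma> \<circ> block_perm p) = g \<sigma>" if "\<sigma> permutes ?I" "p permutes {..<Suc n}" for \<sigma> p
  proof -
    have "(\<Prod>i<Suc n. M (\<sigma> (2*i)) (\<sigma> (2*i+1))) = (\<Prod>i<Suc n. M (\<sigma> (2*p i)) (\<sigma> (2*p i+1)))"
      using prod.permute[OF that(2), of "\<lambda>i. M (\<sigma> (2*i)) (\<sigma> (2*i+1))"] by (simp add: o_def)
    moreover have "sign (\<sigma> \<circ> block_perm p) = sign \<sigma>"
      using sign_permutes_compose[OF finite_lessThan that(1) block_perm_permutes[OF that(2)]] that
      by (simp add: sign_block_perm del: o_apply)
    ultimately show ?thesis by (simp add: g_def)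
  qed
  have flip: "g (\<sigma> \<circ> Transposition.transpose (2*n) ?z) = g \<sigma>" if \<sigma>: "\<sigma> permutes ?I" for \<sigma>
  proof -
    have t: "Transposition.transpose (2*n) ?z permutes ?I" by (rule permutes_swap_id) auto
    have "M (\<sigma> ?z) (\<sigma> (2*n)) = - M (\<sigma> (2*n)) (\<sigma> ?z)"
      using permutes_in_image[OF \<sigma>, of ?z] permutes_in_image[OF \<sigma>, of "2*n"] by (intro skew) auto
    moreover have "(\<Prod>i<n. M ((\<sigma> \<circ> Transposition.transpose (2*n) ?z) (2*i)) ((\<sigma> \<circ> Transposition.transpose (2*n) ?z) (2*i+1)))
        = (\<Prod>i<n. M (\<sigma> (2*i)) (\<sigma> (2*i+1)))"
      by (intro prod.cong) (auto simp: Transposition.transpose_def)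
    moreover have "sign (\<sigma> \<circ> Transposition.transpose (2*n) ?z) = - sign \<sigma>"
      using sign_permutes_compose[OF _ \<sigma> t] by (simp add: sign_swap_id)
    ultimately show ?thesis by (simp add: g_def)
  qed
  have G_eq: "G c = G ?z" if "c < 2 * Suc n" for c
  proof -
    let ?p = "Transposition.transpose (c div 2) n"
    have p: "?p permutes {..<Suc n}" using that by (intro permutes_swap_id) auto
    have c: "block_perm ?p c = (if even c then 2*n else ?z)"
      by (auto simp: block_perm_def odd_iff_mod_2_eq_one)
    have "G c = G (block_perm ?p c)"
      using inv[OF block_perm_permutes[OF p] swap[OF _ p]] by simp
    moreover have "G (2*n) = G (Transposition.transpose (2*n) ?z (2*n))"
      by (rule inv[symmetric]) (use flip in \<open>auto intro!: permutes_swap_id\<close>)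
    ultimately show ?thesis using c by (auto split: if_splits)
  qed
  have "(\<Sum>\<sigma> | \<sigma> permutes ?I. g \<sigma>) = (\<Sum>\<sigma> | \<sigma> permutes ?I. \<Sum>c\<in>?I. if \<sigma> c = ?z then g \<sigma> else 0)"
  proof (rule sum.cong[OF refl])
    fix \<sigma> assume "\<sigma> \<in> {\<sigma>. \<sigma> permutes ?I}"
    then have \<sigma>: "\<sigma> permutes ?I" by simp
    then have "\<sigma> c = ?z \<longleftrightarrow> c = inv \<sigma> ?z" for c
      using permutes_inv_eq by metis
    moreover have "inv \<sigma> ?z < 2 * Suc n"
      using permutes_in_image[OF permutes_inv[OF \<sigma>], of ?z] by simp
    ultimately show "g \<sigma> = (\<Sum>c\<in>?I. if \<sigma> c = ?z then g \<sigma> else 0)"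
      by (simp del: mult_Suc_right)
  qed
  also have "\<dots> = (\<Sum>c\<in>?I. G c)"
    unfolding G_def by (rule sum.swap)
  also have "\<dots> = (\<Sum>c\<in>?I. G ?z)"
    by (rule sum.cong[OF refl], rule G_eq) simp
  also have "\<dots> = 2 * real (Suc n) * G ?z"
    by simp
  also have "G ?z = (\<Sum>\<sigma> | \<sigma> permutes ?I \<and> \<sigma> (2*n) = 2*n \<and> \<sigma> ?z = ?z. g \<sigma>)"
    unfolding G_def sum.inter_filter[OF finite_permutations[OF finite_lessThan], symmetric]
  proof (rule sum.mono_neutral_right, goal_cases)
    case 3
    show ?case
    proof
      fix \<sigma> assume "\<sigma> \<in> {\<sigma> \<in> {\<sigma>. \<sigma> permutes ?I}. \<sigma> ?z = ?z} -
             {\<sigma>. \<sigma> permutes ?I \<and> \<sigma> (2*n) = 2*n \<and> \<sigma> ?z = ?z}"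
      then have \<sigma>: "\<sigma> permutes ?I" "\<sigma> ?z = ?z" "\<sigma> (2*n) \<noteq> 2*n" by auto
      have "\<sigma> (2*n) \<noteq> ?z"
        using \<sigma> inj_eq[OF permutes_inj[OF \<sigma>(1)], of "2*n" ?z] by auto
      moreover have "\<sigma> (2*n) < 2 * Suc n"
        using permutes_in_image[OF \<sigma>(1), of "2*n"] by simp
      ultimately have "\<sigma> (2*n) < 2*n" using \<sigma>(3) by simp
      then have "M (\<sigma> (2*n)) ?z = 0"
        using row[of "\<sigma> (2*n)"] skew[of "\<sigma> (2*n)" ?z] by simp
      then show "g \<sigma> = 0" using \<sigma> by (simp add: g_def)
    qed
  qed (auto simp: finite_permutations)
  also have "\<dots> = (\<Sum>\<sigma> | \<sigma> permutes {..<2*n}. M (2*n) ?z * 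
      (of_int (sign \<sigma>) * (\<Prod>i<n. M (\<sigma> (2*i)) (\<sigma> (2*i+1)))))"
    unfolding permutes_fixing_last_two
    by (intro sum.cong refl) (auto simp: g_def permutes_not_in)
  also have "\<dots> = M (2*n) ?z * (2^n * fact n) * pfaffian n M"
    by (simp add: pfaffian_def flip: sum_distrib_left)
  finally have total: "(\<Sum>\<sigma> | \<sigma> permutes ?I. g \<sigma>) = 2 * real (Suc n) * (M (2*n) ?z * (2^n * fact n) * pfaffian n M)" .
  have cancel: "c * (m * d * p) / (c * d) = m * p" if "c \<noteq> 0" "d \<noteq> 0" for c d m p :: real
    using that by simp
  have "2 ^ Suc n * fact (Suc n) = 2 * real (Suc n) * (2^n * fact n)"
    by simp
  then show ?thesis
    unfolding pfaffian_def[of "Suc n"] g_def[symmetric] total by (simp only:) (rule cancel, auto)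
qed

text \<open>The reflection I - 2 u u^T / |u|^2 with u = v - |v| e_p maps v to |v| e_p. The last
  property matters because the reflection is used as a congruence: in
  \<open>pfaffian_hadamard\<close> the vector v is the last row, whose diagonal entry is 0, so
  reflecting the columns does not mix the last row with the others.\<close>

lemma householder:
  fixes v :: "nat \<Rightarrow> real"
  assumes p: "p < N"
  obtains H where "\<And>a b. H a b = H b a"
    and "\<And>a b. a < N \<Longrightarrow> b < N \<Longrightarrow> (\<Sum>c<N. H a c * H c b) = (if a = b then 1 else 0)"
    and "\<And>a. a < N \<Longrightarrow> (\<Sum>b<N. H a b * v b) = (if a = p then sqrt (\<Sum>b<N. (v b)\<^sup>2) else 0)"
    and "\<And>q a. q \<noteq> p \<Longrightarrow> v q = 0 \<Longrightarrow> H q a = (if a = q then 1 else 0)"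
proof -
  define c where "c = sqrt (\<Sum>b<N. (v b)\<^sup>2)"
  define u where "u b = v b - (if b = p then c else 0)" for b
  define s where "s = (\<Sum>b<N. (u b)\<^sup>2)"
  \<comment> \<open>If v equals |v| e_p already, then u = 0 and s = 0; division by zero makes the
    quotient 0 and \<open>H\<close> the identity, which is the right choice.\<close>
  define H where "H a b = (if a = b then 1 else 0) - 2 * u a * u b / s" for a b
  have c2: "c\<^sup>2 = (\<Sum>b<N. (v b)\<^sup>2)"
    by (simp add: c_def sum_nonneg)
  have ind: "(\<Sum>b<N. (if b = q then x else 0) * f b) = x * f q" if "q < N" for q x and f :: "nat \<Rightarrow> real"
  proof -
    have "(\<Sum>b<N. (if b = q then x else 0) * f b) = (\<Sum>b<N. if b = q then x * f b else 0)"
      by (intro sum.cong) auto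
    then show ?thesis using that by simp
  qed
  have uv: "(\<Sum>b<N. u b * v b) = c\<^sup>2 - c * v p"
    using ind[OF p, of c v] c2 by (simp add: u_def left_diff_distrib sum_subtractf power2_eq_square)
  \<comment> \<open>The identity |u|^2 = 2 <u, v> holds because |v| e_p is as long as v; it is what
    makes the reflection send v there.\<close>
  have "s = (\<Sum>b<N. u b * v b) - (\<Sum>b<N. (if b = p then c else 0) * u b)"
    unfolding s_def sum_subtractf[symmetric]
    by (intro sum.cong refl) (simp add: u_def power2_eq_square algebra_simps)
  also have "\<dots> = 2 * (\<Sum>b<N. u b * v b)"
    unfolding ind[OF p, of c u] uv by (simp add: u_def power2_eq_square right_diff_distrib)
  finally have s: "s = 2 * (\<Sum>b<N. u b * v b)" .
  have u0: "u a = 0" if "s = 0" "a < N" for a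
    using that unfolding s_def by (subst (asm) sum_nonneg_eq_0_iff) auto
  show ?thesis
  proof
    show "H a b = H b a" for a b by (simp add: H_def)
    show "(\<Sum>c<N. H a c * H c b) = (if a = b then 1 else 0)" if "a < N" "b < N" for a b
    proof -
      have "(\<Sum>c<N. H a c * H c b) = (\<Sum>c<N. (if c = a then 1 else 0) * H c b) - 2 * u a / s * (\<Sum>c<N. u c * H c b)"
        by (simp add: H_def left_diff_distrib sum_subtractf sum_distrib_left mult_ac eq_commute[of a])
      also have "(\<Sum>c<N. u c * H c b) = (\<Sum>c<N. (if c = b then 1 else 0) * u c) - 2 * u b / s * (\<Sum>c<N. (u c)\<^sup>2)"
        unfolding sum_distrib_left sum_subtractf[symmetric]
        by (intro sum.cong refl) (simp add: H_def right_diff_distrib power2_eq_square)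
      also have "\<dots> = - u b"
        unfolding s_def[symmetric] using u0[OF _ that(2)] by (cases "s = 0") (simp_all add: ind[OF that(2)])
      finally show ?thesis
        by (simp add: ind[OF that(1)] H_def)
    qed
    show "(\<Sum>b<N. H a b * v b) = (if a = p then sqrt (\<Sum>b<N. (v b)\<^sup>2) else 0)" if "a < N" for a
    proof -
      have "(\<Sum>b<N. H a b * v b) = (\<Sum>b<N. (if b = a then 1 else 0) * v b) - u a / s * (2 * (\<Sum>b<N. u b * v b))"
        unfolding sum_distrib_left sum_subtractf[symmetric]
        by (intro sum.cong refl) (auto simp: H_def left_diff_distrib)
      also have "\<dots> = v a - u a"
        unfolding s[symmetric] using u0[OF _ that] by (cases "s = 0") (simp_all add: ind[OF that])
      finally show ?thesis by (simp add: u_def c_def)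
    qed
    show "H q a = (if a = q then 1 else 0)" if "q \<noteq> p" "v q = 0" for q a
      using that by (simp add: H_def u_def)
  qed
qed

text \<open>H H^T = 1 makes w -> H^T w an isometry. Applied on both sides of a matrix, it shows that
  an orthogonal congruence preserves the sum of the squares of the entries.\<close>

lemma orthogonal_sum_squares:
  fixes H :: "nat \<Rightarrow> nat \<Rightarrow> real"
  assumes "\<And>a b. a < N \<Longrightarrow> b < N \<Longrightarrow> (\<Sum>c<N. H a c * H b c) = (if a = b then 1 else 0)"
  shows "(\<Sum>a<N. (\<Sum>c<N. w c * H c a)\<^sup>2) = (\<Sum>c<N. (w c)\<^sup>2)"
proof -
  have "(\<Sum>a<N. (\<Sum>c<N. w c * H c a)\<^sup>2) = (\<Sum>a<N. \<Sum>c<N. \<Sum>d<N. w c * w d * (H c a * H d a))"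
    by (simp add: power2_eq_square sum_product mult_ac)
  also have "\<dots> = (\<Sum>c<N. \<Sum>d<N. w c * w d * (\<Sum>a<N. H c a * H d a))"
    by (subst sum.swap) (unfold sum_distrib_left, intro sum.cong refl sum.swap)
  also have "\<dots> = (\<Sum>c<N. \<Sum>d<N. if d = c then w c * w d else 0)"
    by (intro sum.cong refl) (auto simp: assms)
  finally show ?thesis by (simp add: power2_eq_square)
qed

text \<open>The inequality of arithmetic and geometric means for x and n copies of q. It is
  Bernoulli's inequality for \<open>y\<close>, the relative excess of the mean over q.\<close>

lemma mult_power_le_mean_power:
  fixes x q :: real
  assumes "x \<ge> 0" "q \<ge> 0"
  shows "x * q ^ n \<le> ((x + n * q) / Suc n) ^ Suc n"
proof (cases "q = 0")
  case True
  with assms show ?thesis by (cases n) auto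
next
  case False
  define y where "y = (x - q) / (Suc n * q)"
  have q: "q > 0" using False assms by simp
  have "Suc n * q * y = x - q" using q by (simp add: y_def)
  then have x: "x = q * (1 + Suc n * y)" by (simp add: algebra_simps)
  have "(x - q) / (Suc n * q) \<ge> - 1"
  proof (subst pos_le_divide_eq)
    have "0 \<le> x + n * q" using q assms by simp
    then show "- 1 * (Suc n * q) \<le> x - q" by (simp add: algebra_simps)
  qed (use q in auto)
  then have "1 + Suc n * y \<le> (1 + y) ^ Suc n"
    unfolding y_def by (rule Bernoulli_inequality)
  then have "q ^ Suc n * (1 + Suc n * y) \<le> q ^ Suc n * (1 + y) ^ Suc n"
    using q by (intro mult_left_mono) auto
  moreover have "x + n * q = Suc n * (q * (1 + y))" unfolding x by (simp add: algebra_simps)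
  then have "(x + n * q) / Suc n = q * (1 + y)" by simp
  ultimately show ?thesis
    unfolding power_mult_distrib[symmetric] by (simp add: x mult_ac)
qed

text \<open>A Householder reflection \<open>H\<close> makes the last row a multiple of a unit vector and preserves the sum of
  the squares of the entries. That \<open>(det H)\<^sup>2 = 1\<close> follows by applying the congruence rule to \<open>H\<close> twice.\<close>

lemma pfaffian_hadamard:
  assumes "\<And>a b. a < 2*n \<Longrightarrow> b < 2*n \<Longrightarrow> M a b = - M b a"
  shows "(pfaffian n M)\<^sup>2 \<le> ((\<Sum>a<2*n. \<Sum>b<2*n. (M a b)\<^sup>2) / (2*n)) ^ n"
  using assms
proof (induction n arbitrary: M)
  case 0
  then show ?case by (simp add: pfaffian_def)
next
  case (Suc n)
  let ?z = "2*n+1"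
  define N where "N = 2 * Suc n"
  then have zN: "?z < N" "2*n < N" by simp_all
  note skew = Suc.prems[folded N_def]
  define F where "F = (\<Sum>a<N. \<Sum>b<N. (M a b)\<^sup>2)"
  obtain H where sym: "\<And>a b. H a b = H b a"
    and orth: "\<And>a b. a < N \<Longrightarrow> b < N \<Longrightarrow> (\<Sum>c<N. H a c * H c b) = (if a = b then 1 else 0)"
    and Hv: "\<And>a. a < N \<Longrightarrow> (\<Sum>b<N. H a b * M ?z b) = (if a = 2*n then sqrt (\<Sum>b<N. (M ?z b)\<^sup>2) else 0)"
    and Hz: "\<And>q a. q \<noteq> 2*n \<Longrightarrow> M ?z q = 0 \<Longrightarrow> H q a = (if a = q then 1 else 0)"
    using householder[OF zN(2), of "M ?z"] by blast
  define c where "c = sqrt (\<Sum>b<N. (M ?z b)\<^sup>2)"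
  define M' where "M' a b = (\<Sum>c<N. \<Sum>d<N. H c a * M c d * H d b)" for a b
  have orth': "(\<Sum>c<N. H a c * H b c) = (if a = b then 1 else 0)" if "a < N" "b < N" for a b
    using orth[OF that] by (simp add: sym[of b])
  have skew': "M' a b = - M' b a" for a b
  proof -
    have "M' a b = (\<Sum>d<N. \<Sum>c<N. H c a * M c d * H d b)"
      unfolding M'_def by (rule sum.swap)
    also have "\<dots> = (\<Sum>d<N. \<Sum>c<N. - (H d b * M d c * H c a))"
    proof (intro sum.cong refl)
      fix c d assume "c \<in> {..<N}" "d \<in> {..<N}"
      then have "M c d = - M d c" by (intro skew) auto
      then show "H c a * M c d * H d b = - (H d b * M d c * H c a)" by simp
    qed
    finally show ?thesis by (simp add: M'_def sum_negf)
  qed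
  \<comment> \<open>The diagonal entry vanishes by skewness, so the reflection fixes the index
    \<open>?z\<close>, and the new row \<open>?z\<close> is just the reflected old one.\<close>
  have "M ?z ?z = - M ?z ?z" by (rule skew) (use zN in auto)
  then have "H ?z a = (if a = ?z then 1 else 0)" for a using Hz[of ?z a] by simp
  then have Hc: "H c ?z = (if c = ?z then 1 else 0)" for c using sym[of ?z c] by simp
  have Mz: "M' ?z b = (if b = 2*n then c else 0)" if "b < N" for b
  proof -
    have "M' ?z b = (\<Sum>c<N. if c = ?z then (\<Sum>d<N. M c d * H d b) else 0)"
      unfolding M'_def by (intro sum.cong refl) (simp add: Hc[simplified])
    also have "\<dots> = (\<Sum>d<N. H b d * M ?z d)"
      using zN by (simp add: sym[of b] mult.commute)
    finally show ?thesis using Hv[OF that] by (simp add: c_def)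
  qed
  have F': "(\<Sum>a<N. \<Sum>b<N. (M' a b)\<^sup>2) = F"
  proof -
    have "M' a b = (\<Sum>d<N. (\<Sum>c<N. M c d * H c a) * H d b)" for a b
      unfolding M'_def sum_distrib_right by (subst sum.swap) (simp only: mult_ac)
    then have "(\<Sum>b<N. (M' a b)\<^sup>2) = (\<Sum>d<N. (\<Sum>c<N. M c d * H c a)\<^sup>2)" for a
      using orthogonal_sum_squares[OF orth', of "\<lambda>d. \<Sum>c<N. M c d * H c a"] by simp
    then have "(\<Sum>a<N. \<Sum>b<N. (M' a b)\<^sup>2) = (\<Sum>d<N. \<Sum>a<N. (\<Sum>c<N. M c d * H c a)\<^sup>2)"
      by (subst sum.swap) simp
    also have "\<dots> = (\<Sum>d<N. \<Sum>c<N. (M c d)\<^sup>2)"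
      using orthogonal_sum_squares[OF orth'] by simp
    also have "\<dots> = F" unfolding F_def by (rule sum.swap)
    finally show ?thesis .
  qed
  define Q where "Q = (\<Sum>a<2*n. \<Sum>b<2*n. (M' a b)\<^sup>2)"
  have Q0: "Q \<ge> 0" unfolding Q_def by (intro sum_nonneg) auto
  have split: "(\<Sum>a<N. f a) = (\<Sum>a<2*n. f a) + f (2*n) + f ?z" for f :: "nat \<Rightarrow> real"
    by (simp add: N_def)
  have zc: "(M' (2*n) ?z)\<^sup>2 = c\<^sup>2" using Mz[of "2*n"] skew'[of "2*n" ?z] zN by simp
  \<comment> \<open>By skewness the entry of size c stands both in row 2n and in row 2n+1, and these
    rows are disjoint from the 2n by 2n corner that \<open>Q\<close> measures.\<close>
  have Q: "Q + 2 * c\<^sup>2 \<le> F"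
  proof -
    have "F = (\<Sum>a<2*n. \<Sum>b<N. (M' a b)\<^sup>2) + (\<Sum>b<N. (M' (2*n) b)\<^sup>2) + (\<Sum>b<N. (M' ?z b)\<^sup>2)"
      unfolding F'[symmetric] split by (rule refl)
    moreover have "Q \<le> (\<Sum>a<2*n. \<Sum>b<N. (M' a b)\<^sup>2)"
      unfolding Q_def using zN by (intro sum_mono sum_mono2) auto
    moreover have "(M' (2*n) ?z)\<^sup>2 \<le> (\<Sum>b<N. (M' (2*n) b)\<^sup>2)" "(M' ?z (2*n))\<^sup>2 \<le> (\<Sum>b<N. (M' ?z b)\<^sup>2)"
      by (rule member_le_sum; use zN in simp)+
    ultimately show ?thesis using zc skew'[of ?z "2*n"] by simp
  qed
  have pf': "pfaffian (Suc n) M' = M' (2*n) ?z * pfaffian n M'"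
    by (rule pfaffian_last_row[OF skew']) (use Mz zN in auto)
  have "(pfaffian (Suc n) M')\<^sup>2 \<le> c\<^sup>2 * (Q / (2*n)) ^ n"
    unfolding pf' power_mult_distrib zc Q_def
    by (intro mult_left_mono Suc.IH skew') auto
  \<comment> \<open>The mean of c^2 and n copies of Q / (2n) is at most (c^2 + Q / 2) / Suc n, and
    the estimate for \<open>Q\<close> bounds this by F / N.\<close>
  also have "\<dots> \<le> ((c\<^sup>2 + n * (Q / (2*n))) / Suc n) ^ Suc n"
    using Q0 by (intro mult_power_le_mean_power) auto
  also have "\<dots> \<le> (F / N) ^ Suc n"
  proof (intro power_mono)
    show "(c\<^sup>2 + n * (Q / (2*n))) / Suc n \<le> F / N"
    proof -
      have "c\<^sup>2 + n * (Q / (2*n)) \<le> F / 2" using Q Q0 by (cases "n = 0") auto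
      then have "(c\<^sup>2 + n * (Q / (2*n))) / Suc n \<le> F / 2 / Suc n"
        by (intro divide_right_mono) auto
      then show ?thesis by (simp add: N_def)
    qed
  qed (use Q0 in auto)
  finally have M'_bound: "(pfaffian (Suc n) M')\<^sup>2 \<le> (F / N) ^ Suc n" .
  have cong: "pfaffian (Suc n) M' = leibniz_det N H * pfaffian (Suc n) M"
    unfolding M'_def N_def by (rule pfaffian_congruence)
  have "pfaffian (Suc n) M = pfaffian (Suc n) (\<lambda>a b. \<Sum>c<N. \<Sum>d<N. H c a * M' c d * H d b)"
  proof -
    have eq: "M a b = (\<Sum>c<N. \<Sum>d<N. H c a * M' c d * H d b)" if "a < N" "b < N" for a b
    proof -
      have "(\<Sum>c<N. \<Sum>d<N. H c a * M' c d * H d b)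
          = (\<Sum>c<N. \<Sum>d<N. \<Sum>e<N. \<Sum>f<N. (H a c * H c e) * M e f * (H f d * H d b))"
        unfolding M'_def sum_distrib_left sum_distrib_right
        by (intro sum.cong refl) (simp only: sym mult_ac)
      also have "\<dots> = (\<Sum>c<N. \<Sum>e<N. \<Sum>f<N. \<Sum>d<N. (H a c * H c e) * M e f * (H f d * H d b))"
        by (rule sum.cong[OF refl], subst sum.swap, rule sum.cong[OF refl], rule sum.swap)
      also have "\<dots> = (\<Sum>e<N. \<Sum>f<N. \<Sum>c<N. \<Sum>d<N. (H a c * H c e) * M e f * (H f d * H d b))"
        by (subst sum.swap, rule sum.cong[OF refl], rule sum.swap)
      also have "\<dots> = (\<Sum>e<N. \<Sum>f<N. (\<Sum>c<N. H a c * H c e) * M e f * (\<Sum>d<N. H f d * H d b))"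
        unfolding sum_distrib_left sum_distrib_right
        by (rule sum.cong[OF refl], rule sum.cong[OF refl], rule sum.swap)
      also have "\<dots> = (\<Sum>e<N. \<Sum>f<N. if e = a then (if f = b then M e f else 0) else 0)"
        using that by (intro sum.cong refl) (simp add: orth)
      also have "\<dots> = (\<Sum>e<N. if e = a then M e b else 0)"
        using that by (intro sum.cong refl) (simp)
      also have "\<dots> = M a b"
        using that by (simp)
      finally show ?thesis by simp
    qed
    have "M (\<sigma> (2*i)) (\<sigma> (2*i+1)) = (\<Sum>c<N. \<Sum>d<N. H c (\<sigma> (2*i)) * M' c d * H d (\<sigma> (2*i+1)))"
      if "\<sigma> permutes {..<2 * Suc n}" "i < Suc n" for \<sigma> i
      using that permutes_in_image[OF that(1)] by (intro eq) (auto simp: N_def)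
    then show ?thesis
      unfolding pfaffian_def by simp
  qed
  also have "\<dots> = leibniz_det N H * pfaffian (Suc n) M'"
    unfolding N_def by (rule pfaffian_congruence)
  finally have "pfaffian (Suc n) M = (leibniz_det N H)\<^sup>2 * pfaffian (Suc n) M"
    unfolding cong power2_eq_square mult.assoc .
  then have "pfaffian (Suc n) M = 0 \<or> (leibniz_det N H)\<^sup>2 = 1"
    by (metis mult_cancel_right mult_1)
  then have "(pfaffian (Suc n) M)\<^sup>2 = (pfaffian (Suc n) M')\<^sup>2"
    unfolding cong power_mult_distrib by auto
  then show ?case
    using M'_bound unfolding F_def N_def by (simp only: of_nat_mult of_nat_numeral)
qed


subsection \<open>Smooth functions of two variables\<close>

lemma smooth_C_diff: "smooth f \<Longrightarrow> C_diff n f"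
  by (simp add: smooth_def)

lemma smooth_differentiable: "smooth f \<Longrightarrow> f differentiable (at p)"
  using smooth_C_diff[of f "Suc 0"] by simp

lemma smooth_continuous: "smooth f \<Longrightarrow> continuous_on UNIV f"
  using smooth_C_diff[of f 0] by simp

lemma smooth_frechet_derivative:
  assumes "smooth f"
  shows "smooth (\<lambda>p. frechet_derivative f (at p) v)"
  using smooth_C_diff[OF assms, of "Suc n" for n] by (simp add: smooth_def)

lemma smooth_has_derivative_fst:
  assumes "smooth (case_prod A)"
  shows "((\<lambda>t. A t y) has_real_derivative frechet_derivative (case_prod A) (at (x, y)) (1, 0)) (at x)"
proof -
  have "(case_prod A has_derivative frechet_derivative (case_prod A) (at (x, y))) (at (x, y))"
    by (simp only: frechet_derivative_works[symmetric] smooth_differentiable[OF assms])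
  moreover have "((\<lambda>t. (t, y)) has_derivative (\<lambda>h. (h, 0))) (at x)"
    by (auto intro!: derivative_eq_intros)
  ultimately have D: "((\<lambda>t. A t y) has_derivative (\<lambda>h. frechet_derivative (case_prod A) (at (x, y)) (h, 0))) (at x)"
    using has_derivative_compose[of "\<lambda>t. (t, y)" "\<lambda>h. (h, 0)" x UNIV "case_prod A" "frechet_derivative (case_prod A) (at (x, y))"]
    by simp
  have lin: "linear (frechet_derivative (case_prod A) (at (x, y)))"
    by (rule linear_frechet_derivative[OF smooth_differentiable[OF assms]])
  have scale: "frechet_derivative (case_prod A) (at (x, y)) (h, 0) = h * frechet_derivative (case_prod A) (at (x, y)) (1, 0)" for h
    using linear_cmul[OF lin, of h "(1, 0)"] by simp
  have "(\<lambda>h. frechet_derivative (case_prod A) (at (x, y)) (h, 0)) = (*) (frechet_derivative (case_prod A) (at (x, y)) (1, 0))"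
    by (intro ext trans[OF scale mult.commute])
  with D show ?thesis
    unfolding has_field_derivative_def by simp
qed

lemma smooth_has_derivative_snd:
  assumes "smooth (case_prod A)"
  shows "((\<lambda>t. A x t) has_real_derivative frechet_derivative (case_prod A) (at (x, y)) (0, 1)) (at y)"
proof -
  have "(case_prod A has_derivative frechet_derivative (case_prod A) (at (x, y))) (at (x, y))"
    by (simp only: frechet_derivative_works[symmetric] smooth_differentiable[OF assms])
  moreover have "((\<lambda>t. (x, t)) has_derivative (\<lambda>h. (0, h))) (at y)"
    by (auto intro!: derivative_eq_intros)
  ultimately have D: "((\<lambda>t. A x t) has_derivative (\<lambda>h. frechet_derivative (case_prod A) (at (x, y)) (0, h))) (at y)"
    using has_derivative_compose[of "\<lambda>t. (x, t)" "\<lambda>h. (0, h)" y UNIV "case_prod A" "frechet_derivative (case_prod A) (at (x, y))"]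
    by simp
  have lin: "linear (frechet_derivative (case_prod A) (at (x, y)))"
    by (rule linear_frechet_derivative[OF smooth_differentiable[OF assms]])
  have scale: "frechet_derivative (case_prod A) (at (x, y)) (0, h) = h * frechet_derivative (case_prod A) (at (x, y)) (0, 1)" for h
    using linear_cmul[OF lin, of h "(0, 1)"] by simp
  have "(\<lambda>h. frechet_derivative (case_prod A) (at (x, y)) (0, h)) = (*) (frechet_derivative (case_prod A) (at (x, y)) (0, 1))"
    by (intro ext trans[OF scale mult.commute])
  with D show ?thesis
    unfolding has_field_derivative_def by simp
qed

text \<open>\<open>smooth\<close> speaks of Frechet derivatives in fixed directions, the kernels of
  one-variable derivatives. This bridge lets smoothness pass to \<open>dx A\<close>.\<close>

lemma dx_eq_frechet:
  assumes "smooth (case_prod A)"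
  shows "case_prod (dx A) = (\<lambda>p. frechet_derivative (case_prod A) (at p) (1, 0))"
  using DERIV_imp_deriv[OF smooth_has_derivative_fst[OF assms]] by (auto simp: dx_def fun_eq_iff)

lemma dy_eq_frechet:
  assumes "smooth (case_prod A)"
  shows "case_prod (dy A) = (\<lambda>p. frechet_derivative (case_prod A) (at p) (0, 1))"
  using DERIV_imp_deriv[OF smooth_has_derivative_snd[OF assms]] by (auto simp: dy_def fun_eq_iff)

lemma smooth_dx: "smooth (case_prod A) \<Longrightarrow> smooth (case_prod (dx A))"
  by (simp add: dx_eq_frechet smooth_frechet_derivative)

lemma smooth_dy: "smooth (case_prod A) \<Longrightarrow> smooth (case_prod (dy A))"
  by (simp add: dy_eq_frechet smooth_frechet_derivative)

lemma has_derivative_dx: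
  assumes "smooth (case_prod A)"
  shows "((\<lambda>t. A t y) has_real_derivative dx A x y) (at x)"
  using smooth_has_derivative_fst[OF assms, of y x] fun_cong[OF dx_eq_frechet[OF assms], of "(x, y)"] by simp

lemma has_derivative_dy:
  assumes "smooth (case_prod A)"
  shows "((\<lambda>t. A x t) has_real_derivative dy A x y) (at y)"
  using smooth_has_derivative_snd[OF assms, of x y] fun_cong[OF dy_eq_frechet[OF assms], of "(x, y)"] by simp

lemma continuous_on_smooth_pair:
  assumes "smooth (case_prod A)" "continuous_on S f" "continuous_on S g"
  shows "continuous_on S (\<lambda>z. A (f z) (g z))"
  using continuous_on_compose2[OF smooth_continuous[OF assms(1)] continuous_on_Pair[OF assms(2,3)]] by simp

text \<open>Differentiating the second row of the kernel in its second argument produces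
  \<open>dy (dx A)\<close>, whereas the matrix contains \<open>dx (dy A)\<close>. As A x s - A x a
  is the integral of \<open>dy A x\<close> over {a..s}, differentiation under the integral writes
  \<open>dx A x s\<close> as a constant plus the integral of \<open>dx (dy A) x\<close>, which can
  be differentiated in s.\<close>

theorem mixed_partials_commute:
  assumes A: "smooth (case_prod A)"
  shows "dx (dy A) x y = dy (dx A) x y"
proof -
  note dyA = smooth_dy[OF A]
  note dxdyA = smooth_dx[OF dyA]
  \<comment> \<open>This places y in the interior of {a..y+1}, where a derivative within the
    interval is a two-sided one.\<close>
  define a where "a = y - 1"
  have cont: "continuous_on S (\<lambda>s. dx (dy A) x s)" for x S
    by (intro continuous_on_smooth_pair[OF dxdyA] continuous_intros)
  have int: "integral {a..s} (dy A x) = A x s - A x a" if "s \<ge> a" for x s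
  proof (rule integral_unique, rule fundamental_theorem_of_calculus[OF that])
    fix t show "(A x has_vector_derivative dy A x t) (at t within {a..s})"
      using has_derivative_dy[OF A, of x t]
      by (simp add: has_real_derivative_iff_has_vector_derivative has_vector_derivative_at_within)
  qed
  have D: "dx A x s = dx A x a + integral {a..s} (dx (dy A) x)" if "s \<ge> a" for s
  proof -
    have "((\<lambda>x. integral (cbox a s) (dy A x)) has_field_derivative integral (cbox a s) (dx (dy A) x)) (at x within UNIV)"
    proof (rule leibniz_rule_field_derivative)
      show "((\<lambda>x. dy A x t) has_real_derivative dx (dy A) x t) (at x within UNIV)" for x t
        using has_derivative_dx[OF dyA] .
      show "dy A x integrable_on cbox a s" for x
        by (intro integrable_continuous continuous_on_smooth_pair[OF dyA] continuous_intros)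
      show "continuous_on (UNIV \<times> cbox a s) (\<lambda>(x, t). dx (dy A) x t)"
        using smooth_continuous[OF dxdyA] continuous_on_subset by blast
    qed auto
    then have "((\<lambda>x. A x s - A x a) has_real_derivative integral {a..s} (dx (dy A) x)) (at x)"
      by (simp add: int[OF that])
    moreover have "((\<lambda>x. A x s - A x a) has_real_derivative dx A x s - dx A x a) (at x)"
      by (intro DERIV_diff has_derivative_dx[OF A])
    ultimately show ?thesis using DERIV_unique by fastforce
  qed
  have "((\<lambda>s. integral {a..s} (dx (dy A) x)) has_real_derivative dx (dy A) x y) (at y within {a..y+1})"
    by (rule integral_has_real_derivative[OF cont]) (auto simp: a_def)
  then have "((\<lambda>s. dx A x a + integral {a..s} (dx (dy A) x)) has_real_derivative dx (dy A) x y) (at y within {a..y+1})"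
    by (auto intro!: derivative_eq_intros)
  then have "((\<lambda>s. dx A x s) has_real_derivative dx (dy A) x y) (at y within {a..y+1})"
  proof (rule has_field_derivative_transform_within[where d = 1])
    show "dx A x a + integral {a..s} (dx (dy A) x) = dx A x s" if "s \<in> {a..y+1}" for s
      using that by (intro D[symmetric]) simp
  qed (simp_all add: a_def)
  then have "((\<lambda>s. dx A x s) has_real_derivative dx (dy A) x y) (at y)"
    by (simp add: at_within_Icc_at a_def)
  then show ?thesis
    using has_derivative_dy[OF smooth_dx[OF A], of x y] DERIV_unique by blast
qed

lemma dx_antisymmetric:
  assumes "smooth (case_prod A)" "\<And>x y. A x y = - A y x"
  shows "dx A x y = - dy A y x"
proof -
  have "(\<lambda>t. A t y) = (\<lambda>t. - A y t)" using assms(2) by blast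
  then show ?thesis
    using DERIV_minus[OF has_derivative_dy[OF assms(1), of y x]] has_derivative_dx[OF assms(1), of y x]
      DERIV_unique by metis
qed


subsection \<open>The action of products of \<open>\<delta>'\<close>\<close>

text \<open>Row \<open>a\<close> of the regular part of \<open>\<^bold>B\<close> after differentiation at the points in \<open>d\<close>, expressed through \<open>\<^bold>A\<close>:
  the derivative of a first row is minus the second row of \<open>\<^bold>A\<close>.\<close>

definition diff_comp :: "nat set \<Rightarrow> nat \<Rightarrow> 2" where
  "diff_comp d a = (if odd a \<or> a div 2 \<in> d then 2 else 1)"

definition diff_coeff :: "nat set \<Rightarrow> nat \<Rightarrow> real" where
  "diff_coeff d a = (if odd a then 2 else if a div 2 \<in> d then - 1 else 1)"

definition diff_entry :: "(real \<Rightarrow> real \<Rightarrow> real) \<Rightarrow> nat set \<Rightarrow> (nat \<Rightarrow> real) \<Rightarrow> nat \<Rightarrow> nat \<Rightarrow> real" where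
  "diff_entry A d x a b = diff_coeff d a * diff_coeff d b *
     kernel_A A (x (a div 2)) (x (b div 2)) $ diff_comp d a $ diff_comp d b"

lemma kernel_A_entries [simp]:
  "kernel_A A x y $ 1 $ 1 = A x y"
  "kernel_A A x y $ 1 $ 2 = - dy A x y"
  "kernel_A A x y $ 2 $ 1 = - dx A x y"
  "kernel_A A x y $ 2 $ 2 = dx (dy A) x y"
  by (simp_all add: kernel_A_def)

lemma reg_kernel_B_block: "block_matrix (reg (kernel_B A)) x a b = diff_entry A {} x a b"
  by (simp add: block_matrix_def kernel_B_def diff_entry_def diff_coeff_def diff_comp_def row_comp_def)

lemma delta_coeff_kernel_B:
  "delta_coeff (kernel_B A) $ row_comp a $ row_comp b = (if odd a \<and> odd b then 1 else 0)"
  by (simp add: kernel_B_def row_comp_def)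

lemma diff_entry_derivative_left:
  assumes A: "smooth (case_prod A)" and a: "a = 2*p" "p \<notin> d" and b: "b div 2 \<noteq> p"
  shows "((\<lambda>t. diff_entry A d (x(p := t)) a b) has_real_derivative diff_entry A (insert p d) x a b) (at (x p))"
proof -
  have der: "((\<lambda>t. kernel_A A t y $ 1 $ c) has_real_derivative - kernel_A A u y $ 2 $ c) (at u)" for y c u
  proof (cases "c = 1")
    case True
    then show ?thesis using has_derivative_dx[OF A] by simp
  next
    case False
    then have "c = 2" using exhaust_2 by blast
    then show ?thesis using DERIV_minus[OF has_derivative_dx[OF smooth_dy[OF A]]] by simp
  qed
  from DERIV_cmult[OF der, of "diff_coeff d b" "x (b div 2)" "diff_comp d b" "x p"]
  show ?thesis
    using a b by (cases "odd b"; cases "b div 2 \<in> d")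
      (simp_all add: diff_entry_def diff_comp_def diff_coeff_def del: kernel_A_entries)
qed

lemma diff_entry_derivative_right:
  assumes A: "smooth (case_prod A)" and b: "b = 2*p" "p \<notin> d" and a: "a div 2 \<noteq> p"
  shows "((\<lambda>t. diff_entry A d (x(p := t)) a b) has_real_derivative diff_entry A (insert p d) x a b) (at (x p))"
proof -
  have der: "((\<lambda>t. kernel_A A y t $ c $ 1) has_real_derivative - kernel_A A y u $ c $ 2) (at u)" for y c u
  proof (cases "c = 1")
    case True
    then show ?thesis using has_derivative_dy[OF A] by simp
  next
    case False
    then have "c = 2" using exhaust_2 by blast
    then show ?thesis
      using DERIV_minus[OF has_derivative_dy[OF smooth_dx[OF A]]] by (simp add: mixed_partials_commute[OF A])
  qed
  from DERIV_cmult[OF der, of "diff_coeff d a" "x (a div 2)" "diff_comp d a" "x p"]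
  show ?thesis
    using a b by (cases "odd a"; cases "a div 2 \<in> d")
      (simp_all add: diff_entry_def diff_comp_def diff_coeff_def del: kernel_A_entries)
qed

lemma diff_entry_other_point:
  assumes "a div 2 \<noteq> p" "b div 2 \<noteq> p"
  shows "diff_entry A (insert p d) x a b = diff_entry A d x a b"
    and "diff_entry A d (x(p := t)) a b = diff_entry A d x a b"
  using assms by (simp_all add: diff_entry_def diff_comp_def diff_coeff_def)

text \<open>The situation at a point whose second row is used up by a \<delta>' factor: only its
  first row is left, so a derivative at \<open>p\<close> hits a single factor of the product, and
  only one argument of it.\<close>

definition lone_row :: "(nat \<Rightarrow> nat) \<Rightarrow> nat set \<Rightarrow> nat \<Rightarrow> bool" where
  "lone_row \<sigma> I p \<longleftrightarrow> (\<exists>i0\<in>I. (\<sigma> (2*i0) = 2*p \<and> \<sigma> (2*i0+1) div 2 \<noteq> p \<or>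
       \<sigma> (2*i0+1) = 2*p \<and> \<sigma> (2*i0) div 2 \<noteq> p) \<and>
     (\<forall>i\<in>I - {i0}. \<sigma> (2*i) div 2 \<noteq> p \<and> \<sigma> (2*i+1) div 2 \<noteq> p))"

lemma diff_entry_prod_derivative:
  assumes A: "smooth (case_prod A)" and I: "finite I" "lone_row \<sigma> I p" and p: "p \<notin> d"
  shows "((\<lambda>t. \<Prod>i\<in>I. diff_entry A d (x(p := t)) (\<sigma> (2*i)) (\<sigma> (2*i+1))) has_real_derivative
     (\<Prod>i\<in>I. diff_entry A (insert p d) x (\<sigma> (2*i)) (\<sigma> (2*i+1)))) (at (x p))"
proof -
  obtain i0 where i0: "i0 \<in> I" and
    pair: "\<sigma> (2*i0) = 2*p \<and> \<sigma> (2*i0+1) div 2 \<noteq> p \<or> \<sigma> (2*i0+1) = 2*p \<and> \<sigma> (2*i0) div 2 \<noteq> p"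
    and other: "\<And>i. i \<in> I - {i0} \<Longrightarrow> \<sigma> (2*i) div 2 \<noteq> p \<and> \<sigma> (2*i+1) div 2 \<noteq> p"
    using I(2) unfolding lone_row_def by blast
  have split: "(\<Prod>i\<in>I. f i) = f i0 * (\<Prod>i\<in>I - {i0}. f i)" for f :: "nat \<Rightarrow> real"
    by (rule prod.remove[OF I(1) i0])
  have D: "((\<lambda>t. diff_entry A d (x(p := t)) (\<sigma> (2*i0)) (\<sigma> (2*i0+1))) has_real_derivative
      diff_entry A (insert p d) x (\<sigma> (2*i0)) (\<sigma> (2*i0+1))) (at (x p))"
    using pair diff_entry_derivative_left[OF A _ p] diff_entry_derivative_right[OF A _ p] by blast
  have "(\<Prod>i\<in>I - {i0}. diff_entry A d (x(p := t)) (\<sigma> (2*i)) (\<sigma> (2*i+1))) =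
      (\<Prod>i\<in>I - {i0}. diff_entry A (insert p d) x (\<sigma> (2*i)) (\<sigma> (2*i+1)))" for t
    using other by (intro prod.cong refl) (simp add: diff_entry_other_point)
  then show ?thesis
    unfolding split by (simp only:) (rule DERIV_cmult_right[OF D])
qed

text \<open>The combined substitution x_s = x_r over all pairs \<open>P i = (r, s)\<close> with i in
  T, written as a map on indices so that the substituted point is
  \<open>x \<circ> merge_pairs P T\<close>.\<close>

definition merge_pairs :: "(nat \<Rightarrow> nat \<times> nat) \<Rightarrow> nat set \<Rightarrow> nat \<Rightarrow> nat" where
  "merge_pairs P T p = (if \<exists>i\<in>T. snd (P i) = p then fst (P (SOME i. i \<in> T \<and> snd (P i) = p)) else p)"

lemma merge_pairs_snd:
  assumes "i \<in> T" "inj_on (snd \<circ> P) T"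
  shows "merge_pairs P T (snd (P i)) = fst (P i)"
proof -
  have "(SOME j. j \<in> T \<and> snd (P j) = snd (P i)) = i"
    using assms by (intro some_equality) (auto simp: inj_on_def)
  then show ?thesis using assms by (auto simp: merge_pairs_def)
qed

lemma merge_pairs_other: "p \<notin> (snd \<circ> P) ` T \<Longrightarrow> merge_pairs P T p = p"
  by (auto simp: merge_pairs_def)

lemma merge_pairs_cases:
  "merge_pairs P T p = p \<or> (\<exists>i\<in>T. merge_pairs P T p = fst (P i))"
proof (cases "\<exists>i\<in>T. snd (P i) = p")
  case True
  then have "(SOME i. i \<in> T \<and> snd (P i) = p) \<in> T \<and> snd (P (SOME i. i \<in> T \<and> snd (P i) = p)) = p"
    by (intro someI_ex[of "\<lambda>i. i \<in> T \<and> snd (P i) = p"]) blast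
  with True show ?thesis unfolding merge_pairs_def by auto
qed (auto simp: merge_pairs_def)

text \<open>Each \<open>\<delta>'\<close> factor differentiates with respect to one point of its pair; \<open>E\<close> is the set of the
  factors for which this is the first one.\<close>

definition diff_points :: "(nat \<Rightarrow> nat \<times> nat) \<Rightarrow> nat set \<Rightarrow> nat set \<Rightarrow> nat set" where
  "diff_points P T E = (fst \<circ> P) ` E \<union> (snd \<circ> P) ` (T - E)"

definition disjoint_pairs :: "(nat \<Rightarrow> nat \<times> nat) \<Rightarrow> nat set \<Rightarrow> bool" where
  "disjoint_pairs P T \<longleftrightarrow> inj_on (fst \<circ> P) T \<and> inj_on (snd \<circ> P) T \<and> (\<forall>i\<in>T. \<forall>j\<in>T. fst (P i) \<noteq> snd (P j))"

text \<open>Each \<delta>' yields the derivative at its second point minus the one at its first;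
  multiplying out gives a sum over the set \<open>E\<close> of factors that use the first. The
  induction appends at the end of the list because \<open>fold\<close> applies the last element
  last. Disjointness of the pairs makes the earlier substitutions and derivatives invisible at the
  new points. The closed form depends on the list only through its set, so the order in which the
  \<delta>' act is immaterial.\<close>

lemma fold_delta_act:
  assumes A: "smooth (case_prod A)" and I: "finite I"
    and S: "distinct L" "disjoint_pairs P (set L)"
    and lone: "\<And>i. i \<in> set L \<Longrightarrow> lone_row \<sigma> I (fst (P i)) \<and> lone_row \<sigma> I (snd (P i))"
  shows "fold delta_act (map P L) (\<lambda>x. \<Prod>i\<in>I. diff_entry A {} x (\<sigma> (2*i)) (\<sigma> (2*i+1))) =
    (\<lambda>x. \<Sum>E\<in>Pow (set L). (-1) ^ card E *
       (\<Prod>i\<in>I. diff_entry A (diff_points P (set L) E) (x \<circ> merge_pairs P (set L)) (\<sigma> (2*i)) (\<sigma> (2*i+1))))"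
  using S lone
proof (induction L rule: rev_induct)
  case Nil
  then show ?case by (simp add: diff_points_def merge_pairs_def o_def)
next
  case (snoc j L)
  obtain r s where P: "P j = (r, s)" by fastforce
  then have Pj: "fst (P j) = r" "snd (P j) = s" by simp_all
  let ?Q = "\<lambda>d x. \<Prod>i\<in>I. diff_entry A d x (\<sigma> (2*i)) (\<sigma> (2*i+1))"
  define q where "q = merge_pairs P (set L)"
  define d where "d E = diff_points P (set L) E" for E
  define F where "F x = (\<Sum>E\<in>Pow (set L). (-1) ^ card E * ?Q (d E) (x \<circ> q))" for x
  have j: "j \<notin> set L" and L: "distinct L" "disjoint_pairs P (set L)"
    using snoc.prems by (auto simp: disjoint_pairs_def)
  have IH: "fold delta_act (map P L) (?Q {}) = F"
    using snoc.IH[OF L] snoc.prems(3) unfolding F_def d_def q_def comp_def by auto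
  have r: "fst (P i) \<noteq> r" "snd (P i) \<noteq> r" and s: "fst (P i) \<noteq> s" "snd (P i) \<noteq> s" if "i \<in> set L" for i
    using that snoc.prems(2) j P by (force simp: disjoint_pairs_def inj_on_def)+
  have qrs: "q r = r" "q s = s"
    unfolding q_def using r s by (intro merge_pairs_other; force)+
  have q_other: "p \<noteq> r \<Longrightarrow> q p \<noteq> r" "p \<noteq> s \<Longrightarrow> q p \<noteq> s" for p
    using merge_pairs_cases[of P "set L" p] r(1) s(1) unfolding q_def by metis+
  have d: "r \<notin> d E" "s \<notin> d E" if "E \<subseteq> set L" for E
  proof -
    have "\<exists>i\<in>set L. p = fst (P i) \<or> p = snd (P i)" if "p \<in> d E" for p
      using that \<open>E \<subseteq> set L\<close> unfolding d_def diff_points_def by auto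
    then show "r \<notin> d E" "s \<notin> d E" using r s by metis+
  qed
  \<comment> \<open>The earlier substitution \<open>q\<close> fixes r and s and sends no other index
    there, so varying coordinate \<open>p\<close> of \<open>y\<close> varies exactly coordinate
    \<open>p\<close> of \<open>y \<circ> q\<close>.\<close>
  have pd: "pderiv_coord p F y = (\<Sum>E\<in>Pow (set L). (-1) ^ card E * ?Q (insert p (d E)) (y \<circ> q))"
    if p: "p \<in> {r, s}" for p y
  proof -
    have "y(p := t) \<circ> q = (y \<circ> q)(p := t)" for t
      using p qrs q_other by (auto simp: fun_eq_iff)
    then have "(\<lambda>t. F (y(p := t))) = (\<lambda>t. \<Sum>E\<in>Pow (set L). (-1) ^ card E * ?Q (d E) ((y \<circ> q)(p := t)))"
      unfolding F_def by simp
    moreover have "((\<lambda>t. \<Sum>E\<in>Pow (set L). (-1) ^ card E * ?Q (d E) ((y \<circ> q)(p := t))) has_real_derivative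
       (\<Sum>E\<in>Pow (set L). (-1) ^ card E * ?Q (insert p (d E)) (y \<circ> q))) (at ((y \<circ> q) p))"
      using p snoc.prems(3)[of j] P d
      by (intro DERIV_sum DERIV_cmult diff_entry_prod_derivative[OF A I]) auto
    moreover have "(y \<circ> q) p = y p" using p qrs by auto
    ultimately show ?thesis
      unfolding pderiv_coord_def by (simp add: DERIV_imp_deriv)
  qed
  have set_eq: "set (L @ [j]) = insert j (set L)" by simp
  have merge: "x(s := x r) \<circ> q = x \<circ> merge_pairs P (insert j (set L))" for x :: "nat \<Rightarrow> real"
  proof
    fix p
    have inj: "inj_on (snd \<circ> P) (insert j (set L))"
      using snoc.prems(2) unfolding disjoint_pairs_def set_eq by blast
    show "(x(s := x r) \<circ> q) p = (x \<circ> merge_pairs P (insert j (set L))) p"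
    proof (cases "\<exists>i\<in>insert j (set L). snd (P i) = p")
      case True
      then obtain i where i: "i \<in> insert j (set L)" "p = snd (P i)" by blast
      then have "merge_pairs P (insert j (set L)) p = fst (P i)"
        using merge_pairs_snd[OF _ inj] by blast
      moreover have "q p = fst (P i)" if "i \<noteq> j"
        using i that merge_pairs_snd[of i "set L" P] L unfolding q_def disjoint_pairs_def by blast
      moreover have "i \<noteq> j \<Longrightarrow> fst (P i) \<noteq> s" using s i by auto
      ultimately show ?thesis using i Pj qrs by (cases "i = j") auto
    next
      case False
      then have "q p = p" "merge_pairs P (insert j (set L)) p = p"
        unfolding q_def by (auto intro!: merge_pairs_other)
      moreover have "p \<noteq> s" using False P by auto
      ultimately show ?thesis by simp
    qed
  qed
  have dE: "diff_points P (insert j (set L)) E = insert s (d E)"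
     "diff_points P (insert j (set L)) (insert j E) = insert r (d E)" if "E \<subseteq> set L" for E
  proof -
    have "insert j (set L) - E = insert j (set L - E)" "insert j (set L) - insert j E = set L - E"
      using that j by auto
    then show "diff_points P (insert j (set L)) E = insert s (d E)"
     "diff_points P (insert j (set L)) (insert j E) = insert r (d E)"
      using P by (auto simp: d_def diff_points_def)
  qed
  show ?case
  proof
    fix x :: "nat \<Rightarrow> real"
    let ?y = "x \<circ> merge_pairs P (insert j (set L))"
    let ?G = "\<lambda>E. (-1) ^ card E * ?Q (diff_points P (insert j (set L)) E) ?y"
    have "fold delta_act (map P (L @ [j])) (?Q {}) x = pderiv_coord s F (x(s := x r)) - pderiv_coord r F (x(s := x r))"
    proof -
      have "fold delta_act (map P (L @ [j])) f = delta_act (P j) (fold delta_act (map P L) f)" for f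
        by simp
      moreover have "delta_act (r, s) F x = pderiv_coord s F (x(s := x r)) - pderiv_coord r F (x(s := x r))"
        by (simp add: delta_act_def)
      ultimately show ?thesis
        by (simp only: IH P)
    qed
    also have "\<dots> = (\<Sum>E\<in>Pow (set L). (-1) ^ card E * ?Q (insert s (d E)) ?y) -
        (\<Sum>E\<in>Pow (set L). (-1) ^ card E * ?Q (insert r (d E)) ?y)"
      by (simp only: pd[of s] pd[of r] insert_iff merge simp_thms)
    also have "\<dots> = (\<Sum>E\<in>Pow (set L). ?G E) + (\<Sum>E\<in>Pow (set L). ?G (insert j E))"
    proof -
      have "card (insert j E) = Suc (card E)" if "E \<subseteq> set L" for E
        using that j finite_subset[OF that] by (auto simp: card_insert_if)
      then show ?thesis
        unfolding diff_conv_add_uminus sum_negf[symmetric]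
        by (intro arg_cong2[where f = "(+)"] sum.cong refl) (auto simp: dE)
    qed
    also have "\<dots> = (\<Sum>E\<in>Pow (insert j (set L)). ?G E)"
    proof -
      have "inj_on (insert j) (Pow (set L))"
        using j by (auto simp: inj_on_def)
      moreover have "Pow (set L) \<inter> insert j ` Pow (set L) = {}" using j by auto
      ultimately show ?thesis
        unfolding Pow_insert by (subst sum.union_disjoint) (auto simp: sum.reindex)
    qed
    finally show "fold delta_act (map P (L @ [j])) (?Q {}) x = (\<Sum>E\<in>Pow (set (L @ [j])).
       (-1) ^ card E * ?Q (diff_points P (set (L @ [j])) E) (x \<circ> merge_pairs P (set (L @ [j]))))"
      unfolding set_eq .
  qed
qed


subsection \<open>Integrals over half boxes\<close>

lemma restrict_reindex_PiE_iff:
  assumes "bij_betw \<pi> V W" "y \<in> extensional V"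
  shows "(\<lambda>w\<in>W. y (inv_into V \<pi> w)) \<in> Pi\<^sub>E W B \<longleftrightarrow> y \<in> Pi\<^sub>E V (\<lambda>v. B (\<pi> v))"
proof -
  have W: "W = \<pi> ` V" and inj: "inj_on \<pi> V" using assms by (auto simp: bij_betw_def)
  have "(\<lambda>w\<in>W. y (inv_into V \<pi> w)) \<in> Pi\<^sub>E W B \<longleftrightarrow> (\<forall>w\<in>W. y (inv_into V \<pi> w) \<in> B w)"
    by (rule restrict_PiE_iff)
  also have "\<dots> \<longleftrightarrow> (\<forall>v\<in>V. y v \<in> B (\<pi> v))"
    unfolding W by (simp add: inv_into_f_f[OF inj])
  finally show ?thesis
    using assms(2) by (simp add: PiE_iff)
qed

text \<open>It suffices to compare the measures of boxes, and there relabelling merely permutes the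
  factors of the product.\<close>

lemma distr_lebesgue_prod_reindex:
  assumes "finite V" and bij: "bij_betw \<pi> V W"
  shows "distr (lebesgue_prod V) (lebesgue_prod W) (\<lambda>y. \<lambda>w\<in>W. y (inv_into V \<pi> w)) = lebesgue_prod W"
proof -
  interpret product_sigma_finite "\<lambda>_::nat. lborel :: real measure" ..
  let ?\<Phi> = "\<lambda>y :: nat \<Rightarrow> real. \<lambda>w\<in>W. y (inv_into V \<pi> w)"
  have W: "finite W" using assms bij_betw_finite by blast
  have inv: "inv_into V \<pi> w \<in> V" "\<pi> (inv_into V \<pi> w) = w" if "w \<in> W" for w
    using that bij by (auto simp: bij_betw_def inv_into_into f_inv_into_f)
  have inv': "inv_into V \<pi> (\<pi> v) = v" "\<pi> v \<in> W" if "v \<in> V" for v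
    using that bij by (auto simp: bij_betw_def)
  have meas: "?\<Phi> \<in> measurable (lebesgue_prod V) (lebesgue_prod W)"
    using inv by (intro measurable_restrict measurable_component_singleton) auto
  show ?thesis
  proof (rule PiM_eqI[OF W])
    fix A :: "nat \<Rightarrow> real set" assume A: "\<And>i. i \<in> W \<Longrightarrow> A i \<in> sets lborel"
    have "?\<Phi> -` Pi\<^sub>E W A \<inter> space (lebesgue_prod V) = Pi\<^sub>E V (\<lambda>v. A (\<pi> v))"
      using restrict_reindex_PiE_iff[OF bij, of _ A] by (auto simp: space_PiM PiE_def)
    moreover have "Pi\<^sub>E W A \<in> sets (lebesgue_prod W)"
      using A by (intro sets_PiM_I_finite W)
    ultimately have "emeasure (distr (lebesgue_prod V) (lebesgue_prod W) ?\<Phi>) (Pi\<^sub>E W A)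
        = emeasure (lebesgue_prod V) (Pi\<^sub>E V (\<lambda>v. A (\<pi> v)))"
      by (simp add: emeasure_distr[OF meas])
    also have "\<dots> = (\<Prod>v\<in>V. emeasure lborel (A (\<pi> v)))"
      using A inv' by (intro emeasure_PiM assms) auto
    also have "\<dots> = (\<Prod>w\<in>W. emeasure lborel (A w))"
      by (rule prod.reindex_bij_betw[OF bij])
    finally show "emeasure (distr (lebesgue_prod V) (lebesgue_prod W) ?\<Phi>) (Pi\<^sub>E W A) = (\<Prod>w\<in>W. emeasure lborel (A w))" .
  qed simp
qed

lemma half_box_measurable: "finite I \<Longrightarrow> half_box x0 I \<in> sets (lebesgue_prod I)"
  by (intro sets_PiM_I_finite) auto

lemma indicator_half_box:
  assumes "finite I" "x \<in> space (lebesgue_prod I)"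
  shows "indicator (half_box x0 I) x = (\<Prod>i\<in>I. indicator {x0<..} (x i) :: real)"
proof (cases "\<forall>i\<in>I. x i > x0")
  case True
  then show ?thesis using assms by (auto simp: space_PiM PiE_iff indicator_def)
next
  case False
  then have "(\<Prod>i\<in>I. indicator {x0<..} (x i) :: real) = 0"
    using assms by (intro prod_zero) (auto simp: indicator_def)
  with False show ?thesis by (auto simp: indicator_def)
qed

text \<open>The terms of the expansion are integrated over different sets of variables; this
  compares two of them that differ by a bijective renaming.\<close>

lemma half_box_integral_reindex:
  fixes h :: "(nat \<Rightarrow> real) \<Rightarrow> real"
  assumes V: "finite V" and bij: "bij_betw \<pi> V W" and h: "h \<in> borel_measurable (lebesgue_prod W)"
    and g: "\<And>y. g y = h (\<lambda>w\<in>W. y (inv_into V \<pi> w))"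
  shows "set_integrable (lebesgue_prod W) (half_box x0 W) h \<longleftrightarrow> set_integrable (lebesgue_prod V) (half_box x0 V) g"
    and "(LINT x : half_box x0 W | lebesgue_prod W. h x) = (LINT x : half_box x0 V | lebesgue_prod V. g x)"
proof -
  let ?\<Phi> = "\<lambda>y :: nat \<Rightarrow> real. \<lambda>w\<in>W. y (inv_into V \<pi> w)"
  have W: "finite W" using assms bij_betw_finite by blast
  have inv: "inv_into V \<pi> w \<in> V" if "w \<in> W" for w
    using that bij by (auto simp: bij_betw_def inv_into_into)
  have meas: "?\<Phi> \<in> measurable (lebesgue_prod V) (lebesgue_prod W)"
    using inv by (intro measurable_restrict measurable_component_singleton) auto
  have f: "(\<lambda>x. indicator (half_box x0 W) x *\<^sub>R h x) \<in> borel_measurable (lebesgue_prod W)"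
    using h half_box_measurable[OF W] by simp
  have "?\<Phi> y \<in> half_box x0 W \<longleftrightarrow> y \<in> half_box x0 V" if "y \<in> space (lebesgue_prod V)" for y
    using that restrict_reindex_PiE_iff[OF bij, of y "\<lambda>_. {x0<..}"] by (auto simp: space_PiM PiE_def)
  then have eq: "indicator (half_box x0 W) (?\<Phi> y) *\<^sub>R h (?\<Phi> y) = indicator (half_box x0 V) y *\<^sub>R g y"
    if "y \<in> space (lebesgue_prod V)" for y
    using that by (simp add: indicator_def g)
  note distr = distr_lebesgue_prod_reindex[OF V bij]
  have "set_integrable (lebesgue_prod W) (half_box x0 W) h \<longleftrightarrow>
     integrable (distr (lebesgue_prod V) (lebesgue_prod W) ?\<Phi>) (\<lambda>x. indicator (half_box x0 W) x *\<^sub>R h x)"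
    unfolding set_integrable_def distr ..
  also have "\<dots> \<longleftrightarrow> integrable (lebesgue_prod V) (\<lambda>y. indicator (half_box x0 W) (?\<Phi> y) *\<^sub>R h (?\<Phi> y))"
    by (rule integrable_distr_eq[OF meas f])
  also have "\<dots> \<longleftrightarrow> set_integrable (lebesgue_prod V) (half_box x0 V) g"
    unfolding set_integrable_def by (intro Bochner_Integration.integrable_cong refl eq)
  finally show "set_integrable (lebesgue_prod W) (half_box x0 W) h \<longleftrightarrow> set_integrable (lebesgue_prod V) (half_box x0 V) g" .
  have "(LINT x : half_box x0 W | lebesgue_prod W. h x) =
     (LINT x | distr (lebesgue_prod V) (lebesgue_prod W) ?\<Phi>. indicator (half_box x0 W) x *\<^sub>R h x)"
    unfolding set_lebesgue_integral_def distr ..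
  also have "\<dots> = (LINT y | lebesgue_prod V. indicator (half_box x0 W) (?\<Phi> y) *\<^sub>R h (?\<Phi> y))"
    by (rule integral_distr[OF meas f])
  also have "\<dots> = (LINT x : half_box x0 V | lebesgue_prod V. g x)"
    unfolding set_lebesgue_integral_def by (intro Bochner_Integration.integral_cong refl eq)
  finally show "(LINT x : half_box x0 W | lebesgue_prod W. h x) = (LINT x : half_box x0 V | lebesgue_prod V. g x)" .
qed

lemma set_integrable_finite_sum:
  fixes f :: "'i \<Rightarrow> 'a \<Rightarrow> real"
  assumes "finite I" "\<And>i. i \<in> I \<Longrightarrow> set_integrable M S (f i)"
  shows "set_integrable M S (\<lambda>x. \<Sum>i\<in>I. f i x)"
    and "(LINT x:S|M. \<Sum>i\<in>I. f i x) = (\<Sum>i\<in>I. LINT x:S|M. f i x)"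
  using assms unfolding set_integrable_def set_lebesgue_integral_def 
  by (simp_all only: scaleR_sum_right Bochner_Integration.integrable_sum Bochner_Integration.integral_sum)

lemma continuous_kernel_A_entry:
  assumes "smooth (case_prod A)"
  shows "continuous_on UNIV (\<lambda>(x, y). kernel_A A x y $ i $ j)"
proof -
  note c = smooth_continuous[OF assms] smooth_continuous[OF smooth_dx[OF assms]]
    smooth_continuous[OF smooth_dy[OF assms]] smooth_continuous[OF smooth_dx[OF smooth_dy[OF assms]]]
  have "continuous_on UNIV (\<lambda>p. - case_prod (dx A) p)" "continuous_on UNIV (\<lambda>p. - case_prod (dy A) p)"
    by (intro continuous_intros c)+
  then show ?thesis
    using c exhaust_2[of i] exhaust_2[of j] by (auto simp: case_prod_unfold)
qed

lemma measurable_kernel_A_entry: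
  assumes "smooth (case_prod A)" "p \<in> V" "q \<in> V"
  shows "(\<lambda>x. kernel_A A (x p) (x q) $ i $ j) \<in> borel_measurable (lebesgue_prod V)"
proof -
  have "case_prod (\<lambda>x y. kernel_A A x y $ i $ j) \<in> borel_measurable borel"
    by (intro borel_measurable_continuous_onI continuous_kernel_A_entry assms)
  moreover have "(\<lambda>x. (x p, x q)) \<in> measurable (lebesgue_prod V) (borel \<Otimes>\<^sub>M borel)"
    using assms(2,3) by (intro measurable_Pair) (simp_all add: measurable_component_singleton)
  then have "(\<lambda>x. (x p, x q)) \<in> measurable (lebesgue_prod V) borel"
    by (simp add: borel_prod)
  ultimately show ?thesis
    using measurable_comp[of "\<lambda>x. (x p, x q)" "lebesgue_prod V" borel "case_prod (\<lambda>x y. kernel_A A x y $ i $ j)" borel]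
    by (simp add: comp_def)
qed

lemma measurable_diff_entry:
  assumes "smooth (case_prod A)" "q (a div 2) \<in> V" "q (b div 2) \<in> V"
  shows "(\<lambda>x. diff_entry A d (x \<circ> q) a b) \<in> borel_measurable (lebesgue_prod V)"
  using measurable_kernel_A_entry[OF assms] unfolding diff_entry_def
  by (simp add: borel_measurable_times)

lemma measurable_block_matrix:
  assumes "smooth (case_prod A)" "a div 2 \<in> V" "b div 2 \<in> V"
  shows "(\<lambda>x. block_matrix (kernel_A A) x a b) \<in> borel_measurable (lebesgue_prod V)"
  using measurable_kernel_A_entry[OF assms] unfolding block_matrix_def .

lemma integrable_exp_half_line:
  fixes c :: real
  assumes "c > 0"
  shows "integrable lborel (\<lambda>t. indicator {x0<..} t * exp (- c * t))"
proof -
  have "(\<lambda>t. exp (- c * t)) absolutely_integrable_on {x0..}"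
    by (rule nonnegative_absolutely_integrable_1) (use integrable_on_exp_minus_to_infinity[OF assms] in auto)
  then have "(\<lambda>t. exp (- c * t)) absolutely_integrable_on {x0<..}"
    by (rule set_integrable_subset) auto
  then show ?thesis
    by (simp add: set_integrable_def integrable_completion)
qed


section \<open>Integrability and growth of Pfaffians of an exponentially bounded kernel\<close>

locale decaying_kernel =
  fixes A :: "real \<Rightarrow> real \<Rightarrow> real" and x0 C \<alpha> \<beta> :: real
  assumes smooth: "smooth (case_prod A)"
    and antisym: "A x y = - A y x"
    and C_pos: "C > 0" and \<alpha>\<beta>: "\<alpha> > \<beta>"
    and bound_11: "x > x0 \<Longrightarrow> y > x0 \<Longrightarrow> \<bar>kernel_A A x y $ 1 $ 1\<bar> \<le> C * exp (- \<alpha> * x - \<alpha> * y)"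
    and bound_12: "x > x0 \<Longrightarrow> y > x0 \<Longrightarrow> \<bar>kernel_A A x y $ 1 $ 2\<bar> \<le> C * exp (- \<alpha> * x + \<beta> * y)"
    and bound_22: "x > x0 \<Longrightarrow> y > x0 \<Longrightarrow> \<bar>kernel_A A x y $ 2 $ 2\<bar> \<le> C * exp (\<beta> * x + \<beta> * y)"
begin

text \<open>Puts the decay bounds into product form: the entry of rows a and b is at most
  \<open>C\<close> times the product of their weights. A point owns one row of each parity, and its
  two weights multiply to exp (- (\<alpha> - \<beta>) t), integrable on a half line because \<alpha>
  > \<beta>.\<close>

definition row_weight :: "nat \<Rightarrow> real \<Rightarrow> real" where
  "row_weight a t = (if even a then exp (- \<alpha> * t) else exp (\<beta> * t))"

lemma row_weight_pos: "row_weight a t > 0"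
  by (simp add: row_weight_def)

lemma dx_eq_neg_dy: "dx A x y = - dy A y x"
  by (rule dx_antisymmetric[OF smooth antisym])

lemma dxdy_antisymmetric: "dx (dy A) x y = - dx (dy A) y x"
proof -
  have "((\<lambda>t. - dx A y t) has_real_derivative - dy (dx A) y x) (at x)"
    by (intro DERIV_minus has_derivative_dy smooth_dx smooth)
  then have "((\<lambda>t. dy A t y) has_real_derivative - dy (dx A) y x) (at x)"
    by (simp add: dx_eq_neg_dy)
  moreover have "((\<lambda>t. dy A t y) has_real_derivative dx (dy A) x y) (at x)"
    by (intro has_derivative_dx smooth_dy smooth)
  ultimately have "dx (dy A) x y = - dy (dx A) y x"
    by (rule DERIV_unique[symmetric])
  then show ?thesis
    unfolding mixed_partials_commute[OF smooth, of y x] .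
qed

lemma block_matrix_skew: "block_matrix (kernel_A A) x a b = - block_matrix (kernel_A A) x b a"
  using antisym[of "x (a div 2)" "x (b div 2)"] dxdy_antisymmetric[of "x (a div 2)" "x (b div 2)"]
  by (cases "even a"; cases "even b") (simp_all add: block_matrix_def row_comp_def dx_eq_neg_dy)

lemma kernel_entry_bound:
  assumes "s > x0" "t > x0"
  shows "\<bar>kernel_A A s t $ row_comp a $ row_comp b\<bar> \<le> C * (row_weight a s * row_weight b t)"
  using bound_11[OF assms] bound_12[OF assms] bound_12[OF assms(2,1)] bound_22[OF assms]
  by (auto simp: row_comp_def row_weight_def dx_eq_neg_dy algebra_simps simp flip: exp_add)


lemma prod_row_weight:
  "(\<Prod>a<2*n. row_weight a (x (a div 2))) = (\<Prod>p<n. exp (- (\<alpha> - \<beta>) * x p))"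
  unfolding prod_lessThan_double
  by (intro prod.cong refl) (simp add: row_weight_def algebra_simps flip: exp_add)

definition tail_mass :: real where
  "tail_mass = (LINT t|lborel. indicator {x0<..} t * exp (- (\<alpha> - \<beta>) * t))"

lemma tail_mass_nonneg: "tail_mass \<ge> 0"
  unfolding tail_mass_def by (intro Bochner_Integration.integral_nonneg) auto

lemma dominating_function:
  fixes n :: nat
  defines "g \<equiv> \<lambda>x :: nat \<Rightarrow> real. \<Prod>p<n. indicator {x0<..} (x p) * exp (- (\<alpha> - \<beta>) * x p)"
  shows "integrable (lebesgue_prod {..<n}) g" "(LINT x | lebesgue_prod {..<n}. g x) = tail_mass ^ n"
    and "x \<in> space (lebesgue_prod {..<n}) \<Longrightarrow>
      g x = indicator (half_box x0 {..<n}) x * (\<Prod>a<2*n. row_weight a (x (a div 2)))"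
proof -
  interpret product_sigma_finite "\<lambda>_::nat. lborel :: real measure" ..
  have int: "integrable lborel (\<lambda>t. indicator {x0<..} t * exp (- (\<alpha> - \<beta>) * t))"
    using \<alpha>\<beta> by (intro integrable_exp_half_line) simp
  show "integrable (lebesgue_prod {..<n}) g"
    unfolding g_def by (intro product_integrable_prod[where f = "\<lambda>_ t. indicator {x0<..} t * exp (- (\<alpha> - \<beta>) * t)"] int) simp
  show "(LINT x | lebesgue_prod {..<n}. g x) = tail_mass ^ n"
    unfolding g_def tail_mass_def
    by (subst product_integral_prod[where f = "\<lambda>_ t. indicator {x0<..} t * exp (- (\<alpha> - \<beta>) * t)"]) (use int in auto)
  show "g x = indicator (half_box x0 {..<n}) x * (\<Prod>a<2*n. row_weight a (x (a div 2)))"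
    if "x \<in> space (lebesgue_prod {..<n})"
    by (simp only: g_def prod.distrib prod_row_weight indicator_half_box[OF finite_lessThan that])
qed

text \<open>Every row occurs once in the monomial, so the entry bounds multiply to
  \<open>C ^ n\<close> times the product of all row weights, whatever \<sigma> is: one integrable
  function dominates all monomials.\<close>

lemma monomial_integrable:
  assumes \<sigma>: "\<sigma> permutes {..<2*n}"
  shows "set_integrable (lebesgue_prod {..<n}) (half_box x0 {..<n})
     (\<lambda>x. \<Prod>i<n. block_matrix (kernel_A A) x (\<sigma> (2*i)) (\<sigma> (2*i+1)))"
  unfolding set_integrable_def
proof (rule Bochner_Integration.integrable_bound)
  let ?w = "\<lambda>x a. row_weight a (x (a div 2))"
  let ?g = "\<lambda>x :: nat \<Rightarrow> real. C ^ n * (\<Prod>p<n. indicator {x0<..} (x p) * exp (- (\<alpha> - \<beta>) * x p))"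
  show "integrable (lebesgue_prod {..<n}) ?g"
    by (intro integrable_mult_right dominating_function)
  have lt: "\<sigma> (2*i) div 2 < n" "\<sigma> (2*i+1) div 2 < n" if "i < n" for i
    using that permutes_in_image[OF \<sigma>, of "2*i"] permutes_in_image[OF \<sigma>, of "2*i+1"] by auto
  show "(\<lambda>x. indicator (half_box x0 {..<n}) x *\<^sub>R (\<Prod>i<n. block_matrix (kernel_A A) x (\<sigma> (2*i)) (\<sigma> (2*i+1))))
      \<in> borel_measurable (lebesgue_prod {..<n})"
    using lt half_box_measurable[of "{..<n}"]
    by (intro borel_measurable_scaleR borel_measurable_indicator borel_measurable_prod measurable_block_matrix[OF smooth]) auto
  show "AE x in lebesgue_prod {..<n}.
      norm (indicator (half_box x0 {..<n}) x *\<^sub>R (\<Prod>i<n. block_matrix (kernel_A A) x (\<sigma> (2*i)) (\<sigma> (2*i+1))))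
      \<le> norm (?g x)"
  proof (rule AE_I2)
    fix x assume x: "x \<in> space (lebesgue_prod {..<n})"
    have g: "?g x = C ^ n * (indicator (half_box x0 {..<n}) x * (\<Prod>a<2*n. ?w x a))"
      using dominating_function(3)[OF x] by simp
    have "(\<Prod>a<2*n. ?w x a) = (\<Prod>a<2*n. ?w x (\<sigma> a))"
      using prod.permute[OF \<sigma>, of "?w x"] by (simp add: o_def)
    then have w: "C ^ n * (\<Prod>a<2*n. ?w x a) = (\<Prod>i<n. C * (?w x (\<sigma> (2*i)) * ?w x (\<sigma> (2*i+1))))"
      by (simp add: prod_lessThan_double prod.distrib)
    show "norm (indicator (half_box x0 {..<n}) x *\<^sub>R (\<Prod>i<n. block_matrix (kernel_A A) x (\<sigma> (2*i)) (\<sigma> (2*i+1))))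
      \<le> norm (?g x)"
    proof (cases "x \<in> half_box x0 {..<n}")
      case True
      then have "(\<Prod>i<n. \<bar>block_matrix (kernel_A A) x (\<sigma> (2*i)) (\<sigma> (2*i+1))\<bar>)
        \<le> (\<Prod>i<n. C * (?w x (\<sigma> (2*i)) * ?w x (\<sigma> (2*i+1))))"
        using lt by (intro prod_mono conjI) (auto simp: block_matrix_def PiE_iff intro!: kernel_entry_bound)
      also have "\<dots> = ?g x"
        unfolding g w[symmetric] using True by simp
      also have "\<dots> \<le> norm (?g x)" by simp
      finally show ?thesis
        using True by (simp add: abs_prod)
    qed simp
  qed
qed

text \<open>After division by the row weights all entries are at most C in absolute value, so the
  sum of the (2n)^2 squares, divided by 2n, is at most 2 n C^2; this is the quantity in Hadamard's
  bound.\<close>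

lemma pfaffian_bound:
  assumes "x \<in> half_box x0 {..<n}"
  shows "\<bar>pfaffian n (block_matrix (kernel_A A) x)\<bar> \<le> sqrt (2 * real n * C\<^sup>2) ^ n * (\<Prod>a<2*n. row_weight a (x (a div 2)))"
proof -
  let ?w = "\<lambda>a. row_weight a (x (a div 2))"
  define M where "M a b = block_matrix (kernel_A A) x a b / (?w a * ?w b)" for a b
  have w: "?w a > 0" for a by (rule row_weight_pos)
  have M: "(M a b)\<^sup>2 \<le> C\<^sup>2" if "a < 2*n" "b < 2*n" for a b
  proof -
    have "x (a div 2) > x0" "x (b div 2) > x0" using that assms by (auto simp: PiE_iff)
    then have "\<bar>block_matrix (kernel_A A) x a b\<bar> \<le> C * (?w a * ?w b)"
      unfolding block_matrix_def by (rule kernel_entry_bound)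
    moreover have "\<bar>M a b\<bar> = \<bar>block_matrix (kernel_A A) x a b\<bar> / (?w a * ?w b)"
      using w[of a] w[of b] by (simp add: M_def)
    ultimately have "\<bar>M a b\<bar> \<le> C"
      using w[of a] w[of b] by (simp add: pos_divide_le_eq)
    then show ?thesis using C_pos by (intro abs_le_square_iff[THEN iffD1]) simp
  qed
  have "block_matrix (kernel_A A) x = (\<lambda>a b. ?w a * ?w b * M a b)"
    using w by (simp add: M_def fun_eq_iff less_imp_neq[symmetric])
  then have pf: "pfaffian n (block_matrix (kernel_A A) x) = (\<Prod>a<2*n. ?w a) * pfaffian n M"
    by (simp only: pfaffian_scale)
  have "M a b = - M b a" for a b
    using block_matrix_skew[of x a b] by (simp add: M_def mult.commute)
  then have "(pfaffian n M)\<^sup>2 \<le> ((\<Sum>a<2*n. \<Sum>b<2*n. (M a b)\<^sup>2) / (2*n)) ^ n"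
    by (rule pfaffian_hadamard)
  also have "\<dots> \<le> (2 * real n * C\<^sup>2) ^ n"
  proof (intro power_mono)
    have "(\<Sum>a<2*n. \<Sum>b<2*n. (M a b)\<^sup>2) \<le> (\<Sum>a<2*n. \<Sum>b<2*n. C\<^sup>2)"
      by (intro sum_mono M) auto
    then show "(\<Sum>a<2*n. \<Sum>b<2*n. (M a b)\<^sup>2) / (2*n) \<le> 2 * real n * C\<^sup>2"
      by (cases "n = 0") (simp_all add: divide_le_eq algebra_simps)
  qed (intro divide_nonneg_nonneg sum_nonneg, auto)
  also have "\<dots> = (sqrt (2 * real n * C\<^sup>2) ^ n)\<^sup>2"
  proof -
    have "(sqrt (2 * real n * C\<^sup>2) ^ n)\<^sup>2 = ((sqrt (2 * real n * C\<^sup>2))\<^sup>2) ^ n"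
      by (metis power_mult mult.commute)
    then show ?thesis by simp
  qed
  finally have "\<bar>pfaffian n M\<bar> \<le> \<bar>sqrt (2 * real n * C\<^sup>2) ^ n\<bar>"
    by (rule abs_le_square_iff[THEN iffD2])
  then have "\<bar>pfaffian n M\<bar> \<le> sqrt (2 * real n * C\<^sup>2) ^ n"
    by simp
  moreover have "\<bar>\<Prod>a<2*n. ?w a\<bar> = (\<Prod>a<2*n. ?w a)"
    using w by (intro abs_of_nonneg prod_nonneg) (auto intro: less_imp_le)
  moreover have "0 \<le> (\<Prod>a<2*n. ?w a)"
    using w by (intro prod_nonneg) (auto intro: less_imp_le)
  ultimately show ?thesis
    unfolding pf abs_mult by (simp only: mult.commute mult_right_mono)
qed

lemma pfaffian_set_integrable:
  "set_integrable (lebesgue_prod {..<n}) (half_box x0 {..<n}) (\<lambda>x. pfaffian n (block_matrix (kernel_A A) x))"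
  unfolding pfaffian_def
  by (intro set_integrable_divide set_integrable_finite_sum set_integrable_mult_right monomial_integrable)
    (auto simp: finite_permutations)

lemma pfaffian_integral_bound:
  "\<bar>pfaffian_integral (kernel_A A) x0 n\<bar> \<le> sqrt (2 * real n * C\<^sup>2) ^ n * tail_mass ^ n"
proof -
  let ?g = "\<lambda>x :: nat \<Rightarrow> real. \<Prod>p<n. indicator {x0<..} (x p) * exp (- (\<alpha> - \<beta>) * x p)"
  let ?f = "\<lambda>x. indicator (half_box x0 {..<n}) x *\<^sub>R pfaffian n (block_matrix (kernel_A A) x)"
  have int: "integrable (lebesgue_prod {..<n}) ?f"
    using pfaffian_set_integrable by (simp only: set_integrable_def)
  have "\<bar>pfaffian_integral (kernel_A A) x0 n\<bar> \<le> (LINT x | lebesgue_prod {..<n}. \<bar>?f x\<bar>)"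
    unfolding pfaffian_integral_def set_lebesgue_integral_def by (rule integral_abs_bound)
  also have "\<dots> \<le> (LINT x | lebesgue_prod {..<n}. sqrt (2 * real n * C\<^sup>2) ^ n * ?g x)"
  proof (rule integral_mono)
    show "integrable (lebesgue_prod {..<n}) (\<lambda>x. \<bar>?f x\<bar>)" using int by (rule integrable_abs)
    show "integrable (lebesgue_prod {..<n}) (\<lambda>x. sqrt (2 * real n * C\<^sup>2) ^ n * ?g x)"
      by (intro integrable_mult_right dominating_function)
    fix x assume x: "x \<in> space (lebesgue_prod {..<n})"
    show "\<bar>?f x\<bar> \<le> sqrt (2 * real n * C\<^sup>2) ^ n * ?g x"
      unfolding dominating_function(3)[OF x] using pfaffian_bound[of x n]
      by (cases "x \<in> half_box x0 {..<n}") auto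
  qed
  also have "\<dots> = sqrt (2 * real n * C\<^sup>2) ^ n * tail_mass ^ n"
    by (simp only: integral_mult_right_zero dominating_function(2))
  finally show ?thesis .
qed

end


subsection \<open>Relabelling points and factors\<close>

text \<open>Every factor in \<open>S\<close> joins two second rows. As \<open>kernel_B\<close>
  carries \<delta>' only in its lower right entry, the coefficient of a term is 1 in this case and 0
  otherwise.\<close>

definition delta_rows :: "(nat \<Rightarrow> nat) \<Rightarrow> nat set \<Rightarrow> bool" where
  "delta_rows \<sigma> S \<longleftrightarrow> (\<forall>i\<in>S. odd (\<sigma> (2*i)) \<and> odd (\<sigma> (2*i+1)))"

lemma point_pair_simps [simp]:
  "fst (point_pair \<sigma> i) = \<sigma> (2*i) div 2" "snd (point_pair \<sigma> i) = \<sigma> (2*i+1) div 2"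
  by (simp_all add: point_pair_def)

lemma odd_div_two_eq:
  fixes a b :: nat
  assumes "odd a" "odd b" "a div 2 = b div 2"
  shows "a = b"
  using assms by (metis odd_two_times_div_two_succ)

lemma delta_rows_odd:
  assumes "delta_rows \<sigma> S" "c div 2 \<in> S"
  shows "odd (\<sigma> c)"
proof -
  have o: "odd (\<sigma> (2 * (c div 2)))" "odd (\<sigma> (2 * (c div 2) + 1))"
    using assms by (simp_all add: delta_rows_def)
  show ?thesis
  proof (cases "even c")
    case True
    then have "2 * (c div 2) = c" by simp
    with o(1) show ?thesis by metis
  next
    case False
    then have "2 * (c div 2) + 1 = c" by simp
    with o(2) show ?thesis by metis
  qed
qed

text \<open>A point has only one odd row and \<sigma> is injective, so odd rows in different slots
  belong to different points.\<close>

lemma disjoint_point_pairs: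
  assumes \<sigma>: "inj \<sigma>" and odd: "delta_rows \<sigma> S"
  shows "disjoint_pairs (point_pair \<sigma>) S"
proof -
  have eq: "c = d" if "c div 2 \<in> S" "d div 2 \<in> S" "\<sigma> c div 2 = \<sigma> d div 2" for c d
  proof -
    have "\<sigma> c = \<sigma> d"
      by (rule odd_div_two_eq[OF delta_rows_odd[OF odd that(1)] delta_rows_odd[OF odd that(2)] that(3)])
    then show ?thesis using \<sigma> by (simp add: inj_eq)
  qed
  show ?thesis
    unfolding disjoint_pairs_def inj_on_def comp_def point_pair_simps
  proof (intro conjI ballI impI notI)
    fix i j assume ij: "i \<in> S" "j \<in> S"
    have mem: "(2*i) div 2 \<in> S" "(2*i+1) div 2 \<in> S" "(2*j) div 2 \<in> S" "(2*j+1) div 2 \<in> S"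
      using ij by auto
    show "i = j" if "\<sigma> (2*i) div 2 = \<sigma> (2*j) div 2"
      using eq[OF mem(1,3) that] by simp
    show "i = j" if "\<sigma> (2*i+1) div 2 = \<sigma> (2*j+1) div 2"
      using eq[OF mem(2,4) that] by simp
    assume "\<sigma> (2*i) div 2 = \<sigma> (2*j+1) div 2"
    then have "2 * i = 2 * j + 1" by (rule eq[OF mem(1,4)])
    then show False by presburger
  qed
qed

text \<open>The second row of the point is taken by a factor in \<open>S\<close>. Its first row is
  even, hence stands in a slot outside \<open>S\<close>, and the point has no further row.\<close>

lemma lone_row_delta:
  assumes \<sigma>: "\<sigma> permutes {..<2*k}" and S: "S \<subseteq> {..<k}" and odd: "delta_rows \<sigma> S"
    and c: "c div 2 \<in> S" "odd (\<sigma> c)"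
  shows "lone_row \<sigma> ({..<k} - S) (\<sigma> c div 2)"
proof -
  define p where "p = \<sigma> c div 2"
  define a where "a = inv \<sigma> (2*p)"
  have \<sigma>c: "\<sigma> c = 2*p+1" using c(2) by (simp add: p_def)
  have "c < 2*k" using c(1) S by auto
  then have "p < k" using permutes_in_image[OF \<sigma>, of c] by (simp add: p_def)
  then have a_lt: "a < 2*k"
    using permutes_in_image[OF permutes_inv[OF \<sigma>], of "2*p"] by (simp add: a_def)
  have \<sigma>a: "\<sigma> a = 2*p" using permutes_inverses[OF \<sigma>] by (simp add: a_def)
  have inj: "\<sigma> u = \<sigma> v \<longleftrightarrow> u = v" for u v using permutes_inj[OF \<sigma>] by (simp add: inj_eq)
  have aS: "a div 2 \<notin> S"
  proof
    assume "a div 2 \<in> S"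
    then have "odd (\<sigma> a)" by (rule delta_rows_odd[OF odd])
    then show False using \<sigma>a by simp
  qed
  have other: "\<sigma> b div 2 \<noteq> p" if "b div 2 \<notin> S" "b \<noteq> a" for b
  proof
    assume "\<sigma> b div 2 = p"
    then have "\<sigma> b = 2*p \<or> \<sigma> b = 2*p+1" by presburger
    then have "b = a \<or> b = c" using \<sigma>a \<sigma>c inj by metis
    then show False using that c by blast
  qed
  show ?thesis
    unfolding lone_row_def p_def[symmetric]
  proof (intro bexI conjI ballI)
    show "a div 2 \<in> {..<k} - S" using a_lt aS by auto
    show "\<sigma> (2 * (a div 2)) = 2*p \<and> \<sigma> (2 * (a div 2) + 1) div 2 \<noteq> p \<or>
          \<sigma> (2 * (a div 2) + 1) = 2*p \<and> \<sigma> (2 * (a div 2)) div 2 \<noteq> p"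
    proof (cases "even a")
      case True
      then have "a = 2 * (a div 2)" by simp
      moreover have "\<sigma> (2 * (a div 2) + 1) div 2 \<noteq> p"
      proof (rule other)
        show "2 * (a div 2) + 1 \<noteq> a" using True by presburger
      qed (use aS in simp)
      ultimately show ?thesis using \<sigma>a by metis
    next
      case False
      then have "a = 2 * (a div 2) + 1" by simp
      moreover have "\<sigma> (2 * (a div 2)) div 2 \<noteq> p"
      proof (rule other)
        show "2 * (a div 2) \<noteq> a" using False by presburger
      qed (use aS in simp)
      ultimately show ?thesis using \<sigma>a by metis
    qed
    fix i assume i: "i \<in> {..<k} - S - {a div 2}"
    show "\<sigma> (2*i) div 2 \<noteq> p"
    proof (rule other)
      show "2 * i \<noteq> a" using i by auto
    qed (use i in simp)
    show "\<sigma> (2*i+1) div 2 \<noteq> p"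
    proof (rule other)
      show "2 * i + 1 \<noteq> a" using i by auto
    qed (use i in simp)
  qed
qed

lemma dist_term_delta_rows:
  assumes A: "smooth (case_prod A)" and \<sigma>: "\<sigma> permutes {..<2*k}" and S: "S \<subseteq> {..<k}" and odd: "delta_rows \<sigma> S"
  shows "dist_term (kernel_B A) k \<sigma> S x = (\<Sum>E\<in>Pow S. (-1) ^ card E *
    (\<Prod>i\<in>{..<k} - S. diff_entry A (diff_points (point_pair \<sigma>) S E) (x \<circ> merge_pairs (point_pair \<sigma>) S)
       (\<sigma> (2*i)) (\<sigma> (2*i+1))))"
proof -
  have fin: "finite S" using S finite_subset by blast
  have "(\<Prod>i\<in>S. delta_coeff (kernel_B A) $ row_comp (\<sigma> (2*i)) $ row_comp (\<sigma> (2*i+1))) = 1"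
    unfolding delta_coeff_kernel_B using odd by (intro prod.neutral ballI) (simp add: delta_rows_def)
  moreover have "fold delta_act (map (point_pair \<sigma>) (sorted_list_of_set S))
      (\<lambda>x. \<Prod>i\<in>{..<k} - S. diff_entry A {} x (\<sigma> (2*i)) (\<sigma> (2*i+1)))
    = (\<lambda>x. \<Sum>E\<in>Pow (set (sorted_list_of_set S)). (-1) ^ card E *
    (\<Prod>i\<in>{..<k} - S. diff_entry A (diff_points (point_pair \<sigma>) (set (sorted_list_of_set S)) E)
       (x \<circ> merge_pairs (point_pair \<sigma>) (set (sorted_list_of_set S))) (\<sigma> (2*i)) (\<sigma> (2*i+1))))"
  proof (rule fold_delta_act[OF A])
    show "disjoint_pairs (point_pair \<sigma>) (set (sorted_list_of_set S))"
      using disjoint_point_pairs[OF permutes_inj[OF \<sigma>] odd] fin by simp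
    fix i assume "i \<in> set (sorted_list_of_set S)"
    then have i: "i \<in> S" using fin by simp
    then have "odd (\<sigma> (2*i))" "odd (\<sigma> (2*i+1))" using odd by (auto simp: delta_rows_def)
    then show "lone_row \<sigma> ({..<k} - S) (fst (point_pair \<sigma> i)) \<and> lone_row \<sigma> ({..<k} - S) (snd (point_pair \<sigma> i))"
      using lone_row_delta[OF \<sigma> S odd, of "2*i"] lone_row_delta[OF \<sigma> S odd, of "2*i+1"] i by simp
  qed auto
  ultimately show ?thesis
    unfolding dist_term_def reg_kernel_B_block by (simp only: mult_1 set_sorted_list_of_set[OF fin])
qed

lemma dist_term_not_delta_rows:
  assumes "finite S" "\<not> delta_rows \<sigma> S"
  shows "dist_term (kernel_B A) k \<sigma> S x = 0"
proof -
  have "(\<Prod>i\<in>S. delta_coeff (kernel_B A) $ row_comp (\<sigma> (2*i)) $ row_comp (\<sigma> (2*i+1))) = 0"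
    unfolding delta_coeff_kernel_B using assms by (intro prod_zero) (auto simp: delta_rows_def)
  then show ?thesis by (simp add: dist_term_def)
qed

text \<open>The first point of a pair is never the second point of another one, so the substitution
  ends in variables that are still integrated over.\<close>

lemma merge_pairs_in_vars:
  assumes \<sigma>: "\<sigma> permutes {..<2*k}" and S: "S \<subseteq> {..<k}" and odd: "delta_rows \<sigma> S" and p: "p < k"
  shows "merge_pairs (point_pair \<sigma>) S p \<in> dist_term_vars k \<sigma> S"
proof -
  have disj: "disjoint_pairs (point_pair \<sigma>) S"
    by (rule disjoint_point_pairs[OF permutes_inj[OF \<sigma>] odd])
  show ?thesis
  proof (cases "p \<in> (snd \<circ> point_pair \<sigma>) ` S")
    case True
    then obtain i where i: "i \<in> S" "p = snd (point_pair \<sigma> i)" by auto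
    then have "merge_pairs (point_pair \<sigma>) S p = fst (point_pair \<sigma> i)"
      using merge_pairs_snd[of i S "point_pair \<sigma>"] disj by (simp add: disjoint_pairs_def)
    moreover have "fst (point_pair \<sigma> i) \<notin> (\<lambda>i. snd (point_pair \<sigma> i)) ` S"
      using disj i unfolding disjoint_pairs_def by blast
    moreover have "2*i < 2*k" using i(1) S by auto
    then have "\<sigma> (2*i) < 2*k" using permutes_in_image[OF \<sigma>, of "2*i"] by auto
    then have "fst (point_pair \<sigma> i) < k" by simp
    ultimately show ?thesis unfolding dist_term_vars_def by (metis DiffI lessThan_iff)
  next
    case False
    then show ?thesis
      using merge_pairs_other[OF False] p by (simp add: dist_term_vars_def comp_def)
  qed
qed

lemma measurable_dist_term:
  assumes A: "smooth (case_prod A)" and \<sigma>: "\<sigma> permutes {..<2*k}" and S: "S \<subseteq> {..<k}" and odd: "delta_rows \<sigma> S"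
  shows "dist_term (kernel_B A) k \<sigma> S \<in> borel_measurable (lebesgue_prod (dist_term_vars k \<sigma> S))"
proof -
  have lt: "\<sigma> (2*i) div 2 < k" "\<sigma> (2*i+1) div 2 < k" if "i < k" for i
    using that permutes_in_image[OF \<sigma>, of "2*i"] permutes_in_image[OF \<sigma>, of "2*i+1"] by auto
  show ?thesis
    unfolding dist_term_delta_rows[OF assms, abs_def]
    by (intro borel_measurable_sum borel_measurable_times borel_measurable_const borel_measurable_prod
        measurable_diff_entry[OF A] merge_pairs_in_vars[OF \<sigma> S odd] lt) auto
qed

lemma delta_rows_permuted:
  assumes "\<beta> ` S' = S"
  shows "delta_rows (block_perm \<pi> \<circ> \<sigma> \<circ> block_perm \<beta>) S' \<longleftrightarrow> delta_rows \<sigma> S"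
  unfolding delta_rows_def assms[symmetric] by simp

lemma point_pair_permuted:
  "point_pair (block_perm \<pi> \<circ> \<sigma> \<circ> block_perm \<beta>) i = map_prod \<pi> \<pi> (point_pair \<sigma> (\<beta> i))"
  by (simp add: point_pair_def)

lemma dist_term_vars_permuted:
  assumes "\<pi> permutes {..<k}" "\<beta> ` S' = S"
  shows "dist_term_vars k (block_perm \<pi> \<circ> \<sigma> \<circ> block_perm \<beta>) S' = \<pi> ` dist_term_vars k \<sigma> S"
proof -
  have "(\<lambda>i. snd (point_pair (block_perm \<pi> \<circ> \<sigma> \<circ> block_perm \<beta>) i)) ` S' = \<pi> ` ((\<lambda>i. snd (point_pair \<sigma> i)) ` S)"
    unfolding point_pair_permuted assms(2)[symmetric] by (simp add: image_image)
  then show ?thesis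
    unfolding dist_term_vars_def
    by (simp only: image_set_diff[OF permutes_inj[OF assms(1)]] permutes_image[OF assms(1)])
qed

lemma diff_entry_permuted:
  assumes "inj \<pi>"
  shows "diff_entry A (\<pi> ` d) x (block_perm \<pi> a) (block_perm \<pi> b) = diff_entry A d (x \<circ> \<pi>) a b"
  using assms by (simp add: diff_entry_def diff_comp_def diff_coeff_def inj_image_mem_iff)

lemma merge_pairs_permuted:
  assumes \<pi>: "inj \<pi>" and S: "\<beta> ` S' = S" "inj_on \<beta> S'" and inj: "inj_on (snd \<circ> P) S"
    and P': "\<And>i. P' i = map_prod \<pi> \<pi> (P (\<beta> i))"
  shows "merge_pairs P' S' (\<pi> p) = \<pi> (merge_pairs P S p)"
proof (cases "p \<in> (snd \<circ> P) ` S")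
  case True
  then obtain i where i: "i \<in> S'" "p = snd (P (\<beta> i))" using S by auto
  have inj': "inj_on (snd \<circ> P') S'"
  proof (rule inj_onI)
    fix i j assume ij: "i \<in> S'" "j \<in> S'" "(snd \<circ> P') i = (snd \<circ> P') j"
    then have "snd (P (\<beta> i)) = snd (P (\<beta> j))"
      using \<pi> by (simp add: P' inj_eq)
    then have "\<beta> i = \<beta> j" using inj S ij by (auto simp: inj_on_def)
    then show "i = j" using S ij by (auto simp: inj_on_def)
  qed
  have "merge_pairs P' S' (snd (P' i)) = fst (P' i)"
    by (rule merge_pairs_snd[OF i(1) inj'])
  moreover have "merge_pairs P S (snd (P (\<beta> i))) = fst (P (\<beta> i))"
    using i(1) S by (intro merge_pairs_snd inj) auto
  ultimately show ?thesis using i(2) by (simp add: P')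
next
  case False
  have "\<pi> p \<notin> (snd \<circ> P') ` S'"
  proof
    assume "\<pi> p \<in> (snd \<circ> P') ` S'"
    then obtain i where "i \<in> S'" "\<pi> p = \<pi> (snd (P (\<beta> i)))" by (auto simp: P')
    then show False using False \<pi> S by (auto simp: inj_eq)
  qed
  from merge_pairs_other[OF this] merge_pairs_other[OF False] show ?thesis
    by (simp only:)
qed

lemma diff_points_permuted:
  assumes S: "\<beta> ` S' = S" "inj_on \<beta> S'" and E: "E \<subseteq> S'" and P': "\<And>i. P' i = map_prod \<pi> \<pi> (P (\<beta> i))"
  shows "diff_points P' S' E = \<pi> ` diff_points P S (\<beta> ` E)"
proof -
  have "S - \<beta> ` E = \<beta> ` (S' - E)"
    using S E by (simp add: inj_on_image_set_diff[of \<beta> S'])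
  then show ?thesis
    unfolding diff_points_def by (simp only: image_Un image_image comp_def P' fst_map_prod snd_map_prod)
qed

text \<open>Renaming the points by \<pi> is a change of coordinates. Renaming the factors by \<beta>
  alters the order in which the \<delta>' act, since \<open>dist_term\<close> runs through
  \<open>S\<close> in increasing order; this is harmless by the order-free form of
  \<open>dist_term_delta_rows\<close>.\<close>

lemma dist_term_permuted:
  assumes A: "smooth (case_prod A)" and \<sigma>: "\<sigma> permutes {..<2*k}" and S: "S \<subseteq> {..<k}"
    and \<pi>: "\<pi> permutes {..<k}" and \<beta>: "\<beta> permutes {..<k}" and S': "\<beta> ` S' = S"
  defines "\<sigma>' \<equiv> block_perm \<pi> \<circ> \<sigma> \<circ> block_perm \<beta>"
  defines "V \<equiv> dist_term_vars k \<sigma> S" and "W \<equiv> dist_term_vars k \<sigma>' S'"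
  shows "set_integrable (lebesgue_prod W) (half_box x0 W) (dist_term (kernel_B A) k \<sigma>' S') \<longleftrightarrow>
      set_integrable (lebesgue_prod V) (half_box x0 V) (dist_term (kernel_B A) k \<sigma> S)" (is ?int)
    and "(LINT x : half_box x0 W | lebesgue_prod W. dist_term (kernel_B A) k \<sigma>' S' x) =
      (LINT x : half_box x0 V | lebesgue_prod V. dist_term (kernel_B A) k \<sigma> S x)" (is ?eq)
proof -
  have S'_eq: "S' = inv \<beta> ` S"
    using S' permutes_inj[OF \<beta>] by (auto simp: image_image)
  have S'k: "S' \<subseteq> {..<k}"
    using S permutes_image[OF permutes_inv[OF \<beta>]] unfolding S'_eq by blast
  have fin: "finite S" "finite S'" using S S'k finite_subset by blast+
  have \<sigma>': "\<sigma>' permutes {..<2*k}"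
    unfolding \<sigma>'_def by (intro permutes_compose block_perm_permutes \<pi> \<beta> \<sigma>)
  have odd_iff: "delta_rows \<sigma>' S' \<longleftrightarrow> delta_rows \<sigma> S"
    unfolding \<sigma>'_def by (rule delta_rows_permuted[OF S'])
  have inj: "inj \<pi>" "inj \<beta>" using \<pi> \<beta> permutes_inj by blast+
  have inj\<beta>: "inj_on \<beta> X" for X using inj(2) inj_on_subset by blast
  have "?int \<and> ?eq"
  proof (cases "delta_rows \<sigma> S")
    case True
    then have odd: "delta_rows \<sigma> S" "delta_rows \<sigma>' S'" using odd_iff by auto
    have W: "W = \<pi> ` V"
      unfolding W_def V_def \<sigma>'_def by (rule dist_term_vars_permuted[OF \<pi> S'])
    have bij: "bij_betw \<pi> V W"
      unfolding W by (intro bij_betw_imageI inj_on_subset[OF inj(1)]) auto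
    have finV: "finite V" unfolding V_def dist_term_vars_def by simp
    have V: "dist_term (kernel_B A) k \<sigma> S y = dist_term (kernel_B A) k \<sigma>' S' (\<lambda>w\<in>W. y (inv_into V \<pi> w))" for y
    proof -
      let ?z = "\<lambda>w\<in>W. y (inv_into V \<pi> w)"
      let ?P = "point_pair \<sigma>" and ?P' = "point_pair \<sigma>'"
      have P': "?P' i = map_prod \<pi> \<pi> (?P (\<beta> i))" for i
        unfolding \<sigma>'_def by (rule point_pair_permuted)
      have injP: "inj_on (snd \<circ> ?P) S"
        using disjoint_point_pairs[OF permutes_inj[OF \<sigma>] odd(1)] by (simp add: disjoint_pairs_def)
      have z: "?z (merge_pairs ?P' S' (\<pi> p)) = y (merge_pairs ?P S p)" if "p < k" for p
      proof -
        have "merge_pairs ?P S p \<in> V"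
          unfolding V_def by (rule merge_pairs_in_vars[OF \<sigma> S odd(1) that])
        then show ?thesis
          using merge_pairs_permuted[OF inj(1) S' inj\<beta> injP, of ?P', OF P', of p] bij
          by (auto simp: bij_betw_def inv_into_f_f)
      qed
      have lt: "\<sigma> a div 2 < k" if "a < 2*k" for a
        using that permutes_in_image[OF \<sigma>, of a] by auto
      have entry: "diff_entry A (\<pi> ` d) (?z \<circ> merge_pairs ?P' S') (\<sigma>' (2*i)) (\<sigma>' (2*i+1))
          = diff_entry A d (y \<circ> merge_pairs ?P S) (\<sigma> (2 * \<beta> i)) (\<sigma> (2 * \<beta> i + 1))" if "i < k" for d i
      proof -
        have "\<beta> i < k" using that permutes_in_image[OF \<beta>, of i] by auto
        then have l: "\<sigma> (2 * \<beta> i) div 2 < k" "\<sigma> (2 * \<beta> i + 1) div 2 < k" by (auto intro!: lt)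
        have \<sigma>'i: "\<sigma>' (2*i) = block_perm \<pi> (\<sigma> (2 * \<beta> i))" "\<sigma>' (2*i+1) = block_perm \<pi> (\<sigma> (2 * \<beta> i + 1))"
          by (simp_all add: \<sigma>'_def)
        show ?thesis
          unfolding \<sigma>'i diff_entry_permuted[OF inj(1)]
          by (simp only: diff_entry_def comp_apply z[OF l(1)] z[OF l(2)])
      qed
      have prod: "(\<Prod>i\<in>{..<k} - S'. f (\<beta> i)) = (\<Prod>i\<in>{..<k} - S. f i)" for f :: "nat \<Rightarrow> real"
      proof -
        have "\<beta> ` ({..<k} - S') = {..<k} - S"
          by (simp only: image_set_diff[OF inj(2)] permutes_image[OF \<beta>] S')
        then show ?thesis
          by (intro prod.reindex_bij_betw) (simp add: bij_betw_def inj\<beta>)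
      qed
      have "dist_term (kernel_B A) k \<sigma>' S' ?z = (\<Sum>E\<in>Pow S'. (-1) ^ card (\<beta> ` E) *
         (\<Prod>i\<in>{..<k} - S. diff_entry A (diff_points ?P S (\<beta> ` E)) (y \<circ> merge_pairs ?P S) (\<sigma> (2*i)) (\<sigma> (2*i+1))))"
        unfolding dist_term_delta_rows[OF A \<sigma>' S'k odd(2)]
      proof (intro sum.cong refl arg_cong2[where f = "(*)"])
        fix E assume "E \<in> Pow S'"
        then have E: "E \<subseteq> S'" by simp
        show "(-1) ^ card E = ((-1) ^ card (\<beta> ` E) :: real)"
          by (simp add: card_image[OF inj\<beta>])
        show "(\<Prod>i\<in>{..<k} - S'. diff_entry A (diff_points ?P' S' E) (?z \<circ> merge_pairs ?P' S') (\<sigma>' (2*i)) (\<sigma>' (2*i+1)))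
            = (\<Prod>i\<in>{..<k} - S. diff_entry A (diff_points ?P S (\<beta> ` E)) (y \<circ> merge_pairs ?P S) (\<sigma> (2*i)) (\<sigma> (2*i+1)))"
          unfolding diff_points_permuted[OF S' inj\<beta> E, of ?P', OF P'] prod[symmetric]
          by (intro prod.cong refl entry) auto
      qed
      also have "\<dots> = dist_term (kernel_B A) k \<sigma> S y"
        unfolding dist_term_delta_rows[OF A \<sigma> S odd(1)]
      proof (rule sum.reindex_bij_betw)
        have "(`) \<beta> ` Pow S' = Pow S" unfolding S'[symmetric] by (rule image_Pow_surj[OF refl])
        moreover have "inj_on ((`) \<beta>) (Pow S')"
          using inj(2) by (meson inj_image_eq_iff inj_onI)
        ultimately show "bij_betw ((`) \<beta>) (Pow S') (Pow S)" by (simp add: bij_betw_def)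
      qed
      finally show ?thesis by simp
    qed
    have meas: "dist_term (kernel_B A) k \<sigma>' S' \<in> borel_measurable (lebesgue_prod W)"
      unfolding W_def by (rule measurable_dist_term[OF A \<sigma>' S'k odd(2)])
    show ?thesis
      by (intro conjI half_box_integral_reindex[OF finV bij meas V])
  next
    case False
    then have "dist_term (kernel_B A) k \<sigma>' S' = (\<lambda>x. 0)" "dist_term (kernel_B A) k \<sigma> S = (\<lambda>x. 0)"
      using odd_iff dist_term_not_delta_rows fin by (intro ext; metis)+
    then show ?thesis by (simp add: set_integrable_def)
  qed
  then show ?int ?eq by blast+
qed


subsection \<open>The standard position of the \<open>\<delta>'\<close> factors\<close>

text \<open>X and its image have complements of equal size in Y, and any bijection between these
  completes f.\<close>

lemma exists_permutes_extending:
  assumes f: "inj_on f X" "f ` X \<subseteq> Y" and X: "X \<subseteq> Y" and Y: "finite Y"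
  obtains p where "p permutes Y" "\<And>x. x \<in> X \<Longrightarrow> p x = f x"
proof -
  have "card (Y - X) = card (Y - f ` X)"
    using assms finite_subset[OF X Y] by (simp add: card_Diff_subset card_image)
  then obtain g where g: "bij_betw g (Y - X) (Y - f ` X)"
    using Y finite_same_card_bij[of "Y - X" "Y - f ` X"] by blast
  define p where "p x = (if x \<in> X then f x else if x \<in> Y then g x else x)" for x
  have "bij_betw p X (f ` X)"
    using f(1) by (subst bij_betw_cong[of _ p f]) (auto simp: p_def bij_betw_def)
  moreover have "bij_betw p (Y - X) (Y - f ` X)"
    using g by (subst bij_betw_cong[of _ p g]) (auto simp: p_def)
  ultimately have "bij_betw p (X \<union> (Y - X)) (f ` X \<union> (Y - f ` X))"
    by (rule bij_betw_combine) blast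
  moreover have "X \<union> (Y - X) = Y" "f ` X \<union> (Y - f ` X) = Y" using f X by blast+
  ultimately have "p permutes Y"
    by (intro bij_imp_permutes) (use X in \<open>auto simp: p_def\<close>)
  then show ?thesis by (rule that) (simp add: p_def)
qed

text \<open>\<rho> is a product of \<open>card T\<close> disjoint transpositions; composing with one
  of them removes it.\<close>

lemma sign_disjoint_swaps:
  assumes "finite T" "inj_on f T" "inj_on g T" "f ` T \<inter> g ` T = {}"
    and "\<And>j. j \<in> T \<Longrightarrow> \<rho> (f j) = g j" "\<And>j. j \<in> T \<Longrightarrow> \<rho> (g j) = f j"
    and "\<And>z. z \<notin> f ` T \<Longrightarrow> z \<notin> g ` T \<Longrightarrow> \<rho> z = z"
  shows "permutation \<rho> \<and> sign \<rho> = (-1) ^ card T"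
  using assms
proof (induction T arbitrary: \<rho> rule: finite_induct)
  case empty
  then have "\<rho> = id" by (intro ext) simp
  then show ?case by simp
next
  case (insert j T)
  let ?t = "Transposition.transpose (f j) (g j)"
  have fg: "f i \<noteq> f j" "g i \<noteq> g j" "f i \<noteq> g j" "g i \<noteq> f j" if "i \<in> T" for i
    using inj_onD[OF insert.prems(1), of i j] inj_onD[OF insert.prems(2), of i j] insert.prems(3) insert.hyps(2) that
    by blast+
  have ne: "f j \<noteq> g j" using insert.prems(3) by auto
  define \<rho>' where "\<rho>' = \<rho> \<circ> ?t"
  have "permutation \<rho>' \<and> sign \<rho>' = (-1) ^ card T"
  proof (rule insert.IH)
    show "inj_on f T" "inj_on g T" "f ` T \<inter> g ` T = {}"
      using inj_on_subset[OF insert.prems(1)] inj_on_subset[OF insert.prems(2)] insert.prems(3) by blast+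
    show "\<rho>' (f i) = g i" "\<rho>' (g i) = f i" if "i \<in> T" for i
      using fg[OF that] insert.prems(4,5)[of i] that by (simp_all add: \<rho>'_def)
    show "\<rho>' z = z" if "z \<notin> f ` T" "z \<notin> g ` T" for z
    proof (cases "z = f j \<or> z = g j")
      case True
      then show ?thesis using insert.prems(4,5)[of j] by (auto simp: \<rho>'_def)
    next
      case False
      then show ?thesis using that insert.prems(6)[of z] by (simp add: \<rho>'_def)
    qed
  qed
  moreover have \<rho>: "\<rho> = \<rho>' \<circ> ?t"
    unfolding \<rho>'_def by (simp add: fun_eq_iff)
  moreover have "sign ?t = -1" using ne by (simp add: sign_swap_id)
  ultimately have "permutation \<rho>" "sign \<rho> = - ((-1) ^ card T)"
    unfolding \<rho> using permutation_compose[of \<rho>' ?t] sign_compose[of \<rho>' ?t] permutation_swap_id[of "f j" "g j"]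
    by (simp_all del: comp_apply)
  then show ?case using insert.hyps by simp
qed

text \<open>The reduction to a standard position: \<open>m\<close> factors \<open>\<delta>'\<close> stand at the positions \<open>k - m, \<dots>, k - 1\<close>, and
  the factor at position \<open>i\<close> pairs the points \<open>i - m\<close> and \<open>i\<close>. Swapping the row \<open>2 (i - m) + 1\<close> with \<open>2 i\<close> turns
  the remaining factors into a term of the Pfaffian at the points \<open>0, \<dots>, k - m - 1\<close>.\<close>

definition std_swap :: "nat \<Rightarrow> nat \<Rightarrow> nat \<Rightarrow> nat" where
  "std_swap k m z =
     (if odd z \<and> z div 2 \<in> {k-2*m..<k-m} then 2 * (z div 2 + m)
      else if even z \<and> z div 2 \<in> {k-m..<k} then 2 * (z div 2 - m) + 1 else z)"

lemma std_swap_odd: "w \<in> {k-2*m..<k-m} \<Longrightarrow> std_swap k m (2 * w + 1) = 2 * (w + m)"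
  by (simp add: std_swap_def)

lemma std_swap_even: "i \<in> {k-m..<k} \<Longrightarrow> std_swap k m (2 * i) = 2 * (i - m) + 1"
  by (simp add: std_swap_def)

lemma std_swap_other:
  "\<not> (odd z \<and> z div 2 \<in> {k-2*m..<k-m}) \<Longrightarrow> \<not> (even z \<and> z div 2 \<in> {k-m..<k}) \<Longrightarrow> std_swap k m z = z"
  by (simp only: std_swap_def if_False)

lemma std_swap_involution:
  assumes "2 * m \<le> k"
  shows "std_swap k m (std_swap k m z) = z"
proof -
  consider "odd z \<and> z div 2 \<in> {k-2*m..<k-m}" | "even z \<and> z div 2 \<in> {k-m..<k}"
    | "\<not> (odd z \<and> z div 2 \<in> {k-2*m..<k-m})" "\<not> (even z \<and> z div 2 \<in> {k-m..<k})" by blast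
  then show ?thesis
  proof cases
    case 1
    then obtain w where z: "z = 2 * w + 1" using oddE by blast
    have w: "w \<in> {k-2*m..<k-m}" using 1 unfolding z by simp
    have "w + m \<in> {k-m..<k}" using w assms by auto
    then show ?thesis unfolding z std_swap_odd[OF w] by (subst std_swap_even) simp_all
  next
    case 2
    then obtain i where z: "z = 2 * i" by blast
    have i: "i \<in> {k-m..<k}" using 2 unfolding z by simp
    have "i - m \<in> {k-2*m..<k-m}" "m \<le> i" using i assms by auto
    then show ?thesis unfolding z std_swap_even[OF i] by (subst std_swap_odd) simp_all
  next
    case 3
    then have "std_swap k m z = z" by (rule std_swap_other)
    then show ?thesis by simp
  qed
qed

lemma std_swap_permutes:
  assumes "2 * m \<le> k"
  shows "std_swap k m permutes {..<2*k}"
proof -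
  have sub: "std_swap k m z < 2*k" if "z < 2*k" for z
    using that by (auto simp: std_swap_def)
  show ?thesis
  proof (rule bij_imp_permutes)
    show "bij_betw (std_swap k m) {..<2*k} {..<2*k}"
      by (rule bij_betw_byWitness[where f' = "std_swap k m"])
        (use sub std_swap_involution[OF assms] in auto)
    show "std_swap k m z = z" if "z \<notin> {..<2*k}" for z
      using that by (auto simp: std_swap_def)
  qed
qed

lemma sign_std_swap:
  assumes "2 * m \<le> k"
  shows "sign (std_swap k m) = (-1) ^ m"
proof -
  have "permutation (std_swap k m) \<and> sign (std_swap k m) = (-1) ^ card {k-m..<k}"
  proof (rule sign_disjoint_swaps[where f = "\<lambda>i. 2 * (i - m) + 1" and g = "\<lambda>i. 2 * i"])
    show "inj_on (\<lambda>i. 2 * (i - m) + 1) {k-m..<k}"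
      using assms by (auto simp: inj_on_def)
    show "(\<lambda>i. 2 * (i - m) + 1) ` {k-m..<k} \<inter> (\<lambda>i. 2 * i) ` {k-m..<k} = {}"
      by auto presburger
    fix z assume z: "z \<notin> (\<lambda>i. 2 * (i - m) + 1) ` {k-m..<k}" "z \<notin> (\<lambda>i. 2 * i) ` {k-m..<k}"
    show "std_swap k m z = z"
    proof (rule std_swap_other)
      show "\<not> (odd z \<and> z div 2 \<in> {k-2*m..<k-m})"
      proof
        assume o: "odd z \<and> z div 2 \<in> {k-2*m..<k-m}"
        then have "z = 2 * ((z div 2 + m) - m) + 1" "z div 2 + m \<in> {k-m..<k}" using assms by auto
        then show False using z(1) by blast
      qed
      show "\<not> (even z \<and> z div 2 \<in> {k-m..<k})"
      proof
        assume "even z \<and> z div 2 \<in> {k-m..<k}"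
        then have "z = 2 * (z div 2)" "z div 2 \<in> {k-m..<k}" by auto
        then show False using z(2) by blast
      qed
    qed
  next
    fix i assume i: "i \<in> {k-m..<k}"
    have "i - m \<in> {k-2*m..<k-m}" "m \<le> i" using i assms by auto
    then show "std_swap k m (2 * (i - m) + 1) = 2 * i" by (subst std_swap_odd) simp_all
    show "std_swap k m (2 * i) = 2 * (i - m) + 1" by (rule std_swap_even[OF i])
  qed (auto simp: inj_on_def)
  then show ?thesis using assms by simp
qed

text \<open>In standard position the first rows of the two points of a pair meet at one merged
  point, and exactly one of them is differentiated. If it is that of the second point, the two come
  in the order of \<open>kernel_A\<close>; if it is that of the first, they are exchanged.
  \<open>R\<close> will collect the merged points of the latter kind.\<close>

definition flip_points :: "nat set \<Rightarrow> nat \<Rightarrow> nat" where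
  "flip_points R z = (if z div 2 \<in> R then (if even z then z + 1 else z - 1) else z)"

lemma flip_points_involution: "flip_points R (flip_points R z) = z"
proof (cases "even z")
  case True
  then obtain w where "z = 2 * w" by blast
  then show ?thesis by (simp add: flip_points_def)
next
  case False
  then obtain w where "z = 2 * w + 1" using oddE by blast
  then show ?thesis by (simp add: flip_points_def)
qed

lemma flip_points_div [simp]: "flip_points R z div 2 = z div 2"
  by (auto simp: flip_points_def elim!: oddE)

lemma flip_points_permutes:
  assumes "R \<subseteq> {..<n}"
  shows "flip_points R permutes {..<2*n}"
proof -
  have lt: "z < 2*n \<longleftrightarrow> z div 2 < n" for z :: nat by auto
  show ?thesis
  proof (rule bij_imp_permutes)
    show "bij_betw (flip_points R) {..<2*n} {..<2*n}"
      by (rule bij_betw_byWitness[where f' = "flip_points R"])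
        (auto simp: flip_points_involution lt)
    show "flip_points R z = z" if "z \<notin> {..<2*n}" for z
    proof -
      have "z div 2 \<notin> R" using that assms lt[of z] by auto
      then show ?thesis by (simp add: flip_points_def)
    qed
  qed
qed

lemma sign_flip_points:
  assumes "finite R"
  shows "sign (flip_points R) = (-1) ^ card R"
proof -
  have "permutation (flip_points R) \<and> sign (flip_points R) = (-1) ^ card R"
  proof (rule sign_disjoint_swaps[OF assms, where f = "\<lambda>i. 2 * i" and g = "\<lambda>i. 2 * i + 1"])
    show "(\<lambda>i. 2 * i) ` R \<inter> (\<lambda>i. 2 * i + 1) ` R = {}"
      by auto presburger
    fix z assume z: "z \<notin> (\<lambda>i. 2 * i) ` R" "z \<notin> (\<lambda>i. 2 * i + 1) ` R"
    have "z = 2 * (z div 2) \<or> z = 2 * (z div 2) + 1" by presburger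
    then have "z div 2 \<notin> R" using z by blast
    then show "flip_points R z = z" by (simp add: flip_points_def)
  qed (auto simp: inj_on_def flip_points_def)
  then show ?thesis by blast
qed

text \<open>The point whose second row is to stand in slot \<open>a\<close> of the tail: slots 2i
  and 2i+1 belong to the points i - m and i.\<close>

definition std_pair :: "nat \<Rightarrow> nat \<Rightarrow> nat" where
  "std_pair m a = (if even a then a div 2 - m else a div 2)"

definition std_position :: "nat \<Rightarrow> nat \<Rightarrow> (nat \<Rightarrow> nat) \<Rightarrow> bool" where
  "std_position k m \<sigma> \<longleftrightarrow> (\<forall>a\<in>{2*(k-m)..<2*k}. \<sigma> a = 2 * std_pair m a + 1)"

text \<open>\<open>std_swap\<close> sends the row prescribed for a tail slot to the number of that
  slot, so standard position means that the composition fixes the tail.\<close>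

lemma std_position_iff:
  assumes m: "2 * m \<le> k" and \<sigma>: "\<sigma> permutes {..<2*k}"
  shows "std_position k m \<sigma> \<longleftrightarrow> (std_swap k m \<circ> \<sigma>) permutes {..<2*(k-m)}"
proof -
  have std: "std_swap k m (2 * std_pair m a + 1) = a" if "a \<in> {2*(k-m)..<2*k}" for a
  proof (cases "even a")
    case True
    then obtain i where a: "a = 2 * i" by blast
    have "i - m \<in> {k-2*m..<k-m}" "m \<le> i" using that m unfolding a by auto
    then show ?thesis unfolding a std_pair_def by (simp add: std_swap_odd[simplified])
  next
    case False
    then obtain i where a: "a = 2 * i + 1" using oddE by blast
    have "k - m \<le> i" using that unfolding a by auto
    then show ?thesis unfolding a std_pair_def by (simp add: std_swap_def)
  qed
  have iff: "\<sigma> a = 2 * std_pair m a + 1 \<longleftrightarrow> std_swap k m (\<sigma> a) = a" if "a \<in> {2*(k-m)..<2*k}" for a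
    using std[OF that] std_swap_involution[OF m] by metis
  have \<rho>\<sigma>: "(std_swap k m \<circ> \<sigma>) permutes {..<2*k}"
    by (intro permutes_compose std_swap_permutes m \<sigma>)
  show ?thesis
  proof
    assume "std_position k m \<sigma>"
    then have "(std_swap k m \<circ> \<sigma>) a = a" if "a \<in> {2*(k-m)..<2*k}" for a
      using that iff by (simp add: std_position_def)
    then show "(std_swap k m \<circ> \<sigma>) permutes {..<2*(k-m)}"
      by (intro permutes_superset[OF \<rho>\<sigma>]) auto
  next
    assume "(std_swap k m \<circ> \<sigma>) permutes {..<2*(k-m)}"
    then have "(std_swap k m \<circ> \<sigma>) a = a" if "a \<in> {2*(k-m)..<2*k}" for a
      using that permutes_not_in[of "std_swap k m \<circ> \<sigma>" "{..<2*(k-m)}" a] by auto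
    then show "std_position k m \<sigma>"
      using iff by (simp add: std_position_def)
  qed
qed


lemma diff_points_std:
  fixes k m :: nat
  assumes "2 * m \<le> k" "E \<subseteq> {k-m..<k}"
  defines "d \<equiv> (\<lambda>i. i - m) ` E \<union> ({k-m..<k} - E)"
  shows "p < k - m \<Longrightarrow> p \<in> d \<longleftrightarrow> p \<in> (\<lambda>i. i - m) ` E"
    and "i \<in> {k-m..<k} \<Longrightarrow> i \<in> d \<longleftrightarrow> i - m \<notin> (\<lambda>i. i - m) ` E"
    and "p < k - 2 * m \<Longrightarrow> p \<notin> (\<lambda>i. i - m) ` E"
proof -
  show 1: "p \<in> d \<longleftrightarrow> p \<in> (\<lambda>i. i - m) ` E" if "p < k - m"
    using that unfolding d_def by auto
  have ge: "m \<le> j" if "j \<in> E" for j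
  proof -
    have "j \<in> {k-m..<k}" using that assms(2) by blast
    then have "k - m \<le> j" by simp
    then show ?thesis using assms(1) by linarith
  qed
  show "i \<in> d \<longleftrightarrow> i - m \<notin> (\<lambda>i. i - m) ` E" if i: "i \<in> {k-m..<k}"
  proof -
    have "i \<notin> (\<lambda>i. i - m) ` E"
    proof
      assume "i \<in> (\<lambda>i. i - m) ` E"
      then obtain j where j: "j \<in> E" "i = j - m" by blast
      have "j < k" using j(1) assms(2) by auto
      then show False using j i ge[OF j(1)] by auto
    qed
    moreover have "i - m \<in> (\<lambda>i. i - m) ` E \<longleftrightarrow> i \<in> E"
    proof
      assume "i - m \<in> (\<lambda>i. i - m) ` E"
      then obtain j where j: "j \<in> E" "i - m = j - m" by blast
      have "m \<le> i" using i assms(1) by auto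
      then have "i = j" using j ge[OF j(1)] by auto
      then show "i \<in> E" using j by simp
    qed blast
    ultimately show ?thesis using i unfolding d_def by blast
  qed
  show "p \<notin> (\<lambda>i. i - m) ` E" if "p < k - 2 * m"
  proof
    assume "p \<in> (\<lambda>i. i - m) ` E"
    then obtain j where j: "j \<in> E" "p = j - m" by blast
    have "k - m \<le> j" using j(1) assms(2) by auto
    then show False using j(2) that by linarith
  qed
qed

text \<open>The dictionary between what is left of B and the rows of A at the points below k - m. A
  point below k - 2m is unpaired and keeps both rows, with a 2 from the second. For a paired point
  the two rows are the first rows of the partners, and the differentiated one becomes minus a second
  row of A; before merging, its odd row is read at the partner \<open>a div 2 + m\<close>.\<close>

lemma std_swap_row:
  fixes k m :: nat
  assumes m: "2 * m \<le> k" and E: "E \<subseteq> {k-m..<k}" and a: "a < 2 * (k - m)"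
  defines "d \<equiv> (\<lambda>i. i - m) ` E \<union> ({k-m..<k} - E)" and "R \<equiv> (\<lambda>i. i - m) ` E"
  shows "diff_comp d (std_swap k m a) = row_comp (flip_points R a)" (is ?comp)
    and "diff_coeff d (std_swap k m a) = (if a div 2 < k - 2 * m then (if odd a then 2 else 1)
        else if (a div 2 \<in> R) = even a then - 1 else 1)" (is ?coeff)
    and "std_swap k m a div 2 = (if odd a \<and> k - 2 * m \<le> a div 2 then a div 2 + m else a div 2)" (is ?pt)
proof -
  have p: "a div 2 < k - m" using a by auto
  note dp = diff_points_std[OF m E, folded d_def R_def]
  have "?comp \<and> ?coeff \<and> ?pt"
  proof (cases "odd a \<and> k - 2 * m \<le> a div 2")
    case True
    then obtain w where aw: "a = 2 * w + 1" using oddE by blast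
    have w: "w \<in> {k-2*m..<k-m}" using True p unfolding aw by simp
    have wm: "w + m \<in> {k-m..<k}" using w m by auto
    have dw: "w + m \<in> d \<longleftrightarrow> w \<notin> R" using dp(2)[OF wm] by simp
    have \<rho>: "std_swap k m a = 2 * (w + m)" unfolding aw by (rule std_swap_odd[OF w])
    have fl: "flip_points R a = (if w \<in> R then 2 * w else a)" unfolding aw flip_points_def by simp
    have ge: "\<not> w < k - 2 * m" using w by simp
    show ?thesis
      unfolding \<rho> fl diff_comp_def diff_coeff_def row_comp_def using dw ge by (cases "w \<in> R") (simp_all add: aw)
  next
    case False
    have \<rho>: "std_swap k m a = a"
      by (rule std_swap_other) (use False p in auto)
    have dw: "a div 2 \<in> d \<longleftrightarrow> a div 2 \<in> R" by (rule dp(1)[OF p])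
    have R: "a div 2 < k - 2 * m \<Longrightarrow> a div 2 \<notin> R" by (rule dp(3))
    show ?thesis
    proof (cases "even a")
      case True
      then have fl: "flip_points R a = (if a div 2 \<in> R then a + 1 else a)" by (simp add: flip_points_def)
      show ?thesis
        unfolding \<rho> fl diff_comp_def diff_coeff_def row_comp_def using dw R True
        by (cases "a div 2 \<in> R"; cases "a div 2 < k - 2 * m") simp_all
    next
      case odd: False
      then have lt: "a div 2 < k - 2 * m" using False by simp
      then have "a div 2 \<notin> R" by (rule R)
      then have fl: "flip_points R a = a" by (simp add: flip_points_def)
      show ?thesis
        unfolding \<rho> fl diff_comp_def diff_coeff_def row_comp_def using odd lt by simp
    qed
  qed
  then show ?comp ?coeff ?pt by blast+
qed

text \<open>One factor 2 for each unpaired point and one - 1 for each pair, whichever of its two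
  points was differentiated.\<close>

lemma prod_std_coeff:
  fixes k m :: nat
  assumes "2 * m \<le> k"
  shows "(\<Prod>a<2*(k-m). if a div 2 < k - 2 * m then (if odd a then 2 else 1)
        else if (a div 2 \<in> R) = even a then - 1 else 1 :: real) = 2 ^ (k - 2 * m) * (-1) ^ m"
proof -
  have "(\<Prod>a<2*(k-m). if a div 2 < k - 2 * m then (if odd a then 2 else 1)
        else if (a div 2 \<in> R) = even a then - 1 else 1 :: real) = (\<Prod>p<k-m. if p < k - 2 * m then 2 else - 1)"
    unfolding prod_lessThan_double by (intro prod.cong refl) simp
  also have "{..<k-m} = {..<k-2*m} \<union> {k-2*m..<k-m}" by auto
  also have "(\<Prod>p\<in>{..<k-2*m} \<union> {k-2*m..<k-m}. if p < k - 2 * m then 2 else - 1 :: real)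
      = (\<Prod>p<k-2*m. 2) * (\<Prod>p=k-2*m..<k-m. - 1)"
    by (subst prod.union_disjoint) (auto intro!: arg_cong2[where f = "(*)"] prod.cong)
  also have "\<dots> = 2 ^ (k - 2 * m) * (-1) ^ m"
    using assms by simp
  finally show ?thesis .
qed

lemma std_rows:
  fixes k m :: nat
  assumes m: "2 * m \<le> k" and \<sigma>: "\<sigma> permutes {..<2*(k-m)}" and i: "i \<in> {k-m..<k}"
  shows "(std_swap k m \<circ> \<sigma>) (2*i) = 2 * (i - m) + 1" "(std_swap k m \<circ> \<sigma>) (2*i+1) = 2*i+1"
proof -
  have fix1: "\<sigma> (2*i) = 2*i" "\<sigma> (2*i+1) = 2*i+1"
    using i by (auto intro!: permutes_not_in[OF \<sigma>])
  show "(std_swap k m \<circ> \<sigma>) (2*i) = 2 * (i - m) + 1"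
    unfolding comp_apply fix1 by (rule std_swap_even[OF i])
  show "(std_swap k m \<circ> \<sigma>) (2*i+1) = 2*i+1"
    unfolding comp_apply fix1 by (rule std_swap_other) (use i in auto)
qed

lemma dist_term_std:
  fixes k m :: nat
  assumes A: "smooth (case_prod A)" and m: "2 * m \<le> k" and \<sigma>: "\<sigma> permutes {..<2*(k-m)}"
  defines "S \<equiv> {k-m..<k}"
  shows "delta_rows (std_swap k m \<circ> \<sigma>) S"
    and "dist_term_vars k (std_swap k m \<circ> \<sigma>) S = {..<k-m}"
    and "dist_term (kernel_B A) k (std_swap k m \<circ> \<sigma>) S x = (\<Sum>E\<in>Pow S. (-1) ^ card E * (2 ^ (k - 2 * m) * (-1) ^ m *
      (\<Prod>i<k-m. block_matrix (kernel_A A) x ((flip_points ((\<lambda>i. i - m) ` E) \<circ> \<sigma>) (2*i))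
         ((flip_points ((\<lambda>i. i - m) ` E) \<circ> \<sigma>) (2*i+1)))))"
proof -
  let ?\<sigma> = "std_swap k m \<circ> \<sigma>"
  let ?P = "point_pair ?\<sigma>"
  note rows = std_rows[OF m \<sigma>, folded S_def]
  show odd: "delta_rows ?\<sigma> S"
    unfolding delta_rows_def by (intro ballI) (simp only: rows, simp)
  have P: "fst (?P i) = i - m" "snd (?P i) = i" if "i \<in> S" for i
    using rows[OF that] by (simp_all add: point_pair_def)
  have "(\<lambda>i. snd (?P i)) ` S = S" using P(2) by (simp add: image_def)
  then show "dist_term_vars k ?\<sigma> S = {..<k-m}"
    unfolding dist_term_vars_def S_def by auto
  have "\<sigma> permutes {..<2*k}" by (rule permutes_subset[OF \<sigma>]) auto
  then have perm: "?\<sigma> permutes {..<2*k}"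
    by (intro permutes_compose std_swap_permutes m)
  have inj: "inj_on (snd \<circ> ?P) S" using P(2) by (simp add: inj_on_def)
  have merge: "merge_pairs ?P S p = (if p \<in> S then p - m else p)" for p
  proof (cases "p \<in> S")
    case True
    then show ?thesis using merge_pairs_snd[OF True inj] P by simp
  next
    case False
    then have "p \<notin> (snd \<circ> ?P) ` S" using P(2) by auto
    then show ?thesis using False by (simp add: merge_pairs_other)
  qed
  have Sk: "S \<subseteq> {..<k}" unfolding S_def by auto
  have rest: "{..<k} - S = {..<k-m}" unfolding S_def by auto
  show "dist_term (kernel_B A) k ?\<sigma> S x = (\<Sum>E\<in>Pow S. (-1) ^ card E * (2 ^ (k - 2 * m) * (-1) ^ m *
      (\<Prod>i<k-m. block_matrix (kernel_A A) x ((flip_points ((\<lambda>i. i - m) ` E) \<circ> \<sigma>) (2*i))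
         ((flip_points ((\<lambda>i. i - m) ` E) \<circ> \<sigma>) (2*i+1)))))"
    unfolding dist_term_delta_rows[OF A perm Sk odd] rest
  proof (intro sum.cong refl arg_cong2[where f = "(*)"])
    fix E assume "E \<in> Pow S"
    then have E: "E \<subseteq> {k-m..<k}" by (simp add: S_def)
    define R where "R = (\<lambda>i. i - m) ` E"
    define d where "d = (\<lambda>i. i - m) ` E \<union> ({k-m..<k} - E)"
    define c where "c a = (if a div 2 < k - 2 * m then (if odd a then 2 else 1)
        else if (a div 2 \<in> R) = even a then - 1 else 1 :: real)" for a
    have "(fst \<circ> ?P) ` E = (\<lambda>i. i - m) ` E" "(snd \<circ> ?P) ` (S - E) = S - E"
      using P E unfolding S_def[symmetric] by (auto simp: image_iff subset_iff Bex_def)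
    then have dp: "diff_points ?P S E = d"
      by (simp only: diff_points_def d_def S_def)
    have row: "diff_comp d (std_swap k m a) = row_comp (flip_points R a)" "diff_coeff d (std_swap k m a) = c a"
      "merge_pairs ?P S (std_swap k m a div 2) = flip_points R a div 2" if "a < 2 * (k - m)" for a
    proof -
      show "diff_comp d (std_swap k m a) = row_comp (flip_points R a)" "diff_coeff d (std_swap k m a) = c a"
        unfolding c_def d_def R_def by (rule std_swap_row[OF m E that])+
      have "a div 2 < k - m" using that by auto
      then show "merge_pairs ?P S (std_swap k m a div 2) = flip_points R a div 2"
        unfolding std_swap_row(3)[OF m E that] merge flip_points_div using m by (auto simp: S_def)
    qed
    have lt: "\<sigma> (2*i) < 2*(k-m)" "\<sigma> (2*i+1) < 2*(k-m)" if "i < k - m" for i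
      using that permutes_in_image[OF \<sigma>, of "2*i"] permutes_in_image[OF \<sigma>, of "2*i+1"] by auto
    have "(\<Prod>i<k-m. diff_entry A (diff_points ?P S E) (x \<circ> merge_pairs ?P S) (?\<sigma> (2*i)) (?\<sigma> (2*i+1)))
      = (\<Prod>i<k-m. (c (\<sigma> (2*i)) * c (\<sigma> (2*i+1))) * block_matrix (kernel_A A) x ((flip_points R \<circ> \<sigma>) (2*i)) ((flip_points R \<circ> \<sigma>) (2*i+1)))"
      unfolding dp
      by (intro prod.cong refl) (simp only: diff_entry_def block_matrix_def comp_apply row[OF lt(1)] row[OF lt(2)] lessThan_iff)
    also have "\<dots> = (\<Prod>i<k-m. c (\<sigma> (2*i)) * c (\<sigma> (2*i+1))) *
       (\<Prod>i<k-m. block_matrix (kernel_A A) x ((flip_points R \<circ> \<sigma>) (2*i)) ((flip_points R \<circ> \<sigma>) (2*i+1)))"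
      by (rule prod.distrib)
    \<comment> \<open>The coefficients multiply up over all rows, so their product does not depend
      on \<sigma>.\<close>
    also have "(\<Prod>i<k-m. c (\<sigma> (2*i)) * c (\<sigma> (2*i+1))) = (\<Prod>a<2*(k-m). c (\<sigma> a))"
      by (rule prod_lessThan_double[symmetric])
    also have "\<dots> = (\<Prod>a<2*(k-m). c a)"
      using prod.permute[OF \<sigma>, of c] by (simp add: comp_def)
    also have "\<dots> = 2 ^ (k - 2 * m) * (-1) ^ m"
      unfolding c_def by (rule prod_std_coeff[OF m])
    finally show "(\<Prod>i<k-m. diff_entry A (diff_points ?P S E) (x \<circ> merge_pairs ?P S) (?\<sigma> (2*i)) (?\<sigma> (2*i+1)))
      = 2 ^ (k - 2 * m) * (-1) ^ m *
      (\<Prod>i<k-m. block_matrix (kernel_A A) x ((flip_points ((\<lambda>i. i - m) ` E) \<circ> \<sigma>) (2*i))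
         ((flip_points ((\<lambda>i. i - m) ` E) \<circ> \<sigma>) (2*i+1)))"
      unfolding R_def .
  qed
qed

lemma delta_rows_tail_iff: "delta_rows \<sigma> {k-m..<k} \<longleftrightarrow> (\<forall>a\<in>{2*(k-m)..<2*k}. odd (\<sigma> a))"
proof
  assume "delta_rows \<sigma> {k-m..<k}"
  then show "\<forall>a\<in>{2*(k-m)..<2*k}. odd (\<sigma> a)"
    by (intro ballI delta_rows_odd) auto
qed (auto simp: delta_rows_def)

lemma std_pair_props:
  assumes "2 * m \<le> k"
  shows "inj_on (std_pair m) {2*(k-m)..<2*k}" "std_pair m ` {2*(k-m)..<2*k} \<subseteq> {..<k}"
proof -
  have "a = b" if a: "a \<in> {2*(k-m)..<2*k}" and b: "b \<in> {2*(k-m)..<2*k}" and eq: "std_pair m a = std_pair m b" for a b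
  proof -
    have ab: "m \<le> a div 2" "m \<le> b div 2" "a div 2 - m < k - m" "b div 2 - m < k - m" "k - m \<le> a div 2" "k - m \<le> b div 2"
      using a b assms by auto
    have "even a = even b \<and> a div 2 = b div 2"
      using eq ab by (cases "even a"; cases "even b") (auto simp: std_pair_def eq_diff_iff)
    then show ?thesis by (metis div_mult_mod_eq mod2_eq_if)
  qed
  then show "inj_on (std_pair m) {2*(k-m)..<2*k}" by (auto simp: inj_on_def)
  show "std_pair m ` {2*(k-m)..<2*k} \<subseteq> {..<k}"
    unfolding std_pair_def by auto
qed

text \<open>The 2m tail slots hold second rows only, at most one from each of the k points; this
  forces 2m \<le> k.\<close>

lemma delta_rows_tail_points:
  assumes \<sigma>: "\<sigma> permutes {..<2*k}" and mk: "m \<le> k" and odd: "delta_rows \<sigma> {k-m..<k}"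
  shows "inj_on (\<lambda>a. \<sigma> a div 2) {2*(k-m)..<2*k}" "(\<lambda>a. \<sigma> a div 2) ` {2*(k-m)..<2*k} \<subseteq> {..<k}" "2 * m \<le> k"
proof -
  have o: "odd (\<sigma> a)" if "a \<in> {2*(k-m)..<2*k}" for a
    using odd that unfolding delta_rows_tail_iff by blast
  show inj: "inj_on (\<lambda>a. \<sigma> a div 2) {2*(k-m)..<2*k}"
  proof (rule inj_onI)
    fix a b assume ab: "a \<in> {2*(k-m)..<2*k}" "b \<in> {2*(k-m)..<2*k}" "\<sigma> a div 2 = \<sigma> b div 2"
    have "\<sigma> a = \<sigma> b" by (rule odd_div_two_eq[OF o[OF ab(1)] o[OF ab(2)] ab(3)])
    then show "a = b" using permutes_inj[OF \<sigma>] by (simp add: inj_eq)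
  qed
  show sub: "(\<lambda>a. \<sigma> a div 2) ` {2*(k-m)..<2*k} \<subseteq> {..<k}"
  proof
    fix p assume "p \<in> (\<lambda>a. \<sigma> a div 2) ` {2*(k-m)..<2*k}"
    then obtain a where a: "a < 2*k" "p = \<sigma> a div 2" by auto
    then have "\<sigma> a < 2*k" using permutes_in_image[OF \<sigma>, of a] by auto
    then show "p \<in> {..<k}" using a by auto
  qed
  have "card {2*(k-m)..<2*k} \<le> card {..<k}"
    by (rule card_inj_on_le[OF inj sub]) simp
  then show "2 * m \<le> k" using mk by simp
qed

text \<open>Supplies the renaming of points that links an arbitrary placement of the \<delta>' pairs
  to the standard one.\<close>

lemma exists_points_perm:
  assumes m: "2 * m \<le> k" and \<phi>: "inj_on \<phi> {2*(k-m)..<2*k}" "\<phi> ` {2*(k-m)..<2*k} \<subseteq> {..<k}"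
  obtains \<pi> where "\<pi> permutes {..<k}" "\<And>a. a \<in> {2*(k-m)..<2*k} \<Longrightarrow> \<pi> (std_pair m a) = \<phi> a"
proof -
  let ?J = "{2*(k-m)..<2*k}"
  let ?f = "\<phi> \<circ> inv_into ?J (std_pair m)"
  note sp = std_pair_props[OF m]
  have img: "inv_into ?J (std_pair m) ` (std_pair m ` ?J) = ?J"
    using sp(1) by simp
  have "inj_on ?f (std_pair m ` ?J)"
    by (intro comp_inj_on inj_on_inv_into) (simp_all only: subset_refl img \<phi>(1))
  moreover have "?f ` (std_pair m ` ?J) \<subseteq> {..<k}"
    unfolding image_comp[symmetric] img by (rule \<phi>(2))
  ultimately obtain \<pi> where \<pi>: "\<pi> permutes {..<k}" "\<And>x. x \<in> std_pair m ` ?J \<Longrightarrow> \<pi> x = ?f x"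
    using sp(2) exists_permutes_extending[of ?f "std_pair m ` ?J" "{..<k}"] by blast
  show ?thesis
  proof
    show "\<pi> permutes {..<k}" by (rule \<pi>(1))
    show "\<pi> (std_pair m a) = \<phi> a" if "a \<in> ?J" for a
      using \<pi>(2)[of "std_pair m a"] that by (simp add: inv_into_f_f[OF sp(1)])
  qed
qed

text \<open>The terms with a prescribed assignment \<phi> of points to the tail slots are the
  translates by \<pi> of the terms in standard position, so all assignments lead to the same
  sum.\<close>

lemma std_position_points:
  assumes \<pi>: "\<pi> permutes {..<k}" and \<phi>: "\<And>a. a \<in> {2*(k-m)..<2*k} \<Longrightarrow> \<pi> (std_pair m a) = \<phi> a"
  shows "delta_rows (block_perm \<pi> \<circ> \<sigma>) {k-m..<k} \<and> (\<forall>a\<in>{2*(k-m)..<2*k}. (block_perm \<pi> \<circ> \<sigma>) a div 2 = \<phi> a)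
      \<longleftrightarrow> std_position k m \<sigma>"
proof -
  have "odd (\<sigma> a) \<and> \<pi> (\<sigma> a div 2) = \<phi> a \<longleftrightarrow> \<sigma> a = 2 * std_pair m a + 1" if "a \<in> {2*(k-m)..<2*k}" for a
  proof -
    have "\<pi> (\<sigma> a div 2) = \<phi> a \<longleftrightarrow> \<sigma> a div 2 = std_pair m a"
      unfolding \<phi>[OF that, symmetric] using permutes_inj[OF \<pi>] by (rule inj_eq)
    moreover have "odd (\<sigma> a) \<and> \<sigma> a div 2 = std_pair m a \<longleftrightarrow> \<sigma> a = 2 * std_pair m a + 1"
      by presburger
    ultimately show ?thesis by blast
  qed
  then show ?thesis
    unfolding delta_rows_tail_iff std_position_def by (simp add: ball_conj_distrib[symmetric])
qed


lemma permutation_block_simps: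
  "block_perm id = id" "id \<circ> f = f" "f \<circ> id = f"
  by (simp_all add: block_perm_id)

section \<open>Integrals of the terms in the expansion of the distributional Pfaffian\<close>

context decaying_kernel begin

abbreviation term_integral :: "nat \<Rightarrow> (nat \<Rightarrow> nat) \<Rightarrow> nat set \<Rightarrow> real" where
  "term_integral k \<sigma> S \<equiv> (LINT x : half_box x0 (dist_term_vars k \<sigma> S) | lebesgue_prod (dist_term_vars k \<sigma> S).
      dist_term (kernel_B A) k \<sigma> S x)"

abbreviation term_integrable :: "nat \<Rightarrow> (nat \<Rightarrow> nat) \<Rightarrow> nat set \<Rightarrow> bool" where
  "term_integrable k \<sigma> S \<equiv> set_integrable (lebesgue_prod (dist_term_vars k \<sigma> S)) (half_box x0 (dist_term_vars k \<sigma> S))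
      (dist_term (kernel_B A) k \<sigma> S)"

definition monomial_integral :: "nat \<Rightarrow> (nat \<Rightarrow> nat) \<Rightarrow> real" where
  "monomial_integral n \<sigma> = (LINT x : half_box x0 {..<n} | lebesgue_prod {..<n}.
     \<Prod>i<n. block_matrix (kernel_A A) x (\<sigma> (2*i)) (\<sigma> (2*i+1)))"

lemma pfaffian_integral_monomials:
  "pfaffian_integral (kernel_A A) x0 n = (\<Sum>\<sigma> | \<sigma> permutes {..<2*n}. of_int (sign \<sigma>) * monomial_integral n \<sigma>) / (2^n * fact n)"
proof -
  let ?M = "\<lambda>\<sigma> x. \<Prod>i<n. block_matrix (kernel_A A) x (\<sigma> (2*i)) (\<sigma> (2*i+1))"
  have "(LINT x : half_box x0 {..<n} | lebesgue_prod {..<n}. \<Sum>\<sigma> | \<sigma> permutes {..<2*n}. of_int (sign \<sigma>) * ?M \<sigma> x)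
     = (\<Sum>\<sigma> | \<sigma> permutes {..<2*n}. LINT x : half_box x0 {..<n} | lebesgue_prod {..<n}. of_int (sign \<sigma>) * ?M \<sigma> x)"
  proof (rule set_integrable_finite_sum(2))
    show "set_integrable (lebesgue_prod {..<n}) (half_box x0 {..<n}) (\<lambda>x. of_int (sign \<sigma>) * ?M \<sigma> x)"
      if "\<sigma> \<in> {\<sigma>. \<sigma> permutes {..<2*n}}" for \<sigma>
      using that by (intro set_integrable_mult_right monomial_integrable) simp
  qed (simp add: finite_permutations)
  then show ?thesis
    unfolding pfaffian_integral_def pfaffian_def monomial_integral_def by simp
qed

lemma flip_compose_permutes:
  assumes "2 * m \<le> k" "E \<subseteq> {k-m..<k}" "\<sigma> permutes {..<2*(k-m)}"
  shows "(flip_points ((\<lambda>i. i - m) ` E) \<circ> \<sigma>) permutes {..<2*(k-m)}"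
proof (intro permutes_compose assms(3) flip_points_permutes)
  show "(\<lambda>i. i - m) ` E \<subseteq> {..<k-m}"
  proof
    fix p assume "p \<in> (\<lambda>i. i - m) ` E"
    then obtain i where i: "i \<in> E" "p = i - m" by blast
    then have "i \<in> {k-m..<k}" using assms(2) by blast
    then show "p \<in> {..<k-m}" using i(2) assms(1) by auto
  qed
qed

lemma term_integral_std:
  assumes m: "2 * m \<le> k" and \<sigma>: "\<sigma> permutes {..<2*(k-m)}"
  shows "term_integrable k (std_swap k m \<circ> \<sigma>) {k-m..<k}"
    and "term_integral k (std_swap k m \<circ> \<sigma>) {k-m..<k} = (\<Sum>E\<in>Pow {k-m..<k}. (-1) ^ card E *
      (2 ^ (k - 2 * m) * (-1) ^ m * monomial_integral (k - m) (flip_points ((\<lambda>i. i - m) ` E) \<circ> \<sigma>)))" (is ?eq)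
proof -
  let ?F = "\<lambda>E x. (-1) ^ card E * (2 ^ (k - 2 * m) * (-1) ^ m *
      (\<Prod>i<k-m. block_matrix (kernel_A A) x ((flip_points ((\<lambda>i. i - m) ` E) \<circ> \<sigma>) (2*i))
         ((flip_points ((\<lambda>i. i - m) ` E) \<circ> \<sigma>) (2*i+1))))"
  have int: "set_integrable (lebesgue_prod {..<k-m}) (half_box x0 {..<k-m}) (?F E)" if "E \<in> Pow {k-m..<k}" for E
    using that by (intro set_integrable_mult_right monomial_integrable flip_compose_permutes m \<sigma>) auto
  have fin: "finite (Pow {k-m..<k})" by simp
  have eq: "dist_term (kernel_B A) k (std_swap k m \<circ> \<sigma>) {k-m..<k} = (\<lambda>x. \<Sum>E\<in>Pow {k-m..<k}. ?F E x)"
    by (intro ext dist_term_std[OF smooth m \<sigma>])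
  show "term_integrable k (std_swap k m \<circ> \<sigma>) {k-m..<k}"
    unfolding dist_term_std(2)[OF smooth m \<sigma>] eq by (rule set_integrable_finite_sum(1)[OF fin int])
  have "term_integral k (std_swap k m \<circ> \<sigma>) {k-m..<k} =
      (\<Sum>E\<in>Pow {k-m..<k}. LINT x : half_box x0 {..<k-m} | lebesgue_prod {..<k-m}. ?F E x)"
    unfolding dist_term_std(2)[OF smooth m \<sigma>] eq by (rule set_integrable_finite_sum(2)[OF fin int])
  then show ?eq
    unfolding monomial_integral_def by (simp only: set_integral_mult_right)
qed

text \<open>All signs cancel: the (-1) ^ m of \<open>std_swap\<close> against that of the m
  differentiated rows, and the (-1) ^ card E of the \<delta>' against the sign of
  \<open>flip_points\<close>. The flip then only reindexes the sum over \<sigma>, so each of the 2 ^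
  m sets \<open>E\<close> contributes equally; 2 ^ (k - m) * fact (k - m) undoes the normalisation
  of \<open>pfaffian\<close>.\<close>

lemma sum_term_integral_std:
  assumes m: "2 * m \<le> k"
  shows "(\<Sum>\<sigma> | \<sigma> permutes {..<2*(k-m)}. of_int (sign (std_swap k m \<circ> \<sigma>)) * term_integral k (std_swap k m \<circ> \<sigma>) {k-m..<k})
    = 2 ^ (k - 2 * m) * 2 ^ m * (2 ^ (k - m) * fact (k - m)) * pfaffian_integral (kernel_A A) x0 (k - m)"
proof -
  let ?R = "\<lambda>E. (\<lambda>i. i - m) ` E" and ?Q = "{\<sigma>. \<sigma> permutes {..<2*(k-m)}}"
  let ?h = "\<lambda>\<sigma>. of_int (sign \<sigma>) * monomial_integral (k - m) \<sigma>"
  have "of_int (sign (std_swap k m \<circ> \<sigma>)) * term_integral k (std_swap k m \<circ> \<sigma>) {k-m..<k}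
      = (\<Sum>E\<in>Pow {k-m..<k}. 2 ^ (k - 2 * m) * ?h (flip_points (?R E) \<circ> \<sigma>))" if \<sigma>: "\<sigma> permutes {..<2*(k-m)}" for \<sigma>
  proof -
    have \<sigma>k: "\<sigma> permutes {..<2*k}" by (rule permutes_subset[OF \<sigma>]) auto
    have s: "sign (std_swap k m \<circ> \<sigma>) = (-1) ^ m * sign \<sigma>"
      by (simp only: sign_permutes_compose[OF finite_lessThan std_swap_permutes[OF m] \<sigma>k] sign_std_swap[OF m])
    have "(real_of_int ((-1) ^ m * sign \<sigma>)) * ((-1) ^ card E * (2 ^ (k - 2 * m) * (-1) ^ m * monomial_integral (k - m) (flip_points (?R E) \<circ> \<sigma>)))
       = 2 ^ (k - 2 * m) * ?h (flip_points (?R E) \<circ> \<sigma>)" if E: "E \<in> Pow {k-m..<k}" for E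
    proof -
      have fin: "finite E" using E finite_subset by blast
      have sub: "E \<subseteq> {k-m..<k}" using E by simp
      have "inj_on (\<lambda>i. i - m) E"
      proof (rule inj_onI)
        fix i j assume ij: "i \<in> E" "j \<in> E" "i - m = j - m"
        then have "i \<in> {k-m..<k}" "j \<in> {k-m..<k}" using sub by blast+
        then show "i = j" using m ij(3) by auto
      qed
      then have card: "card (?R E) = card E" by (rule card_image)
      have "?R E \<subseteq> {..<k-m}"
      proof
        fix p assume "p \<in> ?R E"
        then obtain i where i: "i \<in> E" "p = i - m" by blast
        then have "i \<in> {k-m..<k}" using sub by blast
        then show "p \<in> {..<k-m}" using i(2) m by auto
      qed
      then have "sign (flip_points (?R E) \<circ> \<sigma>) = (-1) ^ card E * sign \<sigma>"
        using sign_permutes_compose[OF finite_lessThan flip_points_permutes \<sigma>, of "?R E"]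
          sign_flip_points[of "?R E"] fin card by simp
      moreover have "(-1) ^ m * (-1) ^ m = (1::real)"
        by (simp flip: power_add)
      ultimately show ?thesis by (simp add: algebra_simps)
    qed
    then show ?thesis
      unfolding term_integral_std(2)[OF m \<sigma>] s sum_distrib_left by (intro sum.cong refl)
  qed
  then have "(\<Sum>\<sigma>\<in>?Q. of_int (sign (std_swap k m \<circ> \<sigma>)) * term_integral k (std_swap k m \<circ> \<sigma>) {k-m..<k})
      = (\<Sum>\<sigma>\<in>?Q. \<Sum>E\<in>Pow {k-m..<k}. 2 ^ (k - 2 * m) * ?h (flip_points (?R E) \<circ> \<sigma>))"
    by (intro sum.cong refl) auto
  also have "\<dots> = (\<Sum>E\<in>Pow {k-m..<k}. 2 ^ (k - 2 * m) * (\<Sum>\<sigma>\<in>?Q. ?h (flip_points (?R E) \<circ> \<sigma>)))"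
    by (subst sum.swap) (simp only: sum_distrib_left)
  also have "\<dots> = (\<Sum>E\<in>Pow {k-m..<k}. 2 ^ (k - 2 * m) * (\<Sum>\<sigma>\<in>?Q. ?h \<sigma>))"
  proof (rule sum.cong[OF refl])
    fix E assume "E \<in> Pow {k-m..<k}"
    then have "flip_points (?R E) permutes {..<2*(k-m)}"
      using flip_compose_permutes[OF m _ permutes_id, of E] by simp
    then have "(\<Sum>\<sigma>\<in>?Q. ?h (flip_points (?R E) \<circ> \<sigma>)) = (\<Sum>\<sigma>\<in>?Q. ?h \<sigma>)"
      by (rule sum_permutes_compose_left)
    then show "2 ^ (k - 2 * m) * (\<Sum>\<sigma>\<in>?Q. ?h (flip_points (?R E) \<circ> \<sigma>)) = 2 ^ (k - 2 * m) * (\<Sum>\<sigma>\<in>?Q. ?h \<sigma>)"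
      by (rule arg_cong)
  qed
  also have "\<dots> = 2 ^ m * (2 ^ (k - 2 * m) * (\<Sum>\<sigma>\<in>?Q. ?h \<sigma>))"
    using m by (simp add: card_Pow)
  also have "(\<Sum>\<sigma>\<in>?Q. ?h \<sigma>) = (2 ^ (k - m) * fact (k - m)) * pfaffian_integral (kernel_A A) x0 (k - m)"
    unfolding pfaffian_integral_monomials by simp
  finally show ?thesis by (simp only: mult_ac)
qed

lemma term_permuted:
  assumes \<sigma>: "\<sigma> permutes {..<2*k}" and S: "\<tau> ` S' \<subseteq> {..<k}"
    and \<pi>: "\<pi> permutes {..<k}" and \<tau>: "\<tau> permutes {..<k}"
  shows "term_integrable k (block_perm \<pi> \<circ> \<sigma> \<circ> block_perm \<tau>) S' \<longleftrightarrow> term_integrable k \<sigma> (\<tau> ` S')"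
    and "term_integral k (block_perm \<pi> \<circ> \<sigma> \<circ> block_perm \<tau>) S' = term_integral k \<sigma> (\<tau> ` S')"
    and "sign (block_perm \<pi> \<circ> \<sigma> \<circ> block_perm \<tau>) = sign \<sigma>"
proof -
  show "term_integrable k (block_perm \<pi> \<circ> \<sigma> \<circ> block_perm \<tau>) S' \<longleftrightarrow> term_integrable k \<sigma> (\<tau> ` S')"
    "term_integral k (block_perm \<pi> \<circ> \<sigma> \<circ> block_perm \<tau>) S' = term_integral k \<sigma> (\<tau> ` S')"
    by (rule dist_term_permuted[OF smooth \<sigma> S \<pi> \<tau> refl])+
  note b = block_perm_permutes[OF \<pi>] block_perm_permutes[OF \<tau>]
  show "sign (block_perm \<pi> \<circ> \<sigma> \<circ> block_perm \<tau>) = sign \<sigma>"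
    by (simp only: sign_permutes_compose[OF finite_lessThan permutes_compose[OF \<sigma> b(1)] b(2)]
        sign_permutes_compose[OF finite_lessThan b(1) \<sigma>] sign_block_perm[OF \<pi>] sign_block_perm[OF \<tau>] mult_1 mult_1_right)
qed

lemma exists_tail_perm:
  assumes "S \<subseteq> {..<k}"
  obtains \<tau> where "\<tau> permutes {..<k}" "\<tau> ` {k - card S..<k} = S"
proof -
  have fin: "finite S" using assms finite_subset by blast
  have le: "card S \<le> k" using card_mono[OF _ assms] by simp
  obtain g where g: "bij_betw g {k - card S..<k} S"
    using finite_same_card_bij[OF _ fin, of "{k - card S..<k}"] le by auto
  have "inj_on g {k - card S..<k}" "g ` {k - card S..<k} \<subseteq> {..<k}" "{k - card S..<k} \<subseteq> {..<k}"
    using g assms by (auto simp: bij_betw_def)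
  from exists_permutes_extending[OF this finite_lessThan]
  obtain \<tau> where \<tau>: "\<tau> permutes {..<k}" "\<And>x. x \<in> {k - card S..<k} \<Longrightarrow> \<tau> x = g x"
    by blast
  show ?thesis
  proof
    have "\<tau> ` {k - card S..<k} = g ` {k - card S..<k}" using \<tau>(2) by (rule image_cong[OF refl])
    then show "\<tau> ` {k - card S..<k} = S" using g by (simp add: bij_betw_def)
  qed (rule \<tau>(1))
qed

text \<open>Unless the coefficient vanishes, renaming the points moves the term into standard
  position, where it is a finite sum of integrable monomials.\<close>

lemma term_integrable_tail:
  assumes \<sigma>: "\<sigma> permutes {..<2*k}" and mk: "m \<le> k"
  shows "term_integrable k \<sigma> {k-m..<k}"
proof (cases "delta_rows \<sigma> {k-m..<k}")
  case True
  note pts = delta_rows_tail_points[OF \<sigma> mk True]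
  obtain \<pi> where \<pi>: "\<pi> permutes {..<k}" "\<And>a. a \<in> {2*(k-m)..<2*k} \<Longrightarrow> \<pi> (std_pair m a) = \<sigma> a div 2"
    using exists_points_perm[OF pts(3,1,2)] by blast
  define \<sigma>0 where "\<sigma>0 = block_perm (inv \<pi>) \<circ> \<sigma>"
  have "block_perm \<pi> \<circ> block_perm (inv \<pi>) = id"
    unfolding block_perm_compose[symmetric] permutes_inv_o(1)[OF \<pi>(1)] by (rule block_perm_id)
  then have \<sigma>_eq: "\<sigma> = block_perm \<pi> \<circ> \<sigma>0"
    unfolding \<sigma>0_def by (simp only: o_assoc id_o)
  have \<sigma>0: "\<sigma>0 permutes {..<2*k}"
    unfolding \<sigma>0_def by (intro permutes_compose \<sigma> block_perm_permutes permutes_inv \<pi>)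
  have "std_position k m \<sigma>0"
    using std_position_points[OF \<pi>, of \<sigma>0] True unfolding \<sigma>_eq[symmetric] by blast
  then have perm: "(std_swap k m \<circ> \<sigma>0) permutes {..<2*(k-m)}"
    using std_position_iff[OF pts(3) \<sigma>0] by blast
  have "std_swap k m \<circ> (std_swap k m \<circ> \<sigma>0) = \<sigma>0"
    using std_swap_involution[OF pts(3)] by (intro ext) simp
  then have "term_integrable k \<sigma>0 {k-m..<k}"
    using term_integral_std(1)[OF pts(3) perm] by (simp only:)
  moreover have "id ` {k-m..<k} \<subseteq> {..<k}" by auto
  ultimately show ?thesis
    using term_permuted(1)[OF \<sigma>0 _ \<pi>(1) permutes_id, of "{k-m..<k}"]
    unfolding block_perm_id o_id image_id \<sigma>_eq[symmetric] id_apply by blast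
next
  case False
  then have "dist_term (kernel_B A) k \<sigma> {k-m..<k} = (\<lambda>x. 0)"
    by (intro ext dist_term_not_delta_rows) auto
  then show ?thesis by (simp add: set_integrable_def)
qed

lemma term_integrable:
  assumes \<sigma>: "\<sigma> permutes {..<2*k}" and S: "S \<subseteq> {..<k}"
  shows "term_integrable k \<sigma> S"
proof -
  obtain \<tau> where \<tau>: "\<tau> permutes {..<k}" "\<tau> ` {k - card S..<k} = S"
    using exists_tail_perm[OF S] by blast
  have "card S \<le> k" using card_mono[OF _ S] by simp
  then have "term_integrable k (block_perm id \<circ> \<sigma> \<circ> block_perm \<tau>) {k - card S..<k}"
    by (intro term_integrable_tail permutes_compose \<sigma> block_perm_permutes \<tau> permutes_id)
  then show ?thesis
    using term_permuted(1)[OF \<sigma> _ permutes_id \<tau>(1), of "{k - card S..<k}"] S unfolding \<tau>(2) by blast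
qed

end


lemma prod_falling_fact:
  fixes j k :: nat
  assumes "j \<le> k"
  shows "(\<Prod>i\<in>{0..<j}. k - i) * fact (k - j) = fact k"
  using assms
proof (induction j)
  case (Suc j)
  then have "k - j = Suc (k - Suc j)" by simp
  then have "fact (k - j) = (k - j) * fact (k - Suc j)" by (metis fact_Suc of_nat_id)
  with Suc show ?case by (simp add: mult.assoc)
qed simp

context decaying_kernel begin

text \<open>Terms with nonzero coefficient are sorted by the injective assignment of points to the
  2m tail slots. There are k! / (k - 2m)! assignments, none if 2m > k, and each class has the same
  sum as the terms in standard position.\<close>

lemma sum_term_integral_tail:
  assumes mk: "m \<le> k"
  shows "(\<Sum>\<sigma> | \<sigma> permutes {..<2*k}. of_int (sign \<sigma>) * term_integral k \<sigma> {k-m..<k}) =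
    (if 2 * m \<le> k then fact k / fact (k - 2 * m) *
       (2 ^ (k - 2 * m) * 2 ^ m * (2 ^ (k - m) * fact (k - m)) * pfaffian_integral (kernel_A A) x0 (k - m)) else 0)"
proof -
  let ?J = "{2*(k-m)..<2*k}" and ?S = "{k-m..<k}"
  let ?Q = "{\<sigma>. \<sigma> permutes {..<2*k}}"
  let ?F = "\<lambda>\<sigma>. of_int (sign \<sigma>) * term_integral k \<sigma> ?S"
  let ?\<Phi> = "{\<phi> \<in> ?J \<rightarrow>\<^sub>E {..<k}. inj_on \<phi> ?J}"
  let ?G = "{\<sigma>. \<sigma> permutes {..<2*k} \<and> delta_rows \<sigma> ?S}"
  let ?pts = "\<lambda>\<sigma>. \<lambda>a\<in>?J. \<sigma> a div 2"
  have fin: "finite ?Q" by (simp add: finite_permutations)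
  have F0: "?F \<sigma> = 0" if "\<not> delta_rows \<sigma> ?S" for \<sigma>
  proof -
    have "dist_term (kernel_B A) k \<sigma> ?S = (\<lambda>x. 0)"
      using that by (intro ext dist_term_not_delta_rows) auto
    then show ?thesis by simp
  qed
  have restrict: "(\<Sum>\<sigma>\<in>?Q. ?F \<sigma>) = (\<Sum>\<sigma>\<in>?G. ?F \<sigma>)"
    by (rule sum.mono_neutral_right[OF fin]) (use F0 in auto)
  show ?thesis
  proof (cases "2 * m \<le> k")
    case False
    then have "?G = {}" using delta_rows_tail_points(3)[OF _ mk] by blast
    then have "(\<Sum>\<sigma>\<in>?G. ?F \<sigma>) = 0" by (simp only: sum.empty)
    then show ?thesis unfolding restrict using False by simp
  next
    case m: True
    define Z where "Z = 2 ^ (k - 2 * m) * 2 ^ m * (2 ^ (k - m) * fact (k - m)) * pfaffian_integral (kernel_A A) x0 (k - m)"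
    \<comment> \<open>Composition with the involution \<open>std_swap\<close> turns the permutations
      in standard position into those that fix the tail.\<close>
    have Z: "(\<Sum>\<sigma>\<in>?Q. if std_position k m \<sigma> then ?F \<sigma> else 0) = Z"
    proof -
      let ?s = "std_swap k m"
      have invol: "?s \<circ> (?s \<circ> \<sigma>) = \<sigma>" for \<sigma> :: "nat \<Rightarrow> nat"
        using std_swap_involution[OF m] by (intro ext) simp
      have "(\<Sum>\<sigma>\<in>?Q. if std_position k m \<sigma> then ?F \<sigma> else 0)
          = (\<Sum>\<sigma>\<in>?Q. if std_position k m (?s \<circ> \<sigma>) then ?F (?s \<circ> \<sigma>) else 0)"
        by (rule sum_permutes_compose_left[OF std_swap_permutes[OF m], symmetric])
      also have "\<dots> = (\<Sum>\<sigma>\<in>?Q. if \<sigma> permutes {..<2*(k-m)} then ?F (?s \<circ> \<sigma>) else 0)"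
      proof (rule sum.cong[OF refl])
        fix \<sigma> assume "\<sigma> \<in> ?Q"
        then have "(?s \<circ> \<sigma>) permutes {..<2*k}" by (intro permutes_compose std_swap_permutes m) auto
        then have "std_position k m (?s \<circ> \<sigma>) \<longleftrightarrow> \<sigma> permutes {..<2*(k-m)}"
          using std_position_iff[OF m, of "?s \<circ> \<sigma>"] unfolding invol by blast
        then show "(if std_position k m (?s \<circ> \<sigma>) then ?F (?s \<circ> \<sigma>) else 0)
            = (if \<sigma> permutes {..<2*(k-m)} then ?F (?s \<circ> \<sigma>) else 0)" by (simp only:)
      qed
      also have "\<dots> = (\<Sum>\<sigma>\<in>{\<sigma> \<in> ?Q. \<sigma> permutes {..<2*(k-m)}}. ?F (?s \<circ> \<sigma>))"
        by (rule sum.inter_filter[OF fin, symmetric])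
      also have "{\<sigma> \<in> ?Q. \<sigma> permutes {..<2*(k-m)}} = {\<sigma>. \<sigma> permutes {..<2*(k-m)}}"
      proof -
        have "\<sigma> permutes {..<2*k}" if "\<sigma> permutes {..<2*(k-m)}" for \<sigma>
          by (rule permutes_subset[OF that]) auto
        then show ?thesis by blast
      qed
      finally show ?thesis
        unfolding Z_def sum_term_integral_std[OF m] .
    qed
    have fiber: "(\<Sum>\<sigma>\<in>{\<sigma>\<in>?G. ?pts \<sigma> = \<phi>}. ?F \<sigma>) = Z" if \<phi>: "\<phi> \<in> ?\<Phi>" for \<phi>
    proof -
      have \<phi>': "inj_on \<phi> ?J" "\<phi> ` ?J \<subseteq> {..<k}" using \<phi> by auto
      obtain \<pi> where \<pi>: "\<pi> permutes {..<k}" "\<And>a. a \<in> ?J \<Longrightarrow> \<pi> (std_pair m a) = \<phi> a"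
        using exists_points_perm[OF m \<phi>'] by blast
      have pts: "?pts \<sigma> = \<phi> \<longleftrightarrow> (\<forall>a\<in>?J. \<sigma> a div 2 = \<phi> a)" for \<sigma>
      proof
        assume eq: "?pts \<sigma> = \<phi>"
        show "\<forall>a\<in>?J. \<sigma> a div 2 = \<phi> a"
        proof
          fix a assume "a \<in> ?J"
          then show "\<sigma> a div 2 = \<phi> a" using fun_cong[OF eq, of a] by (simp only: restrict_apply')
        qed
      next
        assume "\<forall>a\<in>?J. \<sigma> a div 2 = \<phi> a"
        then show "?pts \<sigma> = \<phi>" using \<phi> by (intro extensionalityI[of _ ?J]) (auto simp: PiE_iff)
      qed
      have set_eq: "{\<sigma>\<in>?G. ?pts \<sigma> = \<phi>} = {\<sigma>\<in>?Q. delta_rows \<sigma> ?S \<and> (\<forall>a\<in>?J. \<sigma> a div 2 = \<phi> a)}"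
        unfolding pts by blast
      have "(\<Sum>\<sigma>\<in>{\<sigma>\<in>?G. ?pts \<sigma> = \<phi>}. ?F \<sigma>) =
          (\<Sum>\<sigma>\<in>?Q. if delta_rows \<sigma> ?S \<and> (\<forall>a\<in>?J. \<sigma> a div 2 = \<phi> a) then ?F \<sigma> else 0)"
        unfolding set_eq by (rule sum.inter_filter[OF fin])
      also have "\<dots> = (\<Sum>\<sigma>\<in>?Q. if delta_rows (block_perm \<pi> \<circ> \<sigma>) ?S \<and> (\<forall>a\<in>?J. (block_perm \<pi> \<circ> \<sigma>) a div 2 = \<phi> a)
          then ?F (block_perm \<pi> \<circ> \<sigma>) else 0)"
        by (rule sum_permutes_compose_left[OF block_perm_permutes[OF \<pi>(1)], symmetric])
      also have "\<dots> = (\<Sum>\<sigma>\<in>?Q. if std_position k m \<sigma> then ?F \<sigma> else 0)"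
      proof (rule sum.cong[OF refl])
        fix \<sigma> assume "\<sigma> \<in> ?Q"
        then have \<sigma>: "\<sigma> permutes {..<2*k}" by blast
        have "id ` ?S \<subseteq> {..<k}" by auto
        note term_permuted(2,3)[OF \<sigma> this \<pi>(1) permutes_id, unfolded permutation_block_simps image_id id_apply]
        then have F: "?F (block_perm \<pi> \<circ> \<sigma>) = ?F \<sigma>" by (simp only:)
        have iff: "delta_rows (block_perm \<pi> \<circ> \<sigma>) ?S \<and> (\<forall>a\<in>?J. (block_perm \<pi> \<circ> \<sigma>) a div 2 = \<phi> a)
            \<longleftrightarrow> std_position k m \<sigma>"
          using \<pi> by (rule std_position_points)
        show "(if delta_rows (block_perm \<pi> \<circ> \<sigma>) ?S \<and> (\<forall>a\<in>?J. (block_perm \<pi> \<circ> \<sigma>) a div 2 = \<phi> a)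
          then ?F (block_perm \<pi> \<circ> \<sigma>) else 0) = (if std_position k m \<sigma> then ?F \<sigma> else 0)"
          by (simp only: iff F)
      qed
      finally show ?thesis unfolding Z .
    qed
    have "(\<Sum>\<sigma>\<in>?G. ?F \<sigma>) = (\<Sum>\<phi>\<in>?\<Phi>. \<Sum>\<sigma>\<in>{\<sigma>\<in>?G. ?pts \<sigma> = \<phi>}. ?F \<sigma>)"
    proof (rule sum.group[symmetric])
      show "finite ?G" by (rule finite_subset[OF _ fin]) blast
      show "finite ?\<Phi>" by (rule finite_subset[of _ "?J \<rightarrow>\<^sub>E {..<k}"]) (auto intro: finite_PiE)
      show "?pts ` ?G \<subseteq> ?\<Phi>"
      proof
        fix \<phi> assume "\<phi> \<in> ?pts ` ?G"
        then obtain \<sigma> where \<sigma>: "\<sigma> permutes {..<2*k}" "delta_rows \<sigma> ?S" "\<phi> = ?pts \<sigma>" by blast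
        note p = delta_rows_tail_points[OF \<sigma>(1) mk \<sigma>(2)]
        have "inj_on \<phi> ?J" unfolding \<sigma>(3) inj_on_restrict_eq by (rule p(1))
        moreover have "\<phi> \<in> ?J \<rightarrow>\<^sub>E {..<k}" unfolding \<sigma>(3) restrict_PiE_iff using p(2) by blast
        ultimately show "\<phi> \<in> ?\<Phi>" by blast
      qed
    qed
    also have "\<dots> = (\<Sum>\<phi>\<in>?\<Phi>. Z)"
      using fiber by (rule sum.cong[OF refl])
    also have "\<dots> = real (card ?\<Phi>) * Z" by simp
    also have "real (card ?\<Phi>) = fact k / fact (k - 2 * m)"
    proof -
      have "card {..<k} ^ (card ?J - card ?J) * (\<Prod>i\<in>{0..<card ?J}. card {..<k} - i) = (\<Prod>i\<in>{0..<2*m}. k - i)"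
        using mk by (simp add: algebra_simps)
      then have "card ?\<Phi> = (\<Prod>i\<in>{0..<2*m}. k - i)"
        using card_inj_on_subset_funcset[of ?J "{..<k}" ?J] by simp
      then have "card ?\<Phi> * fact (k - 2 * m) = fact k"
        using prod_falling_fact[OF m] by simp
      then have "real (card ?\<Phi> * fact (k - 2 * m)) = real (fact k)"
        by (rule arg_cong)
      then have "real (card ?\<Phi>) * fact (k - 2 * m) = fact k"
        by (simp only: of_nat_mult of_nat_fact)
      then show ?thesis by (subst nonzero_eq_divide_eq) simp_all
    qed
    finally show ?thesis unfolding restrict if_P[OF m] Z_def .
  qed
qed

text \<open>Sets S of equal size contribute equally, by renaming the factors; hence a binomial
  coefficient (k choose m), whose (k - m)! cancels, while 2 ^ m * 2 ^ (k - m) cancels the 2 ^ k of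
  the normalisation. The remaining k! / (m! (k - 2m)!) counts the choices of m disjoint unordered
  pairs, each with a factor 2.\<close>

lemma dist_pfaffian_integral_expansion:
  "dist_pfaffian_integral (kernel_B A) x0 k = (\<Sum>m\<le>k. if 2 * m \<le> k then
     fact k / (fact m * fact (k - 2 * m)) * 2 ^ (k - 2 * m) * pfaffian_integral (kernel_A A) x0 (k - m) else 0)"
proof -
  let ?Q = "{\<sigma>. \<sigma> permutes {..<2*k}}"
  let ?F = "\<lambda>S \<sigma>. of_int (sign \<sigma>) * term_integral k \<sigma> S"
  let ?c = "\<lambda>m. if 2 * m \<le> k then fact k / fact (k - 2 * m) *
       (2 ^ (k - 2 * m) * 2 ^ m * (2 ^ (k - m) * fact (k - m)) * pfaffian_integral (kernel_A A) x0 (k - m)) else 0"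
  have S: "(\<Sum>\<sigma>\<in>?Q. ?F S \<sigma>) = ?c (card S)" if SS: "S \<subseteq> {..<k}" for S
  proof -
    obtain \<tau> where \<tau>: "\<tau> permutes {..<k}" "\<tau> ` {k - card S..<k} = S"
      using exists_tail_perm[OF SS] by blast
    have card: "card S \<le> k" using card_mono[OF _ SS] by simp
    have sub: "\<tau> ` {k - card S..<k} \<subseteq> {..<k}" using \<tau>(2) SS by simp
    have "(\<Sum>\<sigma>\<in>?Q. ?F S \<sigma>) = (\<Sum>\<sigma>\<in>?Q. ?F {k - card S..<k} (\<sigma> \<circ> block_perm \<tau>))"
    proof (rule sum.cong[OF refl])
      fix \<sigma> assume "\<sigma> \<in> ?Q"
      then have \<sigma>: "\<sigma> permutes {..<2*k}" by blast
      note term_permuted(2,3)[OF \<sigma> sub permutes_id \<tau>(1), unfolded permutation_block_simps \<tau>(2)]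
      then show "?F S \<sigma> = ?F {k - card S..<k} (\<sigma> \<circ> block_perm \<tau>)" by (simp only:)
    qed
    also have "\<dots> = (\<Sum>\<sigma>\<in>?Q. ?F {k - card S..<k} \<sigma>)"
      by (rule sum_permutes_compose_right[OF block_perm_permutes[OF \<tau>(1)]])
    also have "\<dots> = ?c (card S)" by (rule sum_term_integral_tail[OF card])
    finally show ?thesis .
  qed
  have "(\<Sum>\<sigma>\<in>?Q. of_int (sign \<sigma>) * (\<Sum>S\<in>Pow {..<k}. term_integral k \<sigma> S)) = (\<Sum>S\<in>Pow {..<k}. \<Sum>\<sigma>\<in>?Q. ?F S \<sigma>)"
    unfolding sum_distrib_left by (rule sum.swap)
  also have "\<dots> = (\<Sum>S\<in>Pow {..<k}. ?c (card S))"
    by (rule sum.cong[OF refl], rule S) simp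
  also have "\<dots> = (\<Sum>m\<le>k. \<Sum>S\<in>{S \<in> Pow {..<k}. card S = m}. ?c (card S))"
  proof (rule sum.group[symmetric])
    show "card ` Pow {..<k} \<subseteq> {..k}" using card_mono[of "{..<k}"] by fastforce
  qed auto
  also have "\<dots> = (\<Sum>m\<le>k. real (k choose m) * ?c m)"
  proof (rule sum.cong[OF refl])
    fix m
    have "card {S \<in> Pow {..<k}. card S = m} = k choose m"
      using n_subsets[of "{..<k}" m] by (simp add: Pow_def)
    moreover have "(\<Sum>S\<in>{S \<in> Pow {..<k}. card S = m}. ?c (card S)) = (\<Sum>S\<in>{S \<in> Pow {..<k}. card S = m}. ?c m)"
      by (rule sum.cong) (simp_all only: mem_Collect_eq)
    ultimately show "(\<Sum>S\<in>{S \<in> Pow {..<k}. card S = m}. ?c (card S)) = real (k choose m) * ?c m"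
      by (simp only: sum_constant)
  qed
  finally have total: "dist_pfaffian_integral (kernel_B A) x0 k = (\<Sum>m\<le>k. real (k choose m) * ?c m) / (2 ^ k * fact k)"
    unfolding dist_pfaffian_integral_def by (simp only:)
  show ?thesis
    unfolding total sum_divide_distrib
  proof (rule sum.cong[OF refl])
    fix m assume "m \<in> {..k}"
    then have mk: "m \<le> k" by simp
    have pow: "(2::real) ^ k = 2 ^ m * 2 ^ (k - m)" using mk by (simp flip: power_add)
    have cancel: "F / (f1 * f2) * (F / f3 * (p1 * q1 * (q2 * f2) * a)) / (q1 * q2 * F) = F / (f1 * f3) * p1 * a"
      if "F \<noteq> 0" "f1 \<noteq> 0" "f2 \<noteq> 0" "f3 \<noteq> 0" "q1 \<noteq> 0" "q2 \<noteq> 0" for F f1 f2 f3 p1 q1 q2 a :: real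
      using that by (simp add: field_simps)
    show "real (k choose m) * ?c m / (2 ^ k * fact k) = (if 2 * m \<le> k then
     fact k / (fact m * fact (k - 2 * m)) * 2 ^ (k - 2 * m) * pfaffian_integral (kernel_A A) x0 (k - m) else 0)"
    proof (cases "2 * m \<le> k")
      case True
      then show ?thesis
        unfolding pow binomial_fact[OF mk] by (simp only: if_True) (rule cancel, simp_all)
    qed simp
  qed
qed

end


subsection \<open>Resummation\<close>

text \<open>As n^n / n! is a single term of the series of exp n, it is at most e^n, and the summand
  is at most (D e / sqrt n)^n.\<close>

lemma sqrt_power_over_fact_summable:
  fixes D :: real
  assumes "D \<ge> 0"
  shows "summable (\<lambda>n. (sqrt (real n) * D) ^ n / fact n)"
proof -
  \<comment> \<open>From this threshold on sqrt n \<ge> 2 D e, which makes the geometric series of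
    ratio 1/2 a majorant.\<close>
  obtain N :: nat where N: "real N \<ge> (2 * D * exp 1)\<^sup>2" "N \<ge> 1"
    using real_arch_simple[of "max 1 ((2 * D * exp 1)\<^sup>2)"] by auto
  have "norm ((sqrt (real n) * D) ^ n / fact n) \<le> (1/2) ^ n" if n: "n \<ge> N" for n
  proof -
    have n0: "real n > 0" using n N by simp
    have bound: "real n ^ n / fact n \<le> exp (real n)"
    proof -
      have s: "(\<lambda>i. real n ^ i /\<^sub>R fact i) sums exp (real n)" by (rule exp_converges)
      have "(\<Sum>i\<in>{n}. real n ^ i /\<^sub>R fact i) \<le> (\<Sum>i. real n ^ i /\<^sub>R fact i)"
        by (rule sum_le_suminf[OF sums_summable[OF s]]) simp_all
      then show ?thesis unfolding sums_unique[OF s, symmetric] by (simp add: divide_inverse mult.commute)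
    qed
    have "2 * D * exp 1 \<le> sqrt (real n)"
    proof (rule real_le_rsqrt)
      show "(2 * D * exp 1)\<^sup>2 \<le> real n" using N(1) n by linarith
    qed
    then have "sqrt (real n) * (2 * D * exp 1) \<le> sqrt (real n) * sqrt (real n)"
      by (intro mult_left_mono) auto
    moreover have "sqrt (real n) * (2 * D * exp 1) = 2 * (sqrt (real n) * D * exp 1)"
      by (simp only: mult_ac)
    moreover have "sqrt (real n) * sqrt (real n) = real n" by simp
    ultimately have "sqrt (real n) * D * exp 1 \<le> 1/2 * real n"
      by linarith
    then have le: "sqrt (real n) * D * exp 1 / real n \<le> 1/2"
      using n0 by (subst pos_divide_le_eq) simp_all
    have "(sqrt (real n) * D) ^ n / fact n = (sqrt (real n) * D / real n) ^ n * (real n ^ n / fact n)"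
      using n0 by (simp add: power_divide)
    also have "\<dots> \<le> (sqrt (real n) * D / real n) ^ n * exp (real n)"
      using assms by (intro mult_left_mono bound) auto
    also have "\<dots> = (sqrt (real n) * D * exp 1 / real n) ^ n"
    proof -
      have "exp (real n) = exp 1 ^ n" using exp_of_nat_mult[of n "1::real"] by (simp only: mult_1_right)
      then have "(sqrt (real n) * D / real n) ^ n * exp (real n) = (sqrt (real n) * D / real n * exp 1) ^ n"
        by (simp only: power_mult_distrib)
      then show ?thesis by (simp only: times_divide_eq_left)
    qed
    also have "\<dots> \<le> (1/2) ^ n"
      using assms by (intro power_mono le) auto
    finally show ?thesis using assms by simp
  qed
  moreover have "summable (\<lambda>n. (1/2 :: real) ^ n)"
    by (rule summable_geometric) simp
  ultimately show ?thesis
    by (rule summable_comparison_test'[rotated])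
qed

text \<open>Both series sum \<open>(j choose m) (-1)\<^sup>m 2\<^bsup>j-m\<^esup> a\<^sub>j\<close> over all \<open>m \<le> j\<close>, the first one along the diagonals
  \<open>j + m = k\<close>; the absolute values of a row sum to \<open>3\<^sup>j \<bar>a\<^sub>j\<bar>\<close>.\<close>

lemma diagonal_resummation:
  fixes a :: "nat \<Rightarrow> real"
  assumes sum: "summable (\<lambda>j. \<bar>a j\<bar> * 3 ^ j)"
  defines "b \<equiv> \<lambda>k. \<Sum>m\<le>k. real ((k - m) choose m) * (-1) ^ m * 2 ^ (k - 2 * m) * a (k - m)"
  shows "summable b" "summable a" "suminf b = suminf a"
proof -
  define f where "f = (\<lambda>(j, m). real (j choose m) * (-1) ^ m * 2 ^ (j - m) * a j)"
  have f_eq: "f (j, m) = real (j choose m) * (-1) ^ m * 2 ^ (j - m) * a j" for j m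
    by (simp add: f_def)
  \<comment> \<open>The two binomial sums are (2 - 1) ^ j and (2 + 1) ^ j: the first makes row j sum
    to \<open>a j\<close>, the second produces the weight 3 ^ j of the hypothesis.\<close>
  have binom: "(\<Sum>m\<le>j. real (j choose m) * (-1) ^ m * 2 ^ (j - m)) = 1" for j
    using binomial_ring[of "-1::real" 2 j] by simp
  have binom3: "(\<Sum>m\<le>j. real (j choose m) * 2 ^ (j - m)) = 3 ^ j" for j
    using binomial_ring[of "1::real" 2 j] by simp
  let ?T = "SIGMA j:UNIV. {..j}"
  have abs_row: "(\<Sum>m\<le>j. \<bar>f (j, m)\<bar>) = \<bar>a j\<bar> * 3 ^ j" for j
  proof -
    have "(\<Sum>m\<le>j. \<bar>f (j, m)\<bar>) = (\<Sum>m\<le>j. real (j choose m) * 2 ^ (j - m)) * \<bar>a j\<bar>"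
      unfolding sum_distrib_right f_eq by (intro sum.cong refl) (simp add: abs_mult power_abs)
    then show ?thesis by (simp add: binom3)
  qed
  have abs: "(\<lambda>p. norm (f p)) summable_on ?T"
  proof (subst Infinite_Sum.abs_summable_on_Sigma_iff, intro conjI ballI)
    show "(\<lambda>m. norm (f (j, m))) summable_on {..j}" for j by simp
    have "(\<lambda>j. norm (\<bar>a j\<bar> * 3 ^ j)) summable_on UNIV"
      using sum by (intro norm_summable_imp_summable_on) simp
    then show "(\<lambda>j. norm (infsum (\<lambda>m. norm (f (j, m))) {..j})) summable_on UNIV"
      using abs_row by simp
  qed
  have total: "(f has_sum infsum f ?T) ?T"
    by (rule has_sum_infsum) (rule Infinite_Sum.abs_summable_summable[OF abs])
  have row: "(\<Sum>m\<le>j. f (j, m)) = a j" for j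
    using arg_cong[OF binom[of j], of "\<lambda>t. t * a j"] by (simp add: f_eq sum_distrib_right)
  have S1: "(a has_sum infsum f ?T) UNIV"
    using total
  proof (rule has_sum_SigmaD)
    show "((\<lambda>m. f (j, m)) has_sum a j) {..j}" for j
      using has_sum_finite[of "{..j}" "\<lambda>m. f (j, m)"] row by simp
  qed
  \<comment> \<open>The diagonal j + m = k meets the triangle m \<le> j exactly for 2m \<le> k; the
    other m in the definition of \<open>b\<close> contribute 0, as their binomial coefficient
    vanishes.\<close>
  let ?U = "SIGMA k:(UNIV::nat set). {m::nat. 2 * m \<le> k}"
  have bij: "bij_betw (\<lambda>(k, m). (k - m, m)) ?U ?T"
    by (rule bij_betw_byWitness[where f' = "\<lambda>(j, m). (j + m, m)"]) auto
  have S2: "(b has_sum infsum f ?T) UNIV"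
  proof -
    have "((\<lambda>p. f (case p of (k, m) \<Rightarrow> (k - m, m))) has_sum infsum f ?T) ?U"
      using has_sum_reindex_bij_betw[OF bij, of f] total by blast
    then show ?thesis
    proof (rule has_sum_SigmaD)
      show "((\<lambda>m. f (case (k, m) of (k, m) \<Rightarrow> (k - m, m))) has_sum b k) {m. 2 * m \<le> k}" for k
      proof -
        have fin: "finite {m. 2 * m \<le> k}" by (rule finite_subset[of _ "{..k}"]) auto
        have "b k = (\<Sum>m\<in>{m. 2 * m \<le> k}. f (k - m, m))"
          unfolding b_def
        proof (rule sum.mono_neutral_cong_right)
          show "\<forall>m\<in>{..k} - {m. 2 * m \<le> k}. real ((k - m) choose m) * (-1) ^ m * 2 ^ (k - 2 * m) * a (k - m) = 0"
            by auto
          fix m assume "m \<in> {m. 2 * m \<le> k}"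
          have "k - m - m = k - 2 * m" by simp
          then show "real ((k - m) choose m) * (-1) ^ m * 2 ^ (k - 2 * m) * a (k - m) = f (k - m, m)"
            unfolding f_eq by (simp only:)
        qed auto
        then show ?thesis using has_sum_finite[OF fin, of "\<lambda>m. f (k - m, m)"] by simp
      qed
    qed
  qed
  have sums: "a sums infsum f ?T" "b sums infsum f ?T"
    using S1 S2 has_sum_imp_sums by blast+
  then show "summable b" "summable a" "suminf b = suminf a"
    by (auto simp: sums_iff)
qed

section \<open>Comparison of the two Fredholm series\<close>

context decaying_kernel begin

definition fredholm_term :: "nat \<Rightarrow> real" where
  "fredholm_term k = (-1) ^ k / fact k * pfaffian_integral (kernel_A A) x0 k"

definition dist_fredholm_term :: "nat \<Rightarrow> real" where
  "dist_fredholm_term k = (-1) ^ k / fact k * dist_pfaffian_integral (kernel_B A) x0 k"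

text \<open>Since m + (k - 2m) = k - m, the factor 1 / (m! (k - 2m)!) equals (k - m choose m) / (k -
  m)!. For 2m > k this binomial coefficient is 0, which replaces the case distinction.\<close>

lemma dist_fredholm_term_expansion:
  "dist_fredholm_term k = (\<Sum>m\<le>k. real ((k - m) choose m) * (-1) ^ m * 2 ^ (k - 2 * m) * fredholm_term (k - m))"
  unfolding dist_fredholm_term_def dist_pfaffian_integral_expansion sum_distrib_left
proof (rule sum.cong[OF refl])
  fix m assume "m \<in> {..k}"
  then have mk: "m \<le> k" by simp
  let ?a = "pfaffian_integral (kernel_A A) x0 (k - m)"
  show "(-1) ^ k / fact k * (if 2 * m \<le> k then fact k / (fact m * fact (k - 2 * m)) * 2 ^ (k - 2 * m) * ?a else 0)
      = real ((k - m) choose m) * (-1) ^ m * 2 ^ (k - 2 * m) * fredholm_term (k - m)"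
  proof (cases "2 * m \<le> k")
    case True
    then have m: "m \<le> k - m" and km: "k - m - m = k - 2 * m" by simp_all
    have pow: "(-1::real) ^ k = (-1) ^ m * (-1) ^ (k - m)" using mk by (simp flip: power_add)
    have "s * t / F * (F / (f1 * f3) * p * a) = f2 / (f1 * f3) * s * p * (t / f2 * a)"
      if "F \<noteq> 0" "f2 \<noteq> 0" for F f1 f2 f3 p s t a :: real
      using that by (simp add: field_simps)
    then show ?thesis
      unfolding fredholm_term_def pow binomial_fact[OF m] km using True by simp
  next
    case False
    then have "(k - m) choose m = 0" by (simp add: binomial_eq_0)
    then show ?thesis using False by simp
  qed
qed

lemma fredholm_term_summable: "summable (\<lambda>k. \<bar>fredholm_term k\<bar> * 3 ^ k)"
proof (rule summable_comparison_test)
  \<comment> \<open>Hadamard's bound is (sqrt (2 k) * C * tail_mass) ^ k; \<open>D\<close> collects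
    all but sqrt k, together with the 3 of the weight.\<close>
  define D where "D = 3 * (sqrt 2 * C * tail_mass)"
  have D: "D \<ge> 0" using C_pos tail_mass_nonneg by (simp add: D_def)
  show "summable (\<lambda>k. (sqrt (real k) * D) ^ k / fact k)"
    by (rule sqrt_power_over_fact_summable[OF D])
  show "\<exists>N. \<forall>k\<ge>N. norm (\<bar>fredholm_term k\<bar> * 3 ^ k) \<le> (sqrt (real k) * D) ^ k / fact k"
  proof (intro exI[of _ 0] allI impI)
    fix k :: nat
    have "sqrt (2 * real k * C\<^sup>2) = sqrt 2 * sqrt (real k) * C"
      using C_pos by (simp add: real_sqrt_mult)
    then have "\<bar>pfaffian_integral (kernel_A A) x0 k\<bar> \<le> (sqrt 2 * sqrt (real k) * C * tail_mass) ^ k"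
      using pfaffian_integral_bound[of k] by (simp only: power_mult_distrib)
    then have "\<bar>pfaffian_integral (kernel_A A) x0 k\<bar> / fact k * 3 ^ k \<le> (sqrt 2 * sqrt (real k) * C * tail_mass) ^ k / fact k * 3 ^ k"
      by (intro mult_right_mono divide_right_mono) auto
    also have "\<dots> = (sqrt (real k) * D) ^ k / fact k"
      by (simp add: D_def power_mult_distrib)
    finally show "norm (\<bar>fredholm_term k\<bar> * 3 ^ k) \<le> (sqrt (real k) * D) ^ k / fact k"
      by (simp add: fredholm_term_def abs_mult power_abs)
  qed
qed

text \<open>The Fredholm Pfaffians consist of an explicit 1 and a series from k = 1, whereas the
  resummation includes k = 0; the zeroth terms must agree before they are split off.\<close>

lemma initial_terms: "fredholm_term 0 = dist_fredholm_term 0"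
  using dist_fredholm_term_expansion[of 0] by simp

theorem fredholm_pfaffians_agree:
  "fredholm_pfaffian_converges (kernel_A A) x0"
  "dist_fredholm_pfaffian_converges (kernel_B A) x0"
  "fredholm_pfaffian (kernel_A A) x0 = dist_fredholm_pfaffian (kernel_B A) x0"
proof -
  note resum = diagonal_resummation[OF fredholm_term_summable]
  have b: "dist_fredholm_term = (\<lambda>k. \<Sum>m\<le>k. real ((k - m) choose m) * (-1) ^ m * 2 ^ (k - 2 * m) * fredholm_term (k - m))"
    by (rule ext) (rule dist_fredholm_term_expansion)
  have sum: "summable fredholm_term" "summable dist_fredholm_term" "suminf dist_fredholm_term = suminf fredholm_term"
    unfolding b by (rule resum)+
  have Suc: "(\<lambda>n. (-1) ^ Suc n / fact (Suc n) * pfaffian_integral (kernel_A A) x0 (Suc n)) = (\<lambda>n. fredholm_term (Suc n))"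
    "(\<lambda>n. (-1) ^ Suc n / fact (Suc n) * dist_pfaffian_integral (kernel_B A) x0 (Suc n)) = (\<lambda>n. dist_fredholm_term (Suc n))"
    unfolding fredholm_term_def dist_fredholm_term_def by (rule refl)+
  have sumS: "summable (\<lambda>n. fredholm_term (Suc n))" "summable (\<lambda>n. dist_fredholm_term (Suc n))"
    using sum(1,2) by (simp_all add: summable_Suc_iff)
  show "fredholm_pfaffian_converges (kernel_A A) x0"
    unfolding fredholm_pfaffian_converges_def Suc using sumS(1) pfaffian_set_integrable by blast
  show "dist_fredholm_pfaffian_converges (kernel_B A) x0"
    unfolding dist_fredholm_pfaffian_converges_def Suc using sumS(2) term_integrable by blast
  show "fredholm_pfaffian (kernel_A A) x0 = dist_fredholm_pfaffian (kernel_B A) x0"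
    unfolding fredholm_pfaffian_def dist_fredholm_pfaffian_def Suc
    using suminf_split_head[OF sum(1)] suminf_split_head[OF sum(2)] sum(3) initial_terms by simp
qed

end


subsection \<open>Exponential integrals\<close>

text \<open>Integrals of g(w) exp (- x a(w) - y b(w)) as functions of (x, y). Keeping the amplitude
  g variable closes the family under differentiation: a derivative in direction v replaces g by
  \<open>- phase v w * g w\<close>.\<close>

locale exponential_family =
  fixes M :: "'w measure" and a b :: "'w \<Rightarrow> complex"
  assumes a_meas [measurable]: "a \<in> borel_measurable M" and b_meas [measurable]: "b \<in> borel_measurable M"
begin

definition weight :: "'w \<Rightarrow> real" where
  "weight w = norm (a w) + norm (b w)"

text \<open>All exponential moments are demanded so that every (x, y) is allowed and the class
  survives multiplication by \<open>phase\<close>, hence differentiation, arbitrarily often.\<close>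

definition admissible :: "('w \<Rightarrow> complex) \<Rightarrow> bool" where
  "admissible g \<longleftrightarrow> g \<in> borel_measurable M \<and> (\<forall>c\<ge>0. integrable M (\<lambda>w. norm (g w) * exp (c * weight w)))"

definition phase :: "real \<times> real \<Rightarrow> 'w \<Rightarrow> complex" where
  "phase p w = of_real (fst p) * a w + of_real (snd p) * b w"

definition transform :: "('w \<Rightarrow> complex) \<Rightarrow> real \<times> real \<Rightarrow> real" where
  "transform g p = Re (LINT w|M. g w * exp (- phase p w))"

lemma weight_nonneg: "weight w \<ge> 0"
  by (simp add: weight_def)

lemma weight_measurable [measurable]: "weight \<in> borel_measurable M"
  unfolding weight_def[abs_def] by measurable

lemma phase_measurable [measurable]: "phase p \<in> borel_measurable M"
  unfolding phase_def[abs_def] by measurable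

lemma norm_phase: "norm (phase p w) \<le> norm p * weight w"
proof -
  have fs: "\<bar>fst p\<bar> \<le> norm p" "\<bar>snd p\<bar> \<le> norm p"
    using norm_fst_le[of "fst p" "snd p"] norm_snd_le[of "snd p" "fst p"] by simp_all
  have "norm (phase p w) \<le> norm (of_real (fst p) * a w) + norm (of_real (snd p) * b w)"
    unfolding phase_def by (rule norm_triangle_ineq)
  also have "\<dots> = \<bar>fst p\<bar> * norm (a w) + \<bar>snd p\<bar> * norm (b w)"
    by (simp add: norm_mult)
  also have "\<dots> \<le> norm p * norm (a w) + norm p * norm (b w)"
    by (rule add_mono[OF mult_right_mono[OF fs(1)] mult_right_mono[OF fs(2)]]) simp_all
  finally show ?thesis by (simp add: weight_def distrib_left)
qed

lemma phase_add: "phase (p + q) w = phase p w + phase q w"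
  by (simp add: phase_def distrib_right)

lemma norm_exp_phase: "norm (exp (- phase p w)) \<le> exp (norm p * weight w)"
proof -
  have "Re (- phase p w) \<le> norm (phase p w)"
    using abs_Re_le_cmod[of "phase p w"] by simp
  then show ?thesis
    using norm_phase[of p w] unfolding norm_exp_eq_Re exp_le_cancel_iff by linarith
qed

lemma admissible_measurable: "admissible g \<Longrightarrow> g \<in> borel_measurable M"
  by (simp add: admissible_def)

lemma admissible_integrable: "admissible g \<Longrightarrow> c \<ge> 0 \<Longrightarrow> integrable M (\<lambda>w. norm (g w) * exp (c * weight w))"
  by (simp add: admissible_def)

lemma transform_integrable:
  assumes g: "admissible g"
  shows "integrable M (\<lambda>w. g w * exp (- phase p w))"
proof (rule Bochner_Integration.integrable_bound[OF admissible_integrable[OF g norm_ge_zero[of p]]])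
  show "(\<lambda>w. g w * exp (- phase p w)) \<in> borel_measurable M"
    using admissible_measurable[OF g] by measurable
  show "AE w in M. norm (g w * exp (- phase p w)) \<le> norm (norm (g w) * exp (norm p * weight w))"
    using norm_exp_phase[of p] by (intro AE_I2) (simp add: norm_mult mult_left_mono)
qed

text \<open>One factor of the weight is absorbed through t \<le> exp t, at the price of c + 1 in
  place of c.\<close>

lemma admissible_times_phase:
  assumes g: "admissible g"
  shows "admissible (\<lambda>w. - phase v w * g w)"
  unfolding admissible_def
proof (intro conjI allI impI)
  note [measurable] = admissible_measurable[OF g]
  show "(\<lambda>w. - phase v w * g w) \<in> borel_measurable M" by measurable
  fix c :: real assume c: "c \<ge> 0"
  have c1: "c + 1 \<ge> 0" using c by simp
  show "integrable M (\<lambda>w. norm (- phase v w * g w) * exp (c * weight w))"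
  proof (rule Bochner_Integration.integrable_bound[OF integrable_mult_right[OF admissible_integrable[OF g c1], of "norm v"]])
    show "(\<lambda>w. norm (- phase v w * g w) * exp (c * weight w)) \<in> borel_measurable M" by measurable
    show "AE w in M. norm (norm (- phase v w * g w) * exp (c * weight w)) \<le> norm (norm v * (norm (g w) * exp ((c + 1) * weight w)))"
    proof (rule AE_I2)
      fix w
      have "weight w \<le> exp (weight w)"
        using exp_ge_add_one_self[of "weight w"] by linarith
      then have "norm v * weight w \<le> norm v * exp (weight w)"
        by (rule mult_left_mono) simp
      then have "norm (phase v w) \<le> norm v * exp (weight w)"
        using norm_phase[of v w] by linarith
      then have "norm (phase v w) * (norm (g w) * exp (c * weight w)) \<le> norm v * exp (weight w) * (norm (g w) * exp (c * weight w))"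
        by (rule mult_right_mono) simp
      also have "\<dots> = norm v * (norm (g w) * exp ((c + 1) * weight w))"
        by (simp add: distrib_right exp_add)
      finally show "norm (norm (- phase v w * g w) * exp (c * weight w)) \<le> norm (norm v * (norm (g w) * exp ((c + 1) * weight w)))"
        by (simp add: norm_mult mult.assoc)
    qed
  qed
qed

text \<open>Taylor's bound |e^z - 1 - z| \<le> e^|Re z| |z|^2 at z = - phase h w. For norm h \<le> 1
  the exponential costs one factor exp (weight w), and the square of the weight costs two more;
  hence the 3.\<close>

lemma transform_remainder:
  assumes g: "admissible g" and h: "norm h \<le> 1"
  shows "\<bar>transform g (p + h) - transform g p - transform (\<lambda>w. - phase h w * g w) p\<bar>
    \<le> (LINT w|M. norm (g w) * exp ((norm p + 3) * weight w)) * (norm h)\<^sup>2"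
proof -
  let ?r = "\<lambda>w. g w * exp (- phase (p + h) w) - g w * exp (- phase p w) - (- phase h w * g w) * exp (- phase p w)"
  note int = transform_integrable[OF g, of "p + h"] transform_integrable[OF g, of p]
    transform_integrable[OF admissible_times_phase[OF g, of h], of p]
  have r_int: "integrable M ?r" by (intro Bochner_Integration.integrable_diff int)
  have p3: "norm p + 3 \<ge> 0" by (simp add: add_nonneg_nonneg)
  note dom = integrable_mult_left[OF admissible_integrable[OF g p3], of "(norm h)\<^sup>2"]
  have "transform g (p + h) - transform g p - transform (\<lambda>w. - phase h w * g w) p = Re (LINT w|M. ?r w)"
    unfolding transform_def by (simp only: Bochner_Integration.integral_diff int Bochner_Integration.integrable_diff minus_complex.sel)
  then have "\<bar>transform g (p + h) - transform g p - transform (\<lambda>w. - phase h w * g w) p\<bar> \<le> norm (LINT w|M. ?r w)"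
    using abs_Re_le_cmod[of "LINT w|M. ?r w"] by simp
  also have "\<dots> \<le> (LINT w|M. norm (?r w))" by (rule integral_norm_bound)
  also have "\<dots> \<le> (LINT w|M. norm (g w) * exp ((norm p + 3) * weight w) * (norm h)\<^sup>2)"
  proof (rule integral_mono[OF integrable_norm[OF r_int] dom])
    fix w
    let ?z = "- phase h w" and ?s = "weight w"
    have z: "norm ?z \<le> norm h * ?s" using norm_phase[of h w] by simp
    have hs: "norm h * ?s \<le> ?s" using h weight_nonneg[of w] by (simp add: mult_left_le_one_le)
    have s: "?s \<le> exp ?s" using exp_ge_add_one_self[of ?s] by linarith
    have s2: "?s\<^sup>2 \<le> exp (2 * ?s)"
      using power_mono[OF s weight_nonneg, of 2] by (simp add: exp_double)
    have Taylor: "norm (exp ?z - (\<Sum>k\<le>1. ?z ^ k / fact k)) \<le> exp \<bar>Re ?z\<bar> * norm ?z ^ Suc 1 / fact 1"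
      by (rule Taylor_exp)
    have lin: "exp ?z - (\<Sum>k\<le>1. ?z ^ k / fact k) = exp ?z - 1 - ?z"
      by simp
    have quad: "exp \<bar>Re ?z\<bar> * norm ?z ^ Suc 1 / fact 1 = exp \<bar>Re ?z\<bar> * (norm ?z)\<^sup>2"
      by (simp add: power2_eq_square)
    have "norm (exp ?z - 1 - ?z) \<le> exp \<bar>Re ?z\<bar> * (norm ?z)\<^sup>2"
      using Taylor unfolding lin quad .
    also have "\<dots> \<le> exp ?s * (norm h * ?s)\<^sup>2"
      using z hs abs_Re_le_cmod[of ?z] by (intro mult_mono power_mono) auto
    also have "\<dots> \<le> exp ?s * ((norm h)\<^sup>2 * exp (2 * ?s))"
      unfolding power_mult_distrib by (intro mult_left_mono s2) auto
    also have "\<dots> = (norm h)\<^sup>2 * exp (3 * ?s)"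
    proof -
      have "exp (3 * ?s) = exp ?s * exp (2 * ?s)" by (simp flip: exp_add)
      then show ?thesis by (simp only: mult.left_commute)
    qed
    finally have e: "norm (exp ?z - 1 - ?z) \<le> (norm h)\<^sup>2 * exp (3 * ?s)" .
    have "?r w = g w * exp (- phase p w) * (exp ?z - 1 - ?z)"
      unfolding phase_add by (simp add: exp_add[symmetric] algebra_simps)
    then have "norm (?r w) = norm (g w) * norm (exp (- phase p w)) * norm (exp ?z - 1 - ?z)"
      by (simp only: norm_mult)
    also have "\<dots> \<le> norm (g w) * exp (norm p * ?s) * ((norm h)\<^sup>2 * exp (3 * ?s))"
      by (intro mult_mono e norm_exp_phase mult_left_mono mult_nonneg_nonneg) auto
    also have "\<dots> = norm (g w) * exp ((norm p + 3) * ?s) * (norm h)\<^sup>2"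
      by (simp add: distrib_right exp_add)
    finally show "norm (?r w) \<le> norm (g w) * exp ((norm p + 3) * ?s) * (norm h)\<^sup>2" .
  qed
  also have "\<dots> = (LINT w|M. norm (g w) * exp ((norm p + 3) * weight w)) * (norm h)\<^sup>2"
    by (rule integral_mult_left_zero)
  finally show ?thesis .
qed

text \<open>Exhibits the candidate for the derivative as a linear function of the direction
  v.\<close>

lemma transform_phase_linear:
  assumes g: "admissible g"
  shows "transform (\<lambda>w. - phase v w * g w) p =
     fst v * transform (\<lambda>w. - a w * g w) p + snd v * transform (\<lambda>w. - b w * g w) p"
proof -
  have ab: "phase (1, 0) = a" "phase (0, 1) = b" by (auto simp: phase_def)
  note int = transform_integrable[OF admissible_times_phase[OF g, of "(1, 0)"], of p, unfolded ab]
    transform_integrable[OF admissible_times_phase[OF g, of "(0, 1)"], of p, unfolded ab]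
  have "(LINT w|M. - phase v w * g w * exp (- phase p w)) =
     (LINT w|M. of_real (fst v) * (- a w * g w * exp (- phase p w)) + of_real (snd v) * (- b w * g w * exp (- phase p w)))"
    by (rule Bochner_Integration.integral_cong) (simp_all add: phase_def[of v] algebra_simps)
  also have "\<dots> = of_real (fst v) * (LINT w|M. - a w * g w * exp (- phase p w)) +
      of_real (snd v) * (LINT w|M. - b w * g w * exp (- phase p w))"
    by (subst Bochner_Integration.integral_add) (simp_all only: integrable_mult_right int integral_mult_right_zero)
  finally show ?thesis unfolding transform_def by simp
qed

lemma transform_has_derivative:
  assumes g: "admissible g"
  shows "(transform g has_derivative (\<lambda>v. transform (\<lambda>w. - phase v w * g w) p)) (at p)"
proof -
  define K where "K = (LINT w|M. norm (g w) * exp ((norm p + 3) * weight w))"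
  let ?D = "\<lambda>v. transform (\<lambda>w. - phase v w * g w) p"
  have lin: "bounded_linear ?D"
    unfolding transform_phase_linear[OF g]
    by (intro bounded_linear_add bounded_linear_mult_left[THEN bounded_linear_compose] bounded_linear_fst bounded_linear_snd)
  have lim: "((\<lambda>h. norm (transform g (p + h) - transform g p - ?D h) / norm h) \<longlongrightarrow> 0) (at 0)"
  proof (rule Lim_null_comparison)
    have "\<forall>\<^sub>F h in at (0 :: real \<times> real). norm h < 1"
      unfolding eventually_at by (intro exI[of _ 1]) (simp add: dist_norm)
    then show "\<forall>\<^sub>F h in at 0. norm (norm (transform g (p + h) - transform g p - ?D h) / norm h) \<le> K * norm h"
    proof (rule eventually_mono)
      fix h :: "real \<times> real" assume "norm h < 1"
      then have le: "\<bar>transform g (p + h) - transform g p - ?D h\<bar> \<le> K * (norm h)\<^sup>2"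
        using transform_remainder[OF g, of h p] by (simp add: K_def)
      show "norm (norm (transform g (p + h) - transform g p - ?D h) / norm h) \<le> K * norm h"
      proof (cases "h = 0")
        case False
        then have "norm h > 0" by simp
        then show ?thesis using le by (simp add: pos_divide_le_eq power2_eq_square mult.assoc)
      qed simp
    qed
    have "((\<lambda>h :: real \<times> real. K * norm h) \<longlongrightarrow> K * norm (0 :: real \<times> real)) (at 0)"
      by (intro tendsto_intros)
    then show "((\<lambda>h :: real \<times> real. K * norm h) \<longlongrightarrow> 0) (at 0)" by simp
  qed
  show ?thesis
    unfolding has_derivative_at using lin lim by blast
qed

lemma frechet_derivative_transform:
  assumes "admissible g"
  shows "frechet_derivative (transform g) (at p) v = transform (\<lambda>w. - phase v w * g w) p"
  by (rule fun_cong[OF frechet_derivative_at[OF transform_has_derivative[OF assms]], symmetric])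

text \<open>The induction is over all amplitudes at once, because each derivative is the transform
  of a new one.\<close>

lemma transform_C_diff: "admissible g \<Longrightarrow> C_diff n (transform g)"
proof (induction n arbitrary: g)
  case 0
  then show ?case
    by (auto intro!: continuous_at_imp_continuous_on has_derivative_continuous transform_has_derivative)
next
  case (Suc n)
  have "transform g differentiable (at p)" for p
    unfolding differentiable_def using transform_has_derivative[OF Suc.prems] by blast
  moreover have "C_diff n (\<lambda>p. frechet_derivative (transform g) (at p) v)" for v
    unfolding frechet_derivative_transform[OF Suc.prems] by (rule Suc.IH[OF admissible_times_phase[OF Suc.prems]])
  ultimately show ?case by simp
qed

lemma transform_smooth: "admissible g \<Longrightarrow> smooth (transform g)"
  by (simp add: smooth_def transform_C_diff)

lemma transform_decay:
  assumes g: "admissible g" and re: "\<And>w. w \<in> space M \<Longrightarrow> Re (a w) \<ge> 1 \<and> Re (b w) \<ge> 1" and xy: "x > x0" "y > x0"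
  shows "\<bar>transform g (x, y)\<bar> \<le> (LINT w|M. norm (g w) * exp (\<bar>x0\<bar> * weight w)) * exp (2 * x0) * exp (- x - y)"
proof -
  let ?I = "\<lambda>w. g w * exp (- phase (x, y) w)"
  have "\<bar>transform g (x, y)\<bar> \<le> norm (LINT w|M. ?I w)"
    unfolding transform_def by (rule abs_Re_le_cmod)
  also have "\<dots> \<le> (LINT w|M. norm (?I w))" by (rule integral_norm_bound)
  also have "\<dots> \<le> (LINT w|M. norm (g w) * exp (\<bar>x0\<bar> * weight w) * (exp (2 * x0) * exp (- x - y)))"
  proof (rule integral_mono[OF integrable_norm[OF transform_integrable[OF g]]])
    show "integrable M (\<lambda>w. norm (g w) * exp (\<bar>x0\<bar> * weight w) * (exp (2 * x0) * exp (- x - y)))"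
      by (intro integrable_mult_left admissible_integrable g) simp
    fix w assume w: "w \<in> space M"
    \<comment> \<open>From (t - x0) (Re c - 1) \<ge> 0. This isolates the decay exp (- t); the
      remaining - x0 Re c does not involve t and is absorbed by the exponential moment with constant
      \<bar>x0\<bar>.\<close>
    have 1: "- (t * Re c) \<le> \<bar>x0\<bar> * norm c + x0 - t" if "t > x0" "Re c \<ge> 1" for t :: real and c :: complex
    proof -
      have "0 \<le> (t - x0) * (Re c - 1)" using that by simp
      moreover have "- (x0 * Re c) \<le> \<bar>x0\<bar> * norm c"
        using abs_Re_le_cmod[of c] by (metis abs_ge_minus_self abs_mult mult_left_mono abs_ge_zero order_trans)
      ultimately show ?thesis by (simp add: algebra_simps)
    qed
    have "Re (- phase (x, y) w) \<le> \<bar>x0\<bar> * weight w + (2 * x0 + (- x - y))"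
      using 1[OF xy(1), of "a w"] 1[OF xy(2), of "b w"] re[OF w] by (simp add: phase_def weight_def algebra_simps)
    then have "norm (exp (- phase (x, y) w)) \<le> exp (\<bar>x0\<bar> * weight w + (2 * x0 + (- x - y)))"
      by (simp only: norm_exp_eq_Re exp_le_cancel_iff)
    then have "norm (exp (- phase (x, y) w)) \<le> exp (\<bar>x0\<bar> * weight w) * (exp (2 * x0) * exp (- x - y))"
      by (simp only: exp_add)
    then have "norm (g w) * norm (exp (- phase (x, y) w)) \<le> norm (g w) * (exp (\<bar>x0\<bar> * weight w) * (exp (2 * x0) * exp (- x - y)))"
      by (rule mult_left_mono) simp
    then show "norm (?I w) \<le> norm (g w) * exp (\<bar>x0\<bar> * weight w) * (exp (2 * x0) * exp (- x - y))"
      by (simp only: norm_mult mult.assoc)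
  qed
  also have "\<dots> = (LINT w|M. norm (g w) * exp (\<bar>x0\<bar> * weight w)) * (exp (2 * x0) * exp (- x - y))"
    by (rule integral_mult_left_zero)
  finally show ?thesis by (simp only: mult.assoc)
qed

end


subsection \<open>The GSE kernel\<close>

lemma integrable_exp_neg_abs: "integrable lborel (\<lambda>t :: real. exp (- \<bar>t\<bar>))"
proof -
  define f where "f t = indicator {-1<..} t * exp (- 1 * t)" for t :: real
  have f: "integrable lborel f"
    unfolding f_def by (rule integrable_exp_half_line) simp
  have "integrable lborel (\<lambda>t. f (0 + (-1) * t))"
    by (rule lborel_integrable_real_affine[OF f]) simp
  then have sum: "integrable lborel (\<lambda>t. f t + f (- t))"
    using f by (intro Bochner_Integration.integrable_add) simp_all
  show ?thesis
  proof (rule Bochner_Integration.integrable_bound[OF sum])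
    have nn: "f t \<ge> 0" for t by (simp add: f_def)
    have "exp (- \<bar>t\<bar>) \<le> f t + f (- t)" for t
    proof (cases "t \<ge> 0")
      case True
      then show ?thesis using nn[of "- t"] by (simp add: f_def)
    next
      case False
      then show ?thesis using nn[of t] by (simp add: f_def)
    qed
    moreover have "norm (f t + f (- t)) = f t + f (- t)" for t
      using nn[of t] nn[of "- t"] by simp
    ultimately show "AE t in lborel. norm (exp (- \<bar>t\<bar>)) \<le> norm (f t + f (- t))"
      by simp
  qed simp
qed

text \<open>Both rays as one path over the real line, traversed upwards, with the lower ray at t < 0
  and the vertex at t = 0.\<close>

definition contour :: "real \<Rightarrow> complex" where
  "contour t = 1 + of_real \<bar>t\<bar> * cis (sgn t * (pi/3))"

text \<open>The derivative of \<open>contour\<close> away from the vertex; the value 0 at t = 0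
  makes pointwise splittings into the two rays hold there too.\<close>

definition contour_direction :: "real \<Rightarrow> complex" where
  "contour_direction t = of_real (sgn t) * cis (sgn t * (pi/3))"

lemma sgn_measurable [measurable]: "(sgn :: real \<Rightarrow> real) \<in> borel_measurable borel"
proof -
  have "(sgn :: real \<Rightarrow> real) = (\<lambda>t. indicator {0<..} t - indicator {..<0} t)"
    by (auto simp: fun_eq_iff sgn_real_def)
  then show ?thesis by simp
qed

lemma cis_measurable [measurable]: "cis \<in> borel_measurable borel"
  by (intro borel_measurable_continuous_onI continuous_intros)

lemma contour_measurable [measurable]: "contour \<in> borel_measurable borel"
  unfolding contour_def[abs_def] by measurable

lemma contour_direction_measurable [measurable]: "contour_direction \<in> borel_measurable borel"
  unfolding contour_direction_def[abs_def] by measurable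

lemma norm_contour_direction: "norm (contour_direction t) \<le> 1"
  by (simp add: contour_direction_def norm_mult sgn_if)

lemma Re_Im_contour: "Re (contour t) = 1 + \<bar>t\<bar> / 2" "(Im (contour t))\<^sup>2 = 3 * t\<^sup>2 / 4"
proof -
  have c: "cos (sgn t * (pi/3)) = 1/2" if "t \<noteq> 0"
    using that by (cases "t > 0") (simp_all add: cos_60)
  show "Re (contour t) = 1 + \<bar>t\<bar> / 2"
    using c by (cases "t = 0") (simp_all add: contour_def)
  have s: "(sin (sgn t * (pi/3)))\<^sup>2 = 3/4" if "t \<noteq> 0"
    using that by (cases "t > 0") (simp_all add: sin_60 power_divide)
  show "(Im (contour t))\<^sup>2 = 3 * t\<^sup>2 / 4"
    using s by (cases "t = 0") (simp_all add: contour_def power_mult_distrib)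
qed

lemma Re_contour_ge_1: "Re (contour t) \<ge> 1"
  by (simp add: Re_Im_contour)

lemma norm_contour_le: "norm (contour t) \<le> 1 + \<bar>t\<bar>"
proof -
  have "norm (contour t) \<le> norm (1 :: complex) + norm (of_real \<bar>t\<bar> * cis (sgn t * (pi/3)))"
    unfolding contour_def by (rule norm_triangle_ineq)
  then show ?thesis by (simp add: norm_mult)
qed

text \<open>The cube of cis (pi/3) is - 1 and its square has real part - 1/2, and likewise for -
  pi/3, so both the cubic and the quadratic term in \<bar>t\<bar> are negative.\<close>

lemma Re_contour_cube: "Re (contour t ^ 3) = 1 + 3 * \<bar>t\<bar> / 2 - 3 * t\<^sup>2 / 2 - \<bar>t\<bar> ^ 3"
proof -
  let ?z = "contour t"
  have "Re (?z ^ 3) = Re ?z ^ 3 - 3 * Re ?z * (Im ?z)\<^sup>2"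
    by (simp add: power3_eq_cube power2_eq_square algebra_simps)
  also have "\<dots> = (1 + \<bar>t\<bar> / 2) ^ 3 - 3 * (1 + \<bar>t\<bar> / 2) * (3 * \<bar>t\<bar>\<^sup>2 / 4)"
    by (simp add: Re_Im_contour)
  also have "\<dots> = 1 + 3 * \<bar>t\<bar> / 2 - 3 * \<bar>t\<bar>\<^sup>2 / 2 - \<bar>t\<bar> ^ 3"
    by (simp add: power3_eq_cube power2_eq_square field_simps)
  finally show ?thesis by simp
qed

definition contour_bound :: "real \<Rightarrow> real \<Rightarrow> real" where
  "contour_bound c t = exp (Re (contour t ^ 3) / 3 + c * norm (contour t))"

lemma contour_bound_measurable [measurable]: "contour_bound c \<in> borel_measurable borel"
  unfolding contour_bound_def[abs_def] by measurable

lemma contour_bound_integrable: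
  assumes "c \<ge> 0"
  shows "integrable lborel (contour_bound c)"
proof -
  \<comment> \<open>Without the cubic term, the exponent plus \<bar>t\<bar> is at most 1/3 + c +
    (3/2 + c) \<bar>t\<bar> - t^2 / 2; \<open>K\<close> is the maximum of this parabola.\<close>
  define K where "K = 1/3 + c + (3/2 + c)\<^sup>2 / 2"
  have bound: "Re (contour t ^ 3) / 3 + c * norm (contour t) \<le> K - \<bar>t\<bar>" for t
  proof -
    have "c * norm (contour t) \<le> c * (1 + \<bar>t\<bar>)"
      by (rule mult_left_mono[OF norm_contour_le assms])
    then have lin: "c * norm (contour t) \<le> c + c * \<bar>t\<bar>" by (simp add: distrib_left)
    have "(\<bar>t\<bar> - (3/2 + c))\<^sup>2 = t\<^sup>2 - 3 * \<bar>t\<bar> - 2 * (c * \<bar>t\<bar>) + 9/4 + 3 * c + c\<^sup>2"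
      by (simp add: power2_eq_square algebra_simps)
    then have "0 \<le> t\<^sup>2 - 3 * \<bar>t\<bar> - 2 * (c * \<bar>t\<bar>) + 9/4 + 3 * c + c\<^sup>2"
      using zero_le_power2[of "\<bar>t\<bar> - (3/2 + c)"] by (simp only:)
    moreover have "3 * r / 2 + m \<le> s / 2 + (9/4 + 3 * c + q) / 2"
      if "0 \<le> s - 3 * r - 2 * m + 9/4 + 3 * c + q" for r m s q :: real
      using that by argo
    ultimately have sq: "3 * \<bar>t\<bar> / 2 + c * \<bar>t\<bar> \<le> t\<^sup>2 / 2 + (9/4 + 3 * c + c\<^sup>2) / 2"
      by blast
    have cube: "0 \<le> \<bar>t\<bar> ^ 3" by simp
    have K: "K = 1/3 + c + (9/4 + 3 * c + c\<^sup>2) / 2"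
      by (simp add: K_def power2_eq_square algebra_simps)
    have "(1 + 3 * r / 2 - 3 * s / 2 - q) / 3 + l \<le> 1/3 + c + u - r"
      if "l \<le> c + m" "3 * r / 2 + m \<le> s / 2 + u" "0 \<le> q" for r s q l m u :: real
      using that by argo
    from this[OF lin sq cube] show ?thesis
      unfolding Re_contour_cube K .
  qed
  have int: "integrable lborel (\<lambda>t :: real. exp K * exp (- \<bar>t\<bar>))"
    by (rule integrable_mult_right[OF integrable_exp_neg_abs])
  show ?thesis
  proof (rule Bochner_Integration.integrable_bound[OF int])
    show "AE t in lborel. norm (contour_bound c t) \<le> norm (exp K * exp (- \<bar>t\<bar>))"
      using bound by (intro AE_I2) (simp add: contour_bound_def flip: exp_add)
  qed simp
qed

text \<open>The substitution t -> - t carries the lower ray to the negative half line, its minus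
  sign being part of \<open>contour_direction\<close>. Integrability over the line permits the
  splitting into two rays.\<close>

lemma wedge_integral_contour:
  assumes int: "integrable lborel (\<lambda>t. f (contour t) * contour_direction t)"
  shows "wedge_integral f = (LINT t|lborel. f (contour t) * contour_direction t)"
proof -
  let ?g = "\<lambda>t. f (contour t) * contour_direction t"
  have pos: "(LINT t : {0<..} | lborel. f (1 + of_real t * cis (pi/3)) * cis (pi/3)) = (LINT t|lborel. indicator {0<..} t *\<^sub>R ?g t)"
    unfolding set_lebesgue_integral_def
    by (intro Bochner_Integration.integral_cong) (auto simp: indicator_def contour_def contour_direction_def)
  have "(LINT t : {0<..} | lborel. f (1 + of_real t * cis (-pi/3)) * cis (-pi/3)) = (LINT t|lborel. indicator {0<..} t *\<^sub>R - ?g (- t))"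
    unfolding set_lebesgue_integral_def
    by (intro Bochner_Integration.integral_cong) (auto simp: indicator_def contour_def contour_direction_def)
  also have "\<dots> = - (LINT t|lborel. indicator {0<..} t *\<^sub>R ?g (- t))"
    by simp
  also have "(LINT t|lborel. indicator {0<..} t *\<^sub>R ?g (- t)) = (LINT t|lborel. indicator {..<0} t *\<^sub>R ?g t)"
    using lborel_integral_real_affine[of "-1" "\<lambda>t. indicator {..<0} t *\<^sub>R ?g t" 0]
    by (simp add: indicator_def cong: if_cong)
  finally have neg: "(LINT t : {0<..} | lborel. f (1 + of_real t * cis (-pi/3)) * cis (-pi/3)) = - (LINT t|lborel. indicator {..<0} t *\<^sub>R ?g t)" .
  have ints: "integrable lborel (\<lambda>t. indicator {0<..} t *\<^sub>R ?g t)" "integrable lborel (\<lambda>t. indicator {..<0} t *\<^sub>R ?g t)"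
    using int by (intro integrable_mult_indicator; simp)+
  have "?g t = indicator {0<..} t *\<^sub>R ?g t + indicator {..<0} t *\<^sub>R ?g t" for t
    by (cases t "0::real" rule: linorder_cases) (simp_all add: contour_direction_def)
  then have "(LINT t|lborel. ?g t) = (LINT t|lborel. indicator {0<..} t *\<^sub>R ?g t + indicator {..<0} t *\<^sub>R ?g t)"
    by (rule Bochner_Integration.integral_cong[OF refl])
  also have "\<dots> = (LINT t|lborel. indicator {0<..} t *\<^sub>R ?g t) + (LINT t|lborel. indicator {..<0} t *\<^sub>R ?g t)"
    by (rule Bochner_Integration.integral_add[OF ints])
  finally show ?thesis
    unfolding wedge_integral_def pos neg by simp
qed

section \<open>The GSE kernel as an exponential integral over the plane\<close>

abbreviation plane :: "(real \<times> real) measure" where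
  "plane \<equiv> lborel \<Otimes>\<^sub>M lborel"

text \<open>The part of the integrand that does not depend on x and y, including the Jacobian of the
  two contours.\<close>

definition gse_amplitude :: "real \<times> real \<Rightarrow> complex" where
  "gse_amplitude w = (let z = contour (fst w); u = contour (snd w) in
     (z - u) / (4 * z * u * (z + u)) * exp (z^3 / 3 + u^3 / 3) *
     (contour_direction (fst w) * contour_direction (snd w)) / (2 * of_real pi * \<i>)\<^sup>2)"

lemma gse_amplitude_measurable [measurable]: "gse_amplitude \<in> borel_measurable plane"
  unfolding gse_amplitude_def[abs_def] Let_def by measurable

interpretation gse: exponential_family plane "\<lambda>w. contour (fst w)" "\<lambda>w. contour (snd w)"
  by unfold_locales measurable

text \<open>On Re \<ge> 1 one has |z|, |u| \<ge> 1 and |z + u| \<ge> 2, so the rational factor stays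
  away from its poles and is at most 1; the decay comes from the cubes alone.\<close>

lemma norm_gse_amplitude: "norm (gse_amplitude w) \<le> contour_bound 0 (fst w) * contour_bound 0 (snd w)"
proof -
  let ?z = "contour (fst w)" and ?u = "contour (snd w)"
  have ge: "norm ?z \<ge> 1" "norm ?u \<ge> 1" "norm (?z + ?u) \<ge> 2"
    using Re_contour_ge_1[of "fst w"] Re_contour_ge_1[of "snd w"]
      complex_Re_le_cmod[of ?z] complex_Re_le_cmod[of ?u] complex_Re_le_cmod[of "?z + ?u"]
    by (simp_all only: plus_complex.sel)
  have "0 \<le> (norm ?z - 1) * norm ?u" "0 \<le> (norm ?u - 1) * norm ?z"
    using ge(1,2) by simp_all
  then have "norm ?u \<le> norm ?z * norm ?u" "norm ?z \<le> norm ?z * norm ?u"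
    by (simp_all add: algebra_simps)
  then have num: "norm (?z - ?u) \<le> 2 * (norm ?z * norm ?u)"
    using norm_triangle_ineq4[of ?z ?u] by linarith
  have "norm (4 * ?z * ?u * (?z + ?u)) = 4 * (norm ?z * norm ?u * norm (?z + ?u))"
    by (simp add: norm_mult)
  moreover have "norm ?z * norm ?u * 2 \<le> norm ?z * norm ?u * norm (?z + ?u)"
    by (rule mult_left_mono[OF ge(3)]) simp
  moreover have "0 \<le> norm ?z * norm ?u" by simp
  ultimately have "norm (?z - ?u) \<le> norm (4 * ?z * ?u * (?z + ?u))"
    using num by linarith
  moreover have "norm (4 * ?z * ?u * (?z + ?u)) > 0"
    using ge unfolding norm_mult by (intro mult_pos_pos) (simp, linarith+)
  ultimately have ratio: "norm ((?z - ?u) / (4 * ?z * ?u * (?z + ?u))) \<le> 1"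
    by (simp only: norm_divide divide_le_eq_1_pos)
  have e: "norm (exp (?z^3 / 3 + ?u^3 / 3)) = contour_bound 0 (fst w) * contour_bound 0 (snd w)"
    by (simp add: contour_bound_def flip: exp_add)
  have d: "norm (contour_direction (fst w) * contour_direction (snd w)) \<le> 1"
    unfolding norm_mult by (intro mult_le_one norm_contour_direction) simp
  have "(2 * pi)\<^sup>2 \<ge> 1" using pi_gt3 by (intro one_le_power) simp
  then have p: "norm ((2 * of_real pi * \<i>)\<^sup>2 :: complex) \<ge> 1"
    by (simp add: norm_power norm_mult)
  have "norm (gse_amplitude w) = norm ((?z - ?u) / (4 * ?z * ?u * (?z + ?u))) * norm (exp (?z^3 / 3 + ?u^3 / 3)) *
     norm (contour_direction (fst w) * contour_direction (snd w)) / norm ((2 * of_real pi * \<i>)\<^sup>2 :: complex)"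
    unfolding gse_amplitude_def Let_def by (simp only: norm_mult norm_divide)
  also have "\<dots> \<le> 1 * norm (exp (?z^3 / 3 + ?u^3 / 3)) * 1 / 1"
    by (intro frac_le mult_mono mult_nonneg_nonneg ratio d p) simp_all
  finally show ?thesis unfolding e by simp
qed

lemma contour_bound_pair_integrable:
  assumes "c \<ge> 0"
  shows "integrable plane (\<lambda>w. contour_bound c (fst w) * contour_bound c (snd w))"
proof (rule lborel_pair.Fubini_integrable)
  show "(\<lambda>w. contour_bound c (fst w) * contour_bound c (snd w)) \<in> borel_measurable plane" by measurable
  show "integrable lborel (\<lambda>t. LINT u|lborel. norm (contour_bound c (fst (t, u)) * contour_bound c (snd (t, u))))"
  proof -
    have "norm (contour_bound c t * contour_bound c u) = contour_bound c t * contour_bound c u" for t u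
      by (simp add: contour_bound_def)
    then show ?thesis
      unfolding fst_conv snd_conv
      by (simp only: integral_mult_right_zero) (rule integrable_mult_left[OF contour_bound_integrable[OF assms]])
  qed
  show "AE t in lborel. integrable lborel (\<lambda>u. contour_bound c (fst (t, u)) * contour_bound c (snd (t, u)))"
    using contour_bound_integrable[OF assms] by (intro AE_I2) simp
qed

lemma gse_amplitude_weight_bound:
  "norm (gse_amplitude w) * exp (c * gse.weight w) \<le> contour_bound c (fst w) * contour_bound c (snd w)"
proof -
  have "contour_bound 0 t * exp (c * norm (contour t)) = contour_bound c t" for t
    by (simp add: contour_bound_def exp_add)
  then have "contour_bound c (fst w) * contour_bound c (snd w)
      = contour_bound 0 (fst w) * contour_bound 0 (snd w) * exp (c * gse.weight w)"
    by (simp add: gse.weight_def distrib_left exp_add[of "c * norm (contour (fst w))"] mult_ac flip: \<open>\<And>t. contour_bound 0 t * exp (c * norm (contour t)) = contour_bound c t\<close>)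
  then show ?thesis
    using mult_right_mono[OF norm_gse_amplitude, of "exp (c * gse.weight w)" w] by simp
qed

lemma gse_amplitude_admissible: "gse.admissible gse_amplitude"
  unfolding gse.admissible_def
proof (intro conjI allI impI)
  fix c :: real assume c: "c \<ge> 0"
  show "integrable plane (\<lambda>w. norm (gse_amplitude w) * exp (c * gse.weight w))"
  proof (rule Bochner_Integration.integrable_bound[OF contour_bound_pair_integrable[OF c]])
    show "AE w in plane. norm (norm (gse_amplitude w) * exp (c * gse.weight w)) \<le> norm (contour_bound c (fst w) * contour_bound c (snd w))"
      using gse_amplitude_weight_bound[of _ c] by (intro AE_I2) (simp add: contour_bound_def[of c])
  qed measurable
qed measurable

lemma gse_integral_eq: "gse_integral x y = (LINT w|plane. gse_amplitude w * exp (- gse.phase (x, y) w))"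
proof -
  define G where "G w = gse_amplitude w * exp (- gse.phase (x, y) w)" for w
  let ?f = "\<lambda>z w. (z - w) / (4 * z * w * (z + w)) *
       exp (z^3 / 3 + w^3 / 3 - of_real x * z - of_real y * w) / (2 * of_real pi * \<i>)"
  have G_int: "integrable plane G"
    unfolding G_def by (rule gse.transform_integrable[OF gse_amplitude_admissible])
  have f: "?f (contour t) (contour u) * contour_direction u * contour_direction t / (2 * of_real pi * \<i>) = G (t, u)" for t u
  proof -
    have exp: "exp (c - p - q) = exp c * exp (- (p + q))" for c p q :: complex
    proof -
      have "c - p - q = c + - (p + q)" by simp
      then show ?thesis by (simp only: exp_add)
    qed
    have arrange: "r * (e * e') / k * du * dt / k = r * e * (dt * du) / k\<^sup>2 * e'" for r e e' k du dt :: complex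
      by (simp add: power2_eq_square)
    show ?thesis
      unfolding G_def gse_amplitude_def gse.phase_def Let_def fst_conv snd_conv exp arrange ..
  qed
  \<comment> \<open>Fubini would give this for almost every t; the inner contour integral is
    rewritten for every t.\<close>
  have sec: "integrable lborel (\<lambda>u. G (t, u))" for t
  proof (rule Bochner_Integration.integrable_bound[OF integrable_mult_right[OF contour_bound_integrable[OF norm_ge_zero[of "(x, y)"]], of "contour_bound (norm (x, y)) t"]])
    have "G \<in> borel_measurable plane" using G_int by (rule borel_measurable_integrable)
    then show "(\<lambda>u. G (t, u)) \<in> borel_measurable lborel" by measurable
    have "norm (G w) \<le> norm (gse_amplitude w) * exp (norm (x, y) * gse.weight w)" for w
      unfolding G_def norm_mult by (intro mult_left_mono gse.norm_exp_phase) simp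
    then have "norm (G w) \<le> contour_bound (norm (x, y)) (fst w) * contour_bound (norm (x, y)) (snd w)" for w
      using gse_amplitude_weight_bound[of w "norm (x, y)"] order_trans by blast
    from this[of "(t, u)" for u] show "AE u in lborel. norm (G (t, u)) \<le> norm (contour_bound (norm (x, y)) t * contour_bound (norm (x, y)) u)"
      by (intro AE_I2) (simp add: contour_bound_def[of "norm (x, y)"])
  qed
  \<comment> \<open>Where the direction is 0 both sides vanish. Elsewhere the constant
    \<open>k\<close> can be divided out, which passes from integrability of the section of
    \<open>G\<close> to that of the inner contour integrand.\<close>
  have inner: "wedge_integral (?f (contour t)) / (2 * of_real pi * \<i>) * contour_direction t = (LINT u|lborel. G (t, u))" for t
  proof (cases "contour_direction t = 0")
    case True
    then have "G (t, u) = 0" for u using f[of t u] by (metis mult_zero_right div_0)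
    then show ?thesis using True by simp
  next
    case False
    define k where "k = contour_direction t / (2 * of_real pi * \<i>)"
    have k: "k \<noteq> 0" using False by (simp add: k_def)
    have fk: "?f (contour t) (contour u) * contour_direction u = G (t, u) / k" for u
    proof -
      have "G (t, u) = ?f (contour t) (contour u) * contour_direction u * k"
        unfolding k_def f[symmetric] by (simp only: times_divide_eq_right)
      then show ?thesis using k by simp
    qed
    have "integrable lborel (\<lambda>u. ?f (contour t) (contour u) * contour_direction u)"
      unfolding fk using sec by (rule integrable_divide)
    then have "wedge_integral (?f (contour t)) = (LINT u|lborel. ?f (contour t) (contour u) * contour_direction u)"
      by (rule wedge_integral_contour)
    also have "\<dots> = (LINT u|lborel. G (t, u)) / k"
      unfolding fk by (rule integral_divide_zero)
    finally have w: "wedge_integral (?f (contour t)) = (LINT u|lborel. G (t, u)) / k" .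
    have "wedge_integral (?f (contour t)) / (2 * of_real pi * \<i>) * contour_direction t = wedge_integral (?f (contour t)) * k"
      by (simp add: k_def)
    then show ?thesis unfolding w using k by simp
  qed
  have "integrable lborel (\<lambda>t. wedge_integral (?f (contour t)) / (2 * of_real pi * \<i>) * contour_direction t)"
    unfolding inner by (rule lborel_pair.integrable_fst'[OF G_int])
  then have "gse_integral x y = (LINT t|lborel. wedge_integral (?f (contour t)) / (2 * of_real pi * \<i>) * contour_direction t)"
    unfolding gse_integral_def by (rule wedge_integral_contour)
  also have "\<dots> = (LINT t|lborel. LINT u|lborel. G (t, u))" unfolding inner ..
  also have "\<dots> = (LINT w|plane. G w)" by (rule lborel_pair.integral_fst'[OF G_int])
  finally show ?thesis by (simp only: G_def)
qed

lemma K_GSE_11_transform: "case_prod K_GSE_11 = gse.transform gse_amplitude"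
  by (auto simp: K_GSE_11_def gse_integral_eq gse.transform_def)

text \<open>Exchanging the two integration variables turns the integrand for (x, y) into minus the
  one for (y, x), because of the factor z - w.\<close>

lemma K_GSE_11_antisymmetric: "K_GSE_11 x y = - K_GSE_11 y x"
proof -
  define G where "G p w = gse_amplitude w * exp (- gse.phase p w)" for p w
  have swap: "G (x, y) (u, t) = - G (y, x) (t, u)" for t u
  proof -
    let ?t = "contour t" and ?u = "contour u"
    have "4 * ?u * ?t * (?u + ?t) = 4 * ?t * ?u * (?t + ?u)" by (simp add: algebra_simps)
    then have ratio: "(?u - ?t) / (4 * ?u * ?t * (?u + ?t)) = - ((?t - ?u) / (4 * ?t * ?u * (?t + ?u)))"
      by (simp only: minus_divide_left minus_diff_eq)
    show ?thesis
      unfolding G_def gse_amplitude_def gse.phase_def Let_def fst_conv snd_conv ratio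
        add.commute[of "?u ^ 3 / 3" "?t ^ 3 / 3"] mult.commute[of "contour_direction u" "contour_direction t"]
        add.commute[of "of_real x * ?u" "of_real y * ?t"]
      by (simp only: mult_minus_left minus_divide_left[symmetric])
  qed
  have "integrable plane (G (x, y))"
    unfolding G_def by (rule gse.transform_integrable[OF gse_amplitude_admissible])
  then have "(LINT (t, u)|plane. G (x, y) (u, t)) = (LINT w|plane. G (x, y) w)"
    by (intro lborel_pair.integral_product_swap borel_measurable_integrable)
  moreover have "(LINT (t, u)|plane. G (x, y) (u, t)) = - (LINT w|plane. G (y, x) w)"
    unfolding swap by (simp add: case_prod_beta')
  ultimately have "gse_integral x y = - gse_integral y x"
    unfolding gse_integral_eq G_def by simp
  then show ?thesis by (simp add: K_GSE_11_def)
qed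

lemma decaying_kernel_K_GSE_11: "\<exists>C. decaying_kernel K_GSE_11 x0 C 1 0"
proof -
  let ?g = gse_amplitude
  let ?gy = "\<lambda>w. - gse.phase (0, 1) w * ?g w"
  let ?gxy = "\<lambda>w. - gse.phase (1, 0) w * ?gy w"
  have adm: "gse.admissible ?g" "gse.admissible ?gy" "gse.admissible ?gxy"
    by (intro gse.admissible_times_phase gse_amplitude_admissible)+
  have smooth: "smooth (case_prod K_GSE_11)"
    unfolding K_GSE_11_transform by (rule gse.transform_smooth[OF adm(1)])
  have dy: "case_prod (dy K_GSE_11) = gse.transform ?gy"
    unfolding dy_eq_frechet[OF smooth] K_GSE_11_transform gse.frechet_derivative_transform[OF adm(1)] ..
  have dxdy: "case_prod (dx (dy K_GSE_11)) = gse.transform ?gxy"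
    unfolding dx_eq_frechet[OF smooth_dy[OF smooth]] dy gse.frechet_derivative_transform[OF adm(2)] ..
  define I where "I g = (LINT w|plane. norm (g w) * exp (\<bar>x0\<bar> * gse.weight w)) * exp (2 * x0)" for g :: "real \<times> real \<Rightarrow> complex"
  have I: "\<bar>gse.transform g (x, y)\<bar> \<le> I g * exp (- x - y)" if "gse.admissible g" "x > x0" "y > x0" for g x y
    unfolding I_def using that Re_contour_ge_1 by (intro gse.transform_decay) auto
  have I0: "I g \<ge> 0" for g unfolding I_def by (intro mult_nonneg_nonneg Bochner_Integration.integral_nonneg) auto
  \<comment> \<open>The summand 1 gives C > 0. All three functions decay like exp (- x - y); on the
    half line a surplus exp (- y) or exp (- x - y) is at most exp (- x0) or exp (- 2 * x0), which
    enters the constant.\<close>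
  define C where "C = 1 + I ?g + I ?gy * exp (- x0) + I ?gxy * exp (- 2 * x0)"
  have C: "I ?g \<le> C" "I ?gy * exp (- x0) \<le> C" "I ?gxy * exp (- 2 * x0) \<le> C" "C > 0"
    using I0[of ?g] mult_nonneg_nonneg[OF I0[of ?gy], of "exp (- x0)"] mult_nonneg_nonneg[OF I0[of ?gxy], of "exp (- 2 * x0)"]
    unfolding C_def by simp_all
  have "decaying_kernel K_GSE_11 x0 C 1 0"
  proof
    show "smooth (case_prod K_GSE_11)" by (rule smooth)
    show "K_GSE_11 x y = - K_GSE_11 y x" for x y by (rule K_GSE_11_antisymmetric)
    show "C > 0" by (rule C(4))
    fix x y assume xy: "x > x0" "y > x0"
    show "\<bar>kernel_A K_GSE_11 x y $ 1 $ 1\<bar> \<le> C * exp (- 1 * x - 1 * y)"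
    proof -
      have "\<bar>K_GSE_11 x y\<bar> \<le> I ?g * exp (- x - y)"
        using I[OF adm(1) xy] fun_cong[OF K_GSE_11_transform, of "(x, y)"] by simp
      also have "\<dots> \<le> C * exp (- x - y)" by (rule mult_right_mono[OF C(1)]) simp
      finally show ?thesis by simp
    qed
    show "\<bar>kernel_A K_GSE_11 x y $ 1 $ 2\<bar> \<le> C * exp (- 1 * x + 0 * y)"
    proof -
      have "\<bar>dy K_GSE_11 x y\<bar> \<le> I ?gy * exp (- x - y)"
        using I[OF adm(2) xy] fun_cong[OF dy, of "(x, y)"] by simp
      also have "\<dots> \<le> I ?gy * (exp (- x0) * exp (- x))"
        using xy by (intro mult_left_mono[OF _ I0]) (simp flip: exp_add)
      also have "\<dots> \<le> C * exp (- x)"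
        unfolding mult.assoc[symmetric] by (rule mult_right_mono[OF C(2)]) simp
      finally show ?thesis by simp
    qed
    show "\<bar>kernel_A K_GSE_11 x y $ 2 $ 2\<bar> \<le> C * exp (0 * x + 0 * y)"
    proof -
      have "\<bar>dx (dy K_GSE_11) x y\<bar> \<le> I ?gxy * exp (- x - y)"
        using I[OF adm(3) xy] fun_cong[OF dxdy, of "(x, y)"] by simp
      also have "\<dots> \<le> I ?gxy * exp (- 2 * x0)"
        using xy by (intro mult_left_mono[OF _ I0]) simp
      also have "\<dots> \<le> C" by (rule C(3))
      finally show ?thesis by simp
    qed
  qed simp
  then show ?thesis by blast
qed

theorem proposition5p2:
  shows "(\<forall>(A :: real \<Rightarrow> real \<Rightarrow> real) (x0 :: real).
            smooth (\<lambda>(x, y). A x y) \<and>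
            (\<forall>x y. A x y = - A y x) \<and>
            (\<exists>C a b :: real. C > 0 \<and> a > b \<and> b \<ge> 0 \<and>
              (\<forall>x > x0. \<forall>y > x0.
                 \<bar>kernel_A A x y $ 1 $ 1\<bar> < C * exp (- a * x - a * y) \<and>
                 \<bar>kernel_A A x y $ 1 $ 2\<bar> < C * exp (- a * x + b * y) \<and>
                 \<bar>kernel_A A x y $ 2 $ 2\<bar> < C * exp (b * x + b * y)))
            \<longrightarrow> fredholm_pfaffian_converges (kernel_A A) x0 \<and>
                dist_fredholm_pfaffian_converges (kernel_B A) x0 \<and>
                fredholm_pfaffian (kernel_A A) x0 = dist_fredholm_pfaffian (kernel_B A) x0)
       \<and> (\<forall>x0 :: real.
            fredholm_pfaffian_converges K_GSE x0 \<and>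
            dist_fredholm_pfaffian_converges K_infty x0 \<and>
            fredholm_pfaffian K_GSE x0 = dist_fredholm_pfaffian K_infty x0)"
proof (intro conjI allI impI)
  fix A :: "real \<Rightarrow> real \<Rightarrow> real" and x0 :: real
  assume asm: "smooth (\<lambda>(x, y). A x y) \<and> (\<forall>x y. A x y = - A y x) \<and>
    (\<exists>C a b :: real. C > 0 \<and> a > b \<and> b \<ge> 0 \<and>
      (\<forall>x > x0. \<forall>y > x0.
         \<bar>kernel_A A x y $ 1 $ 1\<bar> < C * exp (- a * x - a * y) \<and>
         \<bar>kernel_A A x y $ 1 $ 2\<bar> < C * exp (- a * x + b * y) \<and>
         \<bar>kernel_A A x y $ 2 $ 2\<bar> < C * exp (b * x + b * y)))"
  then obtain C a b :: real where C: "C > 0" "a > b" and bounds: "\<And>x y. x > x0 \<Longrightarrow> y > x0 \<Longrightarrow>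
         \<bar>kernel_A A x y $ 1 $ 1\<bar> < C * exp (- a * x - a * y) \<and>
         \<bar>kernel_A A x y $ 1 $ 2\<bar> < C * exp (- a * x + b * y) \<and>
         \<bar>kernel_A A x y $ 2 $ 2\<bar> < C * exp (b * x + b * y)"
    by blast
  interpret decaying_kernel A x0 C a b
  proof
    show "smooth (case_prod A)" using asm by blast
    show "A x y = - A y x" for x y using asm by blast
    show "\<bar>kernel_A A x y $ 1 $ 1\<bar> \<le> C * exp (- a * x - a * y)" if "x > x0" "y > x0" for x y
      using bounds[OF that] by (blast intro: less_imp_le)
    show "\<bar>kernel_A A x y $ 1 $ 2\<bar> \<le> C * exp (- a * x + b * y)" if "x > x0" "y > x0" for x y
      using bounds[OF that] by (blast intro: less_imp_le)
    show "\<bar>kernel_A A x y $ 2 $ 2\<bar> \<le> C * exp (b * x + b * y)" if "x > x0" "y > x0" for x y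
      using bounds[OF that] by (blast intro: less_imp_le)
  qed (fact C)+
  show "fredholm_pfaffian_converges (kernel_A A) x0" "dist_fredholm_pfaffian_converges (kernel_B A) x0"
    "fredholm_pfaffian (kernel_A A) x0 = dist_fredholm_pfaffian (kernel_B A) x0"
    by (fact fredholm_pfaffians_agree)+
next
  fix x0 :: real
  obtain C where "decaying_kernel K_GSE_11 x0 C 1 0"
    using decaying_kernel_K_GSE_11 by blast
  then interpret decaying_kernel K_GSE_11 x0 C 1 0 .
  show "fredholm_pfaffian_converges K_GSE x0" "dist_fredholm_pfaffian_converges K_infty x0"
    "fredholm_pfaffian K_GSE x0 = dist_fredholm_pfaffian K_infty x0"
    unfolding K_GSE_def K_infty_def by (fact fredholm_pfaffians_agree)+
qed

end
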